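(* Assume that either $0<S^-_\phi\le S^+_\phi<1$ or $1<S^-_\phi\le S^+_\phi<+\infty$, and that, in the scalar case (respectively, in the incompressible vector-valued case), $F$ admits a continuous extension to a bounded linear functional on $H^1_0(\Omega)$ (respectively, on $H^1_0(\Omega;\mathbb{R}^d)$). Assume further that $$\lambda:=\inf_{r>0}\left\{1+\frac{r\mu''(r)}{2\mu'(r)}\right\}>-\infty .$$ If either (i) $\Phi$ is convex and $\mu''(r)\le 0$ for all $r>0$, or (ii) $\Phi$ is concave and $\mu''(r)\ge\frac{4\mu'(r)^2}{\mu(r)}$ for all $r>0$, then, for every $\epsilon\in(0,1)$, the functional $\mathcal{E}_\epsilon:L^\Phi(\Omega)\to(-\infty,+\infty]$ (in the scalar case and in the incompressible vector-valued case, respectively) is geodesically $\lambda$-convex with respect to the metric $d(\cdot,\cdot)$ on $L^\Phi(\Omega)$.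
   Context: $\Omega\subset\mathbb{R}^d$, $d=2,3$ (here $d$ is the dimension), is an open bounded domain. $\phi:[0,+\infty)\to[0,+\infty)$ is an N-function: convex, continuous, $\phi(0)=0$, $\phi(r)>0$ for $r>0$, $\lim_{r\to0}\phi(r)/r=0$, $\lim_{r\to+\infty}\phi(r)/r=+\infty$. Standing assumptions: $\phi\in C^1([0,+\infty))\cap C^3((0,+\infty))$; $\inf_{r>0}\frac{r\phi'(r)}{\phi(r)}>1$ and $\sup_{r>0}\frac{r\phi'(r)}{\phi(r)}<+\infty$. Set $\Phi(r):=\phi(\sqrt r)$ and $\mu(r):=2\Phi'(r)=\phi'(\sqrt r)/\sqrt r$; it is assumed throughout that $\Phi$ is either strictly convex ($\mu'(r)>0$ for all $r>0$) or strictly concave ($\mu'(r)<0$ for all $r>0$) on $(0,+\infty)$. Put $\omega:=1$ if $\Phi$ is convex and $\omega:=-1$ if $\Phi$ is concave. Define $$S^-_\phi:=\inf_{r>0}\frac{r\phi''(r)}{\phi'(r)},\qquad S^+_\phi:=\sup_{r>0}\frac{r\phi''(r)}{\phi'(r)}.$$ $L^\phi(\Omega)$ and $W^{1,\phi}(\Omega)$ are the Orlicz and Orlicz--Sobolev spaces of $\phi$; $W^{1,\phi}_0(\Omega)$ is the closure of $C_c^\infty(\Omega)$ in $W^{1,\phi}(\Omega)$. Metric space: $L^\Phi(\Omega):=\{c:\Omega\to\mathbb{R}\text{ measurable}: \sqrt{|c|}\in L^\phi(\Omega)\}$ (equivalently $\int_\Omega\Phi(|c|)\,dx<+\infty$).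 Let $\psi(r):=\mathrm{sgn}(r)\int_0^{|r|}\sqrt{\tfrac{\omega}{2}\mu'(s)}\,ds$, $\Psi(c)(x):=\psi(c(x))$, which maps $L^\Phi(\Omega)$ bijectively onto $L^2(\Omega)$, and $d(c_0,c_1):=\|\Psi(c_1)-\Psi(c_0)\|_{L^2(\Omega)}$. A geodesic from $c_0$ to $c_1$ is a curve $\gamma_g:[0,1]\to L^\Phi(\Omega)$ with $\gamma_g(0)=c_0$, $\gamma_g(1)=c_1$ and $d(\gamma_g(s),\gamma_g(r))=|s-r|\,d(c_0,c_1)$ for all $s,r\in[0,1]$. A functional $\mathcal{J}:L^\Phi(\Omega)\to(-\infty,+\infty]$ is geodesically $\lambda$-convex with respect to $d$ if for all $c_0,c_1\in L^\Phi(\Omega)$ there exists a geodesic $\gamma_g$ from $c_0$ to $c_1$ such that $$\mathcal{J}(\gamma_g(s))\le(1-s)\mathcal{J}(c_0)+s\mathcal{J}(c_1)-\frac{\lambda}{2}s(1-s)\,d(c_0,c_1)^2\quad\forall s\in[0,1].$$ For $\epsilon\in(0,1)$, $L^\Phi_\epsilon(\Omega):=\{c\in L^\Phi(\Omega):\epsilon\le c(x)\le 1/\epsilon\text{ a.e. in }\Omega\}$. Let $\mathcal{J}_c(c):=\int_\Omega \Phi(c)-\tfrac12\mu(c)c\,dx$. Scalar case: $F\in W^{1,\phi}_0(\Omega)^*$ admits a continuous extension to a bounded linear functional on $H^1_0(\Omega)$, still denoted $F$ (when $\Phi$ is concave, $H^1_0(\Omega)\hookrightarrow W^{1,\phi}_0(\Omega)$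 and this is the restriction), and for $c\in L^\Phi_\epsilon(\Omega)$ $$\mathcal{J}_F(c):=\inf_{u\in H^1_0(\Omega)}\Big(\int_\Omega\tfrac12\mu(c)|\nabla u|^2\,dx-F(u)\Big).$$ Incompressible vector-valued case: $F\in W^{1,\phi}_0(\Omega;\mathbb{R}^d)^*$ admits a continuous extension to a bounded linear functional on $H^1_0(\Omega;\mathbb{R}^d)$ (same convention), $\varepsilon(\boldsymbol u):=\tfrac12(\nabla\boldsymbol u+\nabla\boldsymbol u^{T})$, $H^1_{0,\mathrm{div}}(\Omega;\mathbb{R}^d):=\{\boldsymbol v\in H^1_0(\Omega;\mathbb{R}^d):\nabla\cdot\boldsymbol v=0\}$, and for $c\in L^\Phi_\epsilon(\Omega)$ $$\mathcal{J}_F(c):=\inf_{\boldsymbol u\in H^1_{0,\mathrm{div}}(\Omega;\mathbb{R}^d)}\Big(\int_\Omega\tfrac12\mu(c)|\varepsilon(\boldsymbol u)|^2\,dx-F(\boldsymbol u)\Big).$$ In either case, $\mathcal{E}_\epsilon(c):=-\omega\mathcal{J}_c(c)-\omega\mathcal{J}_F(c)$ if $c\in L^\Phi_\epsilon(\Omega)$, and $\mathcal{E}_\epsilon(c):=+\infty$ for $c\in L^\Phi(\Omega)\setminus L^\Phi_\epsilon(\Omega)$. *)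

theory Defs
  imports "HOL-Analysis.Analysis"
begin

text \<open>Elements of function spaces over \<open>\<Omega>\<close> are represented by functions on all of \<open>real^'n\<close>;
  only their values on \<open>\<Omega>\<close>, up to null sets, are relevant.\<close>

section \<open>N-functions and derived quantities\<close>

definition N_function :: "(real \<Rightarrow> real) \<Rightarrow> bool" where
  "N_function \<phi> \<longleftrightarrow>
     convex_on {0..} \<phi> \<and> continuous_on {0..} \<phi> \<and> \<phi> 0 = 0 \<and> (\<forall>r>0. \<phi> r > 0) \<and>
     ((\<lambda>r. \<phi> r / r) \<longlongrightarrow> 0) (at_right 0) \<and>
     filterlim (\<lambda>r. \<phi> r / r) at_top at_top"

definition C1_nonneg :: "(real \<Rightarrow> real) \<Rightarrow> bool" where
  "C1_nonneg \<phi> \<longleftrightarrow>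
     (\<exists>\<phi>'. continuous_on {0..} \<phi>' \<and>
        (\<forall>r\<ge>0. (\<phi> has_real_derivative \<phi>' r) (at r within {0..})))"

definition C3_pos :: "(real \<Rightarrow> real) \<Rightarrow> bool" where
  "C3_pos \<phi> \<longleftrightarrow>
     (\<forall>k<3. (deriv ^^ k) \<phi> differentiable_on {0<..}) \<and> continuous_on {0<..} ((deriv ^^ 3) \<phi>)"

definition Phi :: "(real \<Rightarrow> real) \<Rightarrow> real \<Rightarrow> real" where
  "Phi \<phi> r = \<phi> (sqrt r)"

text \<open>Used for positive arguments only, where it equals \<open>\<phi>' (sqrt r) / sqrt r\<close>.\<close>

definition mu :: "(real \<Rightarrow> real) \<Rightarrow> real \<Rightarrow> real" where
  "mu \<phi> r = 2 * deriv (Phi \<phi>) r"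

definition omega :: "(real \<Rightarrow> real) \<Rightarrow> real" where
  "omega \<phi> = (if convex_on {0<..} (Phi \<phi>) then 1 else - 1)"

text \<open>Infima and suprema are taken in the extended reals, so that they are meaningful
  without any a priori boundedness.\<close>

definition S_minus :: "(real \<Rightarrow> real) \<Rightarrow> ereal" where
  "S_minus \<phi> = (INF r\<in>{0<..}. ereal (r * deriv (deriv \<phi>) r / deriv \<phi> r))"

definition S_plus :: "(real \<Rightarrow> real) \<Rightarrow> ereal" where
  "S_plus \<phi> = (SUP r\<in>{0<..}. ereal (r * deriv (deriv \<phi>) r / deriv \<phi> r))"

definition convexity_const :: "(real \<Rightarrow> real) \<Rightarrow> ereal" where
  "convexity_const \<phi> =
     (INF r\<in>{0<..}. ereal (1 + r * deriv (deriv (mu \<phi>)) r / (2 * deriv (mu \<phi>) r)))"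

section \<open>Lebesgue and Orlicz spaces\<close>

definition L2_space :: "(real^'n) set \<Rightarrow> (real^'n \<Rightarrow> real) set" where
  "L2_space \<Omega> = {u \<in> borel_measurable (lebesgue_on \<Omega>). integrable (lebesgue_on \<Omega>) (\<lambda>x. (u x)\<^sup>2)}"

definition L2_norm :: "(real^'n) set \<Rightarrow> (real^'n \<Rightarrow> real) \<Rightarrow> real" where
  "L2_norm \<Omega> u = sqrt (integral\<^sup>L (lebesgue_on \<Omega>) (\<lambda>x. (u x)\<^sup>2))"

definition orlicz_space :: "(real \<Rightarrow> real) \<Rightarrow> (real^'n) set \<Rightarrow> (real^'n \<Rightarrow> real) set" where
  "orlicz_space \<phi> \<Omega> = {u \<in> borel_measurable (lebesgue_on \<Omega>).
     \<exists>k>0. (\<integral>\<^sup>+x. ennreal (\<phi> (\<bar>u x\<bar> / k)) \<partial>lebesgue_on \<Omega>) < \<infinity>}"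

text \<open>The Luxemburg norm.\<close>

definition orlicz_norm :: "(real \<Rightarrow> real) \<Rightarrow> (real^'n) set \<Rightarrow> (real^'n \<Rightarrow> real) \<Rightarrow> real" where
  "orlicz_norm \<phi> \<Omega> u =
     Inf {k. k > 0 \<and> (\<integral>\<^sup>+x. ennreal (\<phi> (\<bar>u x\<bar> / k)) \<partial>lebesgue_on \<Omega>) \<le> 1}"

section \<open>Test functions, weak derivatives and Sobolev spaces\<close>

definition partial_deriv :: "'n::finite \<Rightarrow> (real^'n \<Rightarrow> 'b::real_normed_vector) \<Rightarrow> real^'n \<Rightarrow> 'b" where
  "partial_deriv i f x = frechet_derivative f (at x) (axis i 1)"

primrec Ck :: "nat \<Rightarrow> (real^'n::finite \<Rightarrow> 'b::real_normed_vector) \<Rightarrow> bool" where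
  "Ck 0 f \<longleftrightarrow> continuous_on UNIV f"
| "Ck (Suc k) f \<longleftrightarrow> f differentiable_on UNIV \<and> (\<forall>i. Ck k (partial_deriv i f))"

text \<open>\<open>C\<^sub>c\<^sup>\<infinity>(\<Omega>)\<close>, each element being extended by zero outside \<open>\<Omega>\<close>.\<close>

definition test_functions :: "(real^'n) set \<Rightarrow> (real^'n::finite \<Rightarrow> 'b::real_normed_vector) set" where
  "test_functions \<Omega> = {\<eta>. (\<forall>k. Ck k \<eta>) \<and>
     compact (closure {x. \<eta> x \<noteq> 0}) \<and> closure {x. \<eta> x \<noteq> 0} \<subseteq> \<Omega>}"

text \<open>\<open>D x $ i\<close> is the weak \<open>i\<close>-th partial derivative of \<open>u\<close> at \<open>x\<close>. For a scalar \<open>u\<close>, \<open>D x\<close> is the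
  gradient; for \<open>u\<close> with values in \<open>real^'n\<close>, \<open>D x $ i $ j\<close> is the derivative of the \<open>j\<close>-th component
  in direction \<open>i\<close>, and the norm on \<open>real^'n^'n\<close> is the Frobenius norm.\<close>

definition has_weak_deriv ::
  "(real^'n) set \<Rightarrow> (real^'n \<Rightarrow> 'b::euclidean_space) \<Rightarrow> (real^'n::finite \<Rightarrow> 'b^'n) \<Rightarrow> bool" where
  "has_weak_deriv \<Omega> u D \<longleftrightarrow>
     (\<forall>K. compact K \<and> K \<subseteq> \<Omega> \<longrightarrow> integrable (lebesgue_on K) u \<and> integrable (lebesgue_on K) D) \<and>
     (\<forall>\<eta> \<in> test_functions \<Omega>. \<forall>i.
        integral\<^sup>L (lebesgue_on \<Omega>) (\<lambda>x. partial_deriv i \<eta> x *\<^sub>R u x) =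
        - integral\<^sup>L (lebesgue_on \<Omega>) (\<lambda>x. (\<eta> x :: real) *\<^sub>R (D x $ i)))"

definition weak_deriv ::
  "(real^'n) set \<Rightarrow> (real^'n \<Rightarrow> 'b::euclidean_space) \<Rightarrow> real^'n::finite \<Rightarrow> 'b^'n" where
  "weak_deriv \<Omega> u = (SOME D. has_weak_deriv \<Omega> u D)"

text \<open>The Sobolev space built on a space \<open>X\<close> of scalar functions with norm \<open>N\<close>.\<close>

definition sobolev ::
  "(real^'n \<Rightarrow> real) set \<Rightarrow> (real^'n) set \<Rightarrow> (real^'n::finite \<Rightarrow> 'b::euclidean_space) set" where
  "sobolev X \<Omega> = {u \<in> borel_measurable (lebesgue_on \<Omega>). (\<lambda>x. norm (u x)) \<in> X \<and>
     (\<exists>D. has_weak_deriv \<Omega> u D \<and> (\<lambda>x. norm (D x)) \<in> X)}"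

text \<open>For \<open>N = L2_norm \<Omega>\<close> this is equivalent to the usual Hilbert norm of \<open>H\<^sup>1(\<Omega>)\<close>, so it yields the
  same closures and the same bounded functionals.\<close>

definition sobolev_norm ::
  "((real^'n \<Rightarrow> real) \<Rightarrow> real) \<Rightarrow> (real^'n) set \<Rightarrow> (real^'n::finite \<Rightarrow> 'b::euclidean_space) \<Rightarrow> real" where
  "sobolev_norm N \<Omega> u = N (\<lambda>x. norm (u x)) + N (\<lambda>x. norm (weak_deriv \<Omega> u x))"

definition sobolev0 ::
  "(real^'n \<Rightarrow> real) set \<Rightarrow> ((real^'n \<Rightarrow> real) \<Rightarrow> real) \<Rightarrow> (real^'n) set \<Rightarrow>
     (real^'n::finite \<Rightarrow> 'b::euclidean_space) set" where
  "sobolev0 X N \<Omega> = {u \<in> sobolev X \<Omega>.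
     \<forall>e>0. \<exists>\<eta> \<in> test_functions \<Omega>. sobolev_norm N \<Omega> (\<lambda>x. u x - \<eta> x) < e}"

definition W10 ::
  "(real \<Rightarrow> real) \<Rightarrow> (real^'n) set \<Rightarrow> (real^'n::finite \<Rightarrow> 'b::euclidean_space) set" where
  "W10 \<phi> \<Omega> = sobolev0 (orlicz_space \<phi> \<Omega>) (orlicz_norm \<phi> \<Omega>) \<Omega>"

definition H10 :: "(real^'n) set \<Rightarrow> (real^'n::finite \<Rightarrow> 'b::euclidean_space) set" where
  "H10 \<Omega> = sobolev0 (L2_space \<Omega>) (L2_norm \<Omega>) \<Omega>"

definition H10_div :: "(real^'n) set \<Rightarrow> (real^'n::finite \<Rightarrow> real^'n) set" where
  "H10_div \<Omega> = {v \<in> H10 \<Omega>. AE x in lebesgue_on \<Omega>. trace (weak_deriv \<Omega> v x) = 0}"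

definition sym_grad :: "(real^'n) set \<Rightarrow> (real^'n::finite \<Rightarrow> real^'n) \<Rightarrow> real^'n \<Rightarrow> real^'n^'n" where
  "sym_grad \<Omega> u x = (1/2) *\<^sub>R (weak_deriv \<Omega> u x + transpose (weak_deriv \<Omega> u x))"

text \<open>Functions agreeing almost everywhere on \<open>\<Omega>\<close> have distance zero for the norms above, so
  boundedness forces a functional to depend on the equivalence class only.\<close>

definition bounded_functional ::
  "('a \<Rightarrow> 'b::real_vector) set \<Rightarrow> (('a \<Rightarrow> 'b) \<Rightarrow> real) \<Rightarrow> (('a \<Rightarrow> 'b) \<Rightarrow> real) \<Rightarrow> bool" where
  "bounded_functional V N F \<longleftrightarrow>
     (\<forall>u\<in>V. \<forall>v\<in>V. F (\<lambda>x. u x + v x) = F u + F v) \<and>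
     (\<forall>a. \<forall>u\<in>V. F (\<lambda>x. a *\<^sub>R u x) = a * F u) \<and>
     (\<exists>C. \<forall>u\<in>V. \<bar>F u\<bar> \<le> C * N u)"

text \<open>\<open>F\<close> is in the dual of \<open>W\<^sub>0\<^sup>1\<^sup>,\<^sup>\<phi>\<close>, and \<open>G\<close> is the induced functional on \<open>H\<^sub>0\<^sup>1\<close>. If \<open>Phi \<phi>\<close> is convex,
  then \<open>W10 \<phi> \<Omega> \<subseteq> H10 \<Omega>\<close> and \<open>G\<close> is an extension of \<open>F\<close>; if it is concave, then
  \<open>H10 \<Omega> \<subseteq> W10 \<phi> \<Omega>\<close> and \<open>G\<close> is the restriction of \<open>F\<close>.\<close>

definition extends_to_H10 ::
  "(real \<Rightarrow> real) \<Rightarrow> (real^'n) set \<Rightarrow> ((real^'n::finite \<Rightarrow> 'b::euclidean_space) \<Rightarrow> real) \<Rightarrow>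
     ((real^'n \<Rightarrow> 'b) \<Rightarrow> real) \<Rightarrow> bool" where
  "extends_to_H10 \<phi> \<Omega> F G \<longleftrightarrow>
     bounded_functional (W10 \<phi> \<Omega>) (sobolev_norm (orlicz_norm \<phi> \<Omega>) \<Omega>) F \<and>
     bounded_functional (H10 \<Omega>) (sobolev_norm (L2_norm \<Omega>) \<Omega>) G \<and>
     (\<forall>u \<in> W10 \<phi> \<Omega> \<inter> H10 \<Omega>. G u = F u)"

section \<open>The metric space and geodesic convexity\<close>

definition LPhi :: "(real \<Rightarrow> real) \<Rightarrow> (real^'n) set \<Rightarrow> (real^'n \<Rightarrow> real) set" where
  "LPhi \<phi> \<Omega> = {c \<in> borel_measurable (lebesgue_on \<Omega>). (\<lambda>x. sqrt \<bar>c x\<bar>) \<in> orlicz_space \<phi> \<Omega>}"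

definition psi :: "(real \<Rightarrow> real) \<Rightarrow> real \<Rightarrow> real" where
  "psi \<phi> r = sgn r * integral {0..\<bar>r\<bar>} (\<lambda>s. sqrt (omega \<phi> / 2 * deriv (mu \<phi>) s))"

definition LPhi_dist ::
  "(real \<Rightarrow> real) \<Rightarrow> (real^'n) set \<Rightarrow> (real^'n \<Rightarrow> real) \<Rightarrow> (real^'n \<Rightarrow> real) \<Rightarrow> real" where
  "LPhi_dist \<phi> \<Omega> c0 c1 = L2_norm \<Omega> (\<lambda>x. psi \<phi> (c1 x) - psi \<phi> (c0 x))"

definition geodesic ::
  "(real \<Rightarrow> real) \<Rightarrow> (real^'n) set \<Rightarrow> (real^'n \<Rightarrow> real) \<Rightarrow> (real^'n \<Rightarrow> real) \<Rightarrow>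
     (real \<Rightarrow> real^'n \<Rightarrow> real) \<Rightarrow> bool" where
  "geodesic \<phi> \<Omega> c0 c1 \<gamma> \<longleftrightarrow>
     (\<forall>s\<in>{0..1}. \<gamma> s \<in> LPhi \<phi> \<Omega>) \<and>
     (AE x in lebesgue_on \<Omega>. \<gamma> 0 x = c0 x) \<and> (AE x in lebesgue_on \<Omega>. \<gamma> 1 x = c1 x) \<and>
     (\<forall>s\<in>{0..1}. \<forall>r\<in>{0..1}.
        LPhi_dist \<phi> \<Omega> (\<gamma> s) (\<gamma> r) = \<bar>s - r\<bar> * LPhi_dist \<phi> \<Omega> c0 c1)"

text \<open>The first conjunct expresses that \<open>J\<close> takes values in \<open>(-\<infinity>, \<infinity>]\<close>. Note that \<open>0 * \<infinity> = 0\<close> in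
  \<open>ereal\<close>, which is relevant for \<open>s = 0\<close> and \<open>s = 1\<close> only.\<close>

definition geodesically_convex ::
  "(real \<Rightarrow> real) \<Rightarrow> (real^'n) set \<Rightarrow> real \<Rightarrow> ((real^'n \<Rightarrow> real) \<Rightarrow> ereal) \<Rightarrow> bool" where
  "geodesically_convex \<phi> \<Omega> l J \<longleftrightarrow>
     (\<forall>c\<in>LPhi \<phi> \<Omega>. J c > - \<infinity>) \<and>
     (\<forall>c0\<in>LPhi \<phi> \<Omega>. \<forall>c1\<in>LPhi \<phi> \<Omega>. \<exists>\<gamma>. geodesic \<phi> \<Omega> c0 c1 \<gamma> \<and>
        (\<forall>s\<in>{0..1}. J (\<gamma> s) \<le> ereal (1 - s) * J c0 + ereal s * J c1
                        - ereal (l / 2 * s * (1 - s) * (LPhi_dist \<phi> \<Omega> c0 c1)\<^sup>2)))"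

section \<open>The functionals\<close>

definition LPhi_eps :: "(real \<Rightarrow> real) \<Rightarrow> (real^'n) set \<Rightarrow> real \<Rightarrow> (real^'n \<Rightarrow> real) set" where
  "LPhi_eps \<phi> \<Omega> \<epsilon> = {c \<in> LPhi \<phi> \<Omega>. AE x in lebesgue_on \<Omega>. \<epsilon> \<le> c x \<and> c x \<le> 1 / \<epsilon>}"

definition J_c :: "(real \<Rightarrow> real) \<Rightarrow> (real^'n) set \<Rightarrow> (real^'n \<Rightarrow> real) \<Rightarrow> real" where
  "J_c \<phi> \<Omega> c = integral\<^sup>L (lebesgue_on \<Omega>) (\<lambda>x. Phi \<phi> (c x) - 1/2 * mu \<phi> (c x) * c x)"

definition J_F_scalar ::
  "(real \<Rightarrow> real) \<Rightarrow> (real^'n) set \<Rightarrow> ((real^'n::finite \<Rightarrow> real) \<Rightarrow> real) \<Rightarrow> (real^'n \<Rightarrow> real) \<Rightarrow> ereal" where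
  "J_F_scalar \<phi> \<Omega> F c = (INF u\<in>H10 \<Omega>. ereal
     (integral\<^sup>L (lebesgue_on \<Omega>) (\<lambda>x. 1/2 * mu \<phi> (c x) * (norm (weak_deriv \<Omega> u x))\<^sup>2) - F u))"

definition J_F_vector ::
  "(real \<Rightarrow> real) \<Rightarrow> (real^'n) set \<Rightarrow> ((real^'n::finite \<Rightarrow> real^'n) \<Rightarrow> real) \<Rightarrow> (real^'n \<Rightarrow> real) \<Rightarrow> ereal" where
  "J_F_vector \<phi> \<Omega> F c = (INF u\<in>H10_div \<Omega>. ereal
     (integral\<^sup>L (lebesgue_on \<Omega>) (\<lambda>x. 1/2 * mu \<phi> (c x) * (norm (sym_grad \<Omega> u x))\<^sup>2) - F u))"

text \<open>The argument \<open>J\<close> stands for one of the two functionals above.\<close>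

definition E_eps ::
  "(real \<Rightarrow> real) \<Rightarrow> (real^'n) set \<Rightarrow> ((real^'n \<Rightarrow> real) \<Rightarrow> ereal) \<Rightarrow> real \<Rightarrow> (real^'n \<Rightarrow> real) \<Rightarrow> ereal" where
  "E_eps \<phi> \<Omega> J \<epsilon> c =
     (if c \<in> LPhi_eps \<phi> \<Omega> \<epsilon>
      then ereal (- omega \<phi> * J_c \<phi> \<Omega> c) - ereal (omega \<phi>) * J c
      else \<infinity>)"

end

theory Submission imports Defs
begin

text \<open>
  The map \<open>psi \<phi>\<close> carries the metric space isometrically onto \<open>L\<^sup>2(\<Omega>)\<close>, so a geodesic from
  \<open>c0\<close> to \<open>c1\<close> is obtained by joining \<open>psi \<phi> \<circ> c0\<close> and \<open>psi \<phi> \<circ> c1\<close> by a straight line and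
  pulling back (\<open>segment\<close>). Its values lie between those of the endpoints, so the bounds
  \<open>\<epsilon> \<le> c \<le> 1/\<epsilon>\<close> are inherited, and every convexity question becomes a pointwise one about
  functions of \<open>t = psi \<phi> r\<close>. Write \<open>p = psi'\<close> (\<open>speed\<close>), so that
  \<open>p\<^sup>2 = \<omega> \<mu>' / 2\<close> and \<open>p' / p = \<mu>'' / (2 \<mu>')\<close>. A function \<open>g\<close> is convex in \<open>t\<close> as soon as
  \<open>g' / p\<close> is nondecreasing in \<open>r\<close> (\<open>convex_along_psi\<close>). This is used three times.

  \<^item> The integrand \<open>- \<omega> (\<Phi> - \<mu> r / 2)\<close> of \<open>- \<omega> J_c\<close> has derivative \<open>r p\<^sup>2\<close>, so after subtracting
    \<open>\<lambda> t\<^sup>2 / 2\<close> the quotient is \<open>r p - \<lambda> t\<close>, whose derivative \<open>p (1 + r \<mu>'' / (2 \<mu>') - \<lambda>)\<close> is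
    nonnegative by the choice of \<open>\<lambda>\<close>. This is where the convexity constant comes from; the second
    part of the energy is merely convex.

  \<^item> If \<open>\<Phi>\<close> is convex and \<open>\<mu>'' \<le> 0\<close>, then \<open>\<mu>\<close> is concave in \<open>t\<close> because its derivative in \<open>t\<close> is
    \<open>2 p\<close>, which is nonincreasing. Hence for each fixed \<open>u\<close> the dissipation energy is concave along the geodesic, and
    \<open>- J_F\<close> is a supremum of convex functions.

  \<^item> If \<open>\<Phi>\<close> is concave, \<open>J_F\<close> enters with a positive sign. Convexity survives the infimum over \<open>u\<close>
    when it is joint in \<open>u\<close> and \<open>t\<close>. The function \<open>\<mu>(t) \<bar>A\<bar>\<^sup>2\<close> is jointly convex
    in \<open>(t, A)\<close> when \<open>1 / \<mu>\<close> is concave in \<open>t\<close> (\<open>perspective_inequality\<close>), and this is what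
    \<open>\<mu>'' \<ge> 4 \<mu>'\<^sup>2 / \<mu>\<close> says.

  The bounds on \<open>r \<phi>'' / \<phi>'\<close> and \<open>r \<phi>' / \<phi>\<close> make \<open>p\<close> comparable to the derivative of
  \<open>sqrt \<Phi>\<close>; therefore \<open>psi \<phi>\<close> is well defined, comparable to \<open>sqrt \<Phi>\<close> and onto, and the metric
  space consists of the functions \<open>c\<close> with \<open>psi \<phi> \<circ> c\<close> in \<open>L\<^sup>2\<close>.

  Functional analysis enters only through three facts about the admissible fields \<open>u\<close>: they form a
  nonempty convex set on which the weak gradient is affine almost everywhere, and the functional is
  bounded by the \<open>L\<^sup>2\<close> norm of the (symmetric) gradient, which makes \<open>J_F\<close> finite. They are
  collected in the locale \<open>dissipation\<close>, which covers the scalar and the incompressible case at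
  once. Affinity rests on uniqueness of weak derivatives, which needs enough test functions, and
  boundedness on the inequalities of Poincare and Korn.
\<close>

section \<open>Smooth functions and bump functions\<close>

lemma partial_deriv_eq:
  "(f has_derivative f') (at x) \<Longrightarrow> partial_deriv i f x = f' (axis i 1)"
  unfolding partial_deriv_def by (simp add: frechet_derivative_at[symmetric])

lemma differentiable_on_UNIV_has_derivative:
  "f differentiable_on UNIV \<Longrightarrow> (f has_derivative frechet_derivative f (at x)) (at x)"
  by (simp add: differentiable_on_def frechet_derivative_works)

lemma Ck_continuous: "Ck k f \<Longrightarrow> continuous_on UNIV f"
  by (cases k) (auto intro: differentiable_imp_continuous_on)

lemma Ck_Suc_lower: "Ck (Suc k) f \<Longrightarrow> Ck k f"
proof (induction k arbitrary: f)
  case 0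
  then show ?case by (simp add: differentiable_imp_continuous_on)
next
  case (Suc k)
  then show ?case by (meson Ck.simps(2))
qed

lemma Ck_const: "Ck k (\<lambda>x::real^'n. c)"
proof (induction k arbitrary: c)
  case (Suc k)
  have "partial_deriv i (\<lambda>x::real^'n. c) = (\<lambda>x. 0)" for i
    by (rule ext, subst partial_deriv_eq) (auto intro!: derivative_eq_intros)
  with Suc[of 0] show ?case by (simp add: differentiable_on_def)
qed auto

lemma partial_deriv_bilinear:
  assumes "bounded_bilinear m" "f differentiable_on UNIV" "g differentiable_on UNIV"
  shows "(\<lambda>x. m (f x) (g x)) differentiable_on UNIV"
    and "partial_deriv i (\<lambda>x. m (f x) (g x)) =
           (\<lambda>x. m (partial_deriv i f x) (g x) + m (f x) (partial_deriv i g x))"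
proof -
  have *: "((\<lambda>x. m (f x) (g x)) has_derivative
        (\<lambda>h. m (f x) (frechet_derivative g (at x) h) + m (frechet_derivative f (at x) h) (g x))) (at x)" for x
    using assms by (intro bounded_bilinear.FDERIV differentiable_on_UNIV_has_derivative)
  show "(\<lambda>x. m (f x) (g x)) differentiable_on UNIV"
    using * by (auto simp: differentiable_on_def differentiable_def)
  show "partial_deriv i (\<lambda>x. m (f x) (g x)) =
           (\<lambda>x. m (partial_deriv i f x) (g x) + m (f x) (partial_deriv i g x))"
    using partial_deriv_eq[OF *] by (auto simp: partial_deriv_def fun_eq_iff)
qed

lemma partial_deriv_add:
  assumes "f differentiable_on UNIV" "g differentiable_on UNIV"
  shows "partial_deriv i (\<lambda>x. f x + g x) = (\<lambda>x. partial_deriv i f x + partial_deriv i g x)"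
  using partial_deriv_eq[OF has_derivative_add[OF assms[THEN differentiable_on_UNIV_has_derivative]]]
  by (auto simp: partial_deriv_def fun_eq_iff)

lemma Ck_add: "Ck k f \<Longrightarrow> Ck k g \<Longrightarrow> Ck k (\<lambda>x. f x + g x)"
  by (induction k arbitrary: f g)
     (auto simp: partial_deriv_add intro: continuous_on_add differentiable_on_add)

text \<open>The Leibniz rule sends a product to a sum of two products whose factors lose at most one order of smoothness; the induction therefore needs \<open>Ck_Suc_lower\<close> and \<open>Ck_add\<close>.\<close>

lemma Ck_bilinear:
  assumes "bounded_bilinear m"
  shows "Ck k f \<Longrightarrow> Ck k g \<Longrightarrow> Ck k (\<lambda>x. m (f x) (g x))"
proof (induction k arbitrary: f g)
  case 0
  then show ?case using bounded_bilinear.continuous_on[OF assms] by auto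
next
  case (Suc k)
  have "Ck k f" "Ck k g" using Suc.prems by (auto intro: Ck_Suc_lower simp del: Ck.simps)
  with Suc show ?case
    by (simp add: partial_deriv_bilinear[OF assms] Ck_add)
qed

lemmas Ck_mult = Ck_bilinear[OF bounded_bilinear_mult]
lemmas Ck_scaleR = Ck_bilinear[OF bounded_bilinear_scaleR]

lemma Ck_prod:
  fixes f :: "'i \<Rightarrow> real^'n \<Rightarrow> real"
  assumes "finite I" "\<And>i. i \<in> I \<Longrightarrow> Ck k (f i)"
  shows "Ck k (\<lambda>x. \<Prod>i\<in>I. f i x)"
  using assms by (induction rule: finite_induct) (auto intro: Ck_const Ck_mult)

text \<open>The functions \<open>P(1/t) exp(-1/t)\<close>, extended by zero, for all polynomials \<open>P\<close> at once: this
  family is closed under differentiation, so smoothness follows by induction on the order with \<open>P\<close>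
  arbitrary.\<close>

definition flat :: "real poly \<Rightarrow> real \<Rightarrow> real" where
  "flat P t = (if t > 0 then poly P (1 / t) * exp (- (1 / t)) else 0)"

lemma poly_exp_tendsto_0: "((\<lambda>x. x ^ k * poly P x * exp (- x)) \<longlongrightarrow> (0::real)) at_top"
proof (induction P arbitrary: k)
  case (pCons a P)
  have "((\<lambda>x. a * (x ^ k / exp x) + x ^ Suc k * poly P x * exp (- x)) \<longlongrightarrow> a * 0 + 0) at_top"
    by (intro tendsto_intros tendsto_power_div_exp_0 pCons)
  then show ?case by (simp add: algebra_simps exp_minus field_simps)
qed auto

text \<open>At \<open>0\<close> the right derivative vanishes because \<open>exp(-x)\<close> beats every polynomial in \<open>x = 1/t\<close>.\<close>

lemma flat_has_derivative:
  "(flat P has_real_derivative flat ([:0, 0, 1:] * (P - pderiv P)) t) (at t)"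
proof (cases "t = 0")
  case True
  have "((\<lambda>h. (1/h) ^ 1 * poly P (1/h) * exp (- (1/h))) \<longlongrightarrow> 0) (at_right 0)"
    using filterlim_compose[OF poly_exp_tendsto_0[of 1 P] filterlim_inverse_at_top_right]
    by (simp add: inverse_eq_divide)
  then have "((\<lambda>h. flat P h / h) \<longlongrightarrow> 0) (at_right 0)"
    by (rule Lim_transform_eventually)
       (auto simp: flat_def eventually_at_filter)
  moreover have "((\<lambda>h. flat P h / h) \<longlongrightarrow> 0) (at_left 0)"
    by (rule Lim_transform_eventually[OF tendsto_const])
       (auto simp: flat_def eventually_at_filter)
  ultimately have "((\<lambda>h. flat P h / h) \<longlongrightarrow> 0) (at 0)"
    by (simp add: filterlim_at_split)
  then show ?thesis using True by (simp add: DERIV_def flat_def)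
next
  case False
  show ?thesis
  proof (cases "t > 0")
    case True
    have "((\<lambda>t. poly P (1 / t) * exp (- (1 / t))) has_real_derivative
           flat ([:0, 0, 1:] * (P - pderiv P)) t) (at t)"
      using True
      by (auto intro!: derivative_eq_intros DERIV_chain2[OF poly_DERIV]
               simp: flat_def field_simps power2_eq_square)
    then show ?thesis
      by (rule has_field_derivative_transform_within_open[OF _ open_greaterThan[of 0]])
         (use True in \<open>auto simp: flat_def\<close>)
  next
    case F: False
    have "((\<lambda>t. 0) has_real_derivative flat ([:0, 0, 1:] * (P - pderiv P)) t) (at t)"
      using F by (simp add: flat_def)
    then show ?thesis
      by (rule has_field_derivative_transform_within_open[OF _ open_lessThan[of 0]])
         (use F False in \<open>auto simp: flat_def\<close>)
  qed
qed

lemma Ck_flat: "Ck k (\<lambda>x::real^'n. flat P (c * x $ i + d))"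
proof (induction k arbitrary: P)
  case 0
  have "continuous_on UNIV (flat P)" for P
    by (meson DERIV_continuous continuous_at_imp_continuous_on flat_has_derivative)
  then have "continuous_on UNIV (\<lambda>x::real^'n. flat P (c * x $ i + d))"
    by (rule continuous_on_compose2) (auto intro!: continuous_intros)
  then show ?case by simp
next
  case (Suc k)
  let ?Q = "[:0, 0, 1:] * (P - pderiv P)"
  have *: "((\<lambda>x::real^'n. flat P (c * x $ i + d)) has_derivative
         (\<lambda>h. flat ?Q (c * x $ i + d) * (c * h $ i))) (at x)" for x
  proof -
    have "(flat P has_derivative (\<lambda>h. flat ?Q (c * x $ i + d) * h)) (at (c * x $ i + d))"
      using flat_has_derivative[of P] by (simp add: has_field_derivative_def)
    moreover have "((\<lambda>x::real^'n. c * x $ i + d) has_derivative (\<lambda>h. c * h $ i)) (at x)"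
      using bounded_linear_imp_has_derivative[OF bounded_linear_vec_nth[of i]]
      by (auto intro!: derivative_eq_intros)
    ultimately show ?thesis
      by (intro has_derivative_compose[where g = "flat P" and f = "\<lambda>x. c * x $ i + d"])
  qed
  have "Ck k (\<lambda>x::real^'n. flat ?Q (c * x $ i + d) * (c * axis j 1 $ i))" for j
    by (intro Ck_mult Ck_const Suc.IH)
  moreover have "partial_deriv j (\<lambda>x::real^'n. flat P (c * x $ i + d)) =
      (\<lambda>x. flat ?Q (c * x $ i + d) * (c * axis j 1 $ i))" for j
    by (rule ext) (rule partial_deriv_eq[OF *])
  moreover have "(\<lambda>x::real^'n. flat P (c * x $ i + d)) differentiable_on UNIV"
    unfolding differentiable_on_def differentiable_def using * by blast
  ultimately show ?case unfolding Ck.simps by metis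
qed

text \<open>As \<open>m\<close> grows, these smooth functions increase to the indicator function of the open box with
  corners \<open>a\<close> and \<open>b\<close>, because \<open>exp(-1/(m s))\<close> tends to \<open>1\<close> for every \<open>s > 0\<close>.\<close>

definition bump :: "real^'n \<Rightarrow> real^'n \<Rightarrow> real \<Rightarrow> real^'n \<Rightarrow> real" where
  "bump a b m x = (\<Prod>i\<in>UNIV. flat 1 (m * x $ i + - (m * a $ i)) * flat 1 ((- m) * x $ i + m * b $ i))"

lemma flat_1: "flat 1 t = (if t > 0 then exp (- (1 / t)) else 0)"
  by (simp add: flat_def)

lemma bump_nonneg: "0 \<le> bump a b m x"
  unfolding bump_def by (intro prod_nonneg) (auto simp: flat_1)

lemma bump_le_1: "bump a b m x \<le> 1"
  unfolding bump_def by (intro prod_le_1) (auto simp: flat_1 intro!: mult_le_one)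

lemma bump_outside:
  assumes "m > 0" "x \<notin> box a b" shows "bump a b m x = 0"
proof -
  obtain i where "x $ i \<le> a $ i \<or> b $ i \<le> x $ i"
    using assms(2) by (auto simp: mem_box_cart not_less)
  then have "m * x $ i \<le> m * a $ i \<or> m * b $ i \<le> m * x $ i" using assms(1) by auto
  then have "flat 1 (m * x $ i + - (m * a $ i)) * flat 1 ((- m) * x $ i + m * b $ i) = 0"
    by (auto simp: flat_1)
  then show ?thesis unfolding bump_def by (auto simp: prod_zero_iff)
qed

lemma bump_test_function:
  assumes "m > 0" "cbox a b \<subseteq> \<Omega>"
  shows "bump a b m \<in> test_functions \<Omega>"
proof -
  have "closure {x. bump a b m x \<noteq> 0} \<subseteq> cbox a b"
    by (rule closure_minimal) (use bump_outside[OF assms(1), of _ a b] box_subset_cbox[of a b] in auto)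
  moreover have "Ck k (bump a b m)" for k
    unfolding bump_def[abs_def] by (intro Ck_prod Ck_mult Ck_flat) auto
  moreover have "compact (closure {x. bump a b m x \<noteq> 0})"
    using calculation(1) by (meson bounded_cbox bounded_subset closed_closure compact_eq_bounded_closed)
  ultimately show ?thesis using assms(2) by (auto simp: test_functions_def)
qed

lemma bump_tendsto:
  "(\<lambda>n. bump a b (real (Suc n)) x) \<longlonglongrightarrow> indicator (box a b) x"
proof (cases "x \<in> box a b")
  case False
  then show ?thesis by (simp add: bump_outside)
next
  case True
  have *: "(\<lambda>n. flat 1 (real (Suc n) * s)) \<longlonglongrightarrow> 1" if "s > 0" for s
  proof -
    have "(\<lambda>n. exp (- (1 / s) * (1 / real (Suc n)))) \<longlonglongrightarrow> exp (- (1 / s) * 0)"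
      by (intro tendsto_intros lim_1_over_n[THEN LIMSEQ_Suc])
    then show ?thesis using that by (simp add: flat_1 mult.commute)
  qed
  have "(\<lambda>n. bump a b (real (Suc n)) x) \<longlonglongrightarrow> (\<Prod>i\<in>(UNIV::'a set). 1 * 1)"
    unfolding bump_def
  proof (intro tendsto_prod tendsto_mult)
    fix i
    have "a $ i < x $ i" "x $ i < b $ i" using True by (auto simp: mem_box_cart)
    then show "(\<lambda>n. flat 1 (real (Suc n) * x $ i + - (real (Suc n) * a $ i))) \<longlonglongrightarrow> 1"
      "(\<lambda>n. flat 1 (- real (Suc n) * x $ i + real (Suc n) * b $ i)) \<longlonglongrightarrow> 1"
      using *[of "x $ i - a $ i"] *[of "b $ i - x $ i"] by (simp_all add: algebra_simps)
  qed
  with True show ?thesis by simp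
qed

lemma borel_imp_lebesgue_measurable: "f \<in> borel_measurable borel \<Longrightarrow> f \<in> borel_measurable lebesgue"
  by (rule measurable_completion) simp

section \<open>Uniqueness of weak derivatives\<close>

lemma mem_centered_box:
  "(\<And>i. i \<in> Basis \<Longrightarrow> \<bar>x \<bullet> i\<bar> < r) \<Longrightarrow> x \<in> box (- r *\<^sub>R One) (r *\<^sub>R One :: 'a::euclidean_space)"
  by (simp add: mem_box abs_less_iff minus_less_iff)

text \<open>The boxes form an intersection-stable generator of the Borel sets, and the sets over which \<open>f\<close>
  integrates to zero form a Dynkin system. Hence \<open>f\<close> integrates to zero over \<open>{f > 0}\<close> and \<open>{f < 0}\<close>.\<close>

lemma AE_zero_if_box_integrals_zero:
  fixes f :: "'a::euclidean_space \<Rightarrow> real"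
  assumes f: "integrable lborel f"
    and zero: "\<And>a b. (LINT x:box a b|lborel. f x) = 0"
  shows "AE x in lborel. f x = 0"
proof -
  have [measurable]: "f \<in> borel_measurable borel" using f by auto
  have int: "set_integrable lborel A f" if "A \<in> sets borel" for A
    using f that unfolding set_integrable_def by (intro integrable_mult_indicator) auto
  let ?G = "range (\<lambda>(a, b). box a b :: 'a set)"
  have gen: "sets borel = sigma_sets UNIV ?G"
    by (subst borel_eq_box) simp
  have stable: "Int_stable ?G"
  proof (rule Int_stableI)
    fix X Y :: "'a set" assume "X \<in> ?G" "Y \<in> ?G"
    then obtain a b c d :: 'a where "X = box a b" "Y = box c d" by auto
    then have "X \<inter> Y = box (\<Sum>i\<in>Basis. max (a \<bullet> i) (c \<bullet> i) *\<^sub>R i) (\<Sum>i\<in>Basis. min (b \<bullet> i) (d \<bullet> i) *\<^sub>R i)"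
      by (auto simp: box_Int_box)
    then show "X \<inter> Y \<in> ?G" by auto
  qed
  have whole: "(LINT x|lborel. f x) = 0"
  proof -
    define B where "B n = box (- real (Suc n) *\<^sub>R One) (real (Suc n) *\<^sub>R One :: 'a)" for n
    have "(\<lambda>n. LINT x:B n|lborel. f x) \<longlonglongrightarrow> (LINT x|lborel. f x)"
      unfolding set_lebesgue_integral_def
    proof (rule integral_dominated_convergence[where w = "\<lambda>x. \<bar>f x\<bar>"])
      show "AE x in lborel. (\<lambda>n. indicat_real (B n) x *\<^sub>R f x) \<longlonglongrightarrow> f x"
      proof (intro AE_I2 tendsto_eventually)
        fix x :: 'a
        obtain N :: nat where N: "norm x < real N" using reals_Archimedean2 by blast
        have "x \<in> B n" if "N \<le> n" for n
        proof -
          have "\<bar>x \<bullet> i\<bar> < real (Suc n)" if "i \<in> Basis" for i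
            using Basis_le_norm[OF that, of x] N \<open>N \<le> n\<close> by linarith
          then show ?thesis unfolding B_def by (rule mem_centered_box)
        qed
        then show "\<forall>\<^sub>F n in sequentially. indicat_real (B n) x *\<^sub>R f x = f x"
          unfolding eventually_sequentially by (intro exI[of _ N]) auto
      qed
      have "B n \<in> sets lborel" for n by (simp add: B_def)
      then show "(\<lambda>x. indicat_real (B n) x *\<^sub>R f x) \<in> borel_measurable lborel" for n
        by (intro borel_measurable_scaleR borel_measurable_indicator) auto
      show "AE x in lborel. norm (indicat_real (B n) x *\<^sub>R f x) \<le> \<bar>f x\<bar>" for n
        by (intro AE_I2) (simp split: split_indicator)
    qed (use f in auto)
    then show ?thesis by (simp only: B_def zero LIMSEQ_const_iff)
  qed
  have closed: "?G \<subseteq> Pow UNIV" by simp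
  have set_zero: "(LINT x:A|lborel. f x) = 0" if "A \<in> sets borel" for A
    using stable closed that[unfolded gen]
  proof (induction rule: sigma_sets_induct_disjoint)
    case (union A)
    then have "\<And>i. A i \<in> sets lborel" by (auto simp: gen)
    then show ?case
      using union by (subst lebesgue_integral_countable_add)
        (auto simp: disjoint_family_on_def intro!: int)
  next
    case (compl A)
    then have A: "A \<in> sets borel" by (simp add: gen)
    have "(LINT x:UNIV - A|lborel. f x) = (LINT x|lborel. f x - indicator A x *\<^sub>R f x)"
      unfolding set_lebesgue_integral_def
      by (intro Bochner_Integration.integral_cong) (auto split: split_indicator)
    also have "\<dots> = 0"
      using int[OF A] compl f whole unfolding set_integrable_def set_lebesgue_integral_def by simp
    finally show ?case .
  qed (auto simp: zero set_lebesgue_integral_def[of _ "{}"])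
  \<comment> \<open>Used with \<open>s = 1\<close> and \<open>s = -1\<close>, which treats the positive and the negative part together.\<close>
  have "AE x in lborel. indicator {x. 0 < s * f x} x * (s * f x) = 0" for s
  proof -
    have A: "{x. 0 < s * f x} \<in> sets borel" by measurable
    have "(LINT x|lborel. indicator {x. 0 < s * f x} x * (s * f x)) = s * (LINT x:{x. 0 < s * f x}|lborel. f x)"
      unfolding set_lebesgue_integral_def
      by (subst integral_mult_right_zero[symmetric]) (simp add: mult_ac)
    moreover have "integrable lborel (\<lambda>x. indicator {x. 0 < s * f x} x * (s * f x))"
      using integrable_mult_right[OF int[OF A, unfolded set_integrable_def], of s]
      by (simp add: mult_ac)
    ultimately show ?thesis
      using set_zero[OF A]
      by (subst integral_nonneg_eq_0_iff_AE[symmetric]) (auto split: split_indicator)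
  qed
  from this[of 1] this[of "-1"] show ?thesis
  proof eventually_elim
    case (elim x)
    then show ?case by (cases "f x" "0::real" rule: linorder_cases) auto
  qed
qed

lemma integral_lebesgue_on_support:
  fixes g :: "'a::euclidean_space \<Rightarrow> 'b::{banach, second_countable_topology}"
  assumes "S \<in> sets lebesgue" "\<And>x. x \<notin> S \<Longrightarrow> g x = 0"
  shows "integral\<^sup>L (lebesgue_on S) g = integral\<^sup>L lebesgue g"
    and "integrable (lebesgue_on S) g \<longleftrightarrow> integrable lebesgue g"
proof -
  have *: "indicator S x *\<^sub>R g x = g x" for x using assms(2)[of x] by (cases "x \<in> S") auto
  have S: "S \<inter> space lebesgue \<in> sets lebesgue" using assms(1) by simp
  show "integral\<^sup>L (lebesgue_on S) g = integral\<^sup>L lebesgue g"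
    unfolding integral_restrict_space[OF S] by (simp only: *)
  show "integrable (lebesgue_on S) g \<longleftrightarrow> integrable lebesgue g"
    unfolding integrable_restrict_space[OF S] by (simp only: *)
qed

lemma AE_lebesgue_on_iff:
  "S \<in> sets lebesgue \<Longrightarrow> (AE x in lebesgue_on S. P x) \<longleftrightarrow> (AE x in lebesgue. x \<in> S \<longrightarrow> P x)"
  by (simp add: AE_restrict_space_iff)

text \<open>Elements of a Sobolev space are only integrable on compact subsets of the domain; multiplying by
  a test function makes them integrable on the whole space.\<close>

lemma integrable_cutoff:
  fixes f :: "'a::euclidean_space \<Rightarrow> 'b::euclidean_space" and \<eta> :: "'a \<Rightarrow> real"
  assumes "compact K" and f: "integrable (lebesgue_on K) f"
    and \<eta>: "continuous_on UNIV \<eta>" "\<And>x. x \<notin> K \<Longrightarrow> \<eta> x = 0"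
  shows "integrable lebesgue (\<lambda>x. \<eta> x *\<^sub>R f x)"
proof -
  have K: "K \<in> sets lebesgue" using assms(1) by (simp add: compact_imp_closed)
  have "bounded (\<eta> ` K)"
    using compact_continuous_image[OF continuous_on_subset[OF \<eta>(1)] \<open>compact K\<close>]
    by (auto dest!: compact_imp_bounded)
  then obtain M where M: "\<And>x. x \<in> K \<Longrightarrow> \<bar>\<eta> x\<bar> \<le> \<bar>M\<bar>"
    unfolding bounded_iff by (metis abs_ge_self image_eqI order_trans real_norm_def)
  have "\<eta> \<in> borel_measurable borel" by (rule borel_measurable_continuous_onI[OF \<eta>(1)])
  then have "\<eta> \<in> borel_measurable (lebesgue_on K)"
    by (intro measurable_restrict_space1 borel_imp_lebesgue_measurable)
  then have "integrable (lebesgue_on K) (\<lambda>x. \<eta> x *\<^sub>R f x)"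
    using f M
    by (intro Bochner_Integration.integrable_bound[OF integrable_scaleR_right[OF f, of M]])
       (auto intro!: AE_I2 mult_right_mono borel_measurable_scaleR)
  then show ?thesis
    by (subst (asm) integral_lebesgue_on_support(2)[OF K]) (simp_all add: \<eta>(2))
qed

text \<open>Letting the bump functions increase to indicators turns the hypothesis into the vanishing of
  all box integrals. The passage through a Borel representative \<open>g\<close> of a component is needed because
  \<open>d\<close> is only Lebesgue measurable.\<close>

lemma AE_zero_if_bump_integrals_zero:
  fixes d :: "real^'n \<Rightarrow> 'b::euclidean_space"
  assumes d: "integrable (lebesgue_on (cbox a b)) d"
    and zero: "\<And>p q m. m > 0 \<Longrightarrow> cbox p q \<subseteq> cbox a b \<Longrightarrow>
       integral\<^sup>L lebesgue (\<lambda>x. bump p q m x *\<^sub>R d x) = 0"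
  shows "AE x in lebesgue. x \<in> cbox a b \<longrightarrow> d x = 0"
proof -
  define e where "e x = indicator (cbox a b) x *\<^sub>R d x" for x
  have e: "integrable lebesgue e"
    using d unfolding e_def by (simp add: integrable_restrict_space)
  have sub: "(LINT x:box p q|lebesgue. d x) = 0" if pq: "cbox p q \<subseteq> cbox a b" for p q
  proof -
    have "(\<lambda>n. integral\<^sup>L lebesgue (\<lambda>x. bump p q (real (Suc n)) x *\<^sub>R e x)) \<longlonglongrightarrow>
        integral\<^sup>L lebesgue (\<lambda>x. indicator (box p q) x *\<^sub>R e x)"
    proof (rule integral_dominated_convergence[where w = "\<lambda>x. norm (e x)"])
      show "(\<lambda>x. bump p q (real (Suc n)) x *\<^sub>R e x) \<in> borel_measurable lebesgue" for n
      proof -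
        have "bump p q (real (Suc n)) \<in> borel_measurable borel"
          using bump_test_function[of "real (Suc n)" p q UNIV]
          by (intro borel_measurable_continuous_onI Ck_continuous[of 0])
             (auto simp: test_functions_def simp del: Ck.simps)
        then have "bump p q (real (Suc n)) \<in> borel_measurable lebesgue"
          by (rule borel_imp_lebesgue_measurable)
        then show ?thesis using e by (intro borel_measurable_scaleR) auto
      qed
      show "AE x in lebesgue. (\<lambda>n. bump p q (real (Suc n)) x *\<^sub>R e x) \<longlonglongrightarrow> indicat_real (box p q) x *\<^sub>R e x"
        by (intro AE_I2 tendsto_intros bump_tendsto)
      show "AE x in lebesgue. norm (bump p q (real (Suc n)) x *\<^sub>R e x) \<le> norm (e x)" for n
        by (intro AE_I2) (simp add: bump_nonneg bump_le_1 mult_left_le_one_le)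
    qed (use e in \<open>auto intro!: borel_measurable_scaleR borel_measurable_indicator\<close>)
    moreover have "integral\<^sup>L lebesgue (\<lambda>x. bump p q (real (Suc n)) x *\<^sub>R e x) = 0" for n
    proof -
      have "(\<lambda>x. bump p q (real (Suc n)) x *\<^sub>R e x) = (\<lambda>x. bump p q (real (Suc n)) x *\<^sub>R d x)"
        using bump_outside[of "real (Suc n)" _ p q] pq box_subset_cbox[of p q]
        by (auto simp: e_def fun_eq_iff split: split_indicator)
      then show ?thesis using zero[of "real (Suc n)", OF _ pq] by simp
    qed
    ultimately have "integral\<^sup>L lebesgue (\<lambda>x. indicator (box p q) x *\<^sub>R e x) = 0"
      by (simp only: LIMSEQ_const_iff)
    moreover have "(\<lambda>x. indicat_real (box p q) x *\<^sub>R e x) = (\<lambda>x. indicat_real (box p q) x *\<^sub>R d x)"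
      using pq box_subset_cbox[of p q] by (auto simp: e_def fun_eq_iff split: split_indicator)
    ultimately show ?thesis by (simp only: set_lebesgue_integral_def)
  qed
  have bdry: "AE x in lebesgue. x \<notin> cbox a b - box a b"
    using negligible_frontier_interval[of a b]
    unfolding negligible_iff_null_sets by (rule AE_not_in)
  have comp: "AE x in lebesgue. x \<in> cbox a b \<longrightarrow> d x \<bullet> v = 0" for v
  proof -
    define f where "f x = indicator (box a b) x * (d x \<bullet> v)" for x
    have "f = (\<lambda>x. indicator (box a b) x *\<^sub>R (e x \<bullet> v))"
      using box_subset_cbox[of a b] by (auto simp: f_def e_def fun_eq_iff split: split_indicator)
    then have f: "integrable lebesgue f"
      using integrable_mult_indicator[of "box a b" lebesgue "\<lambda>x. e x \<bullet> v"] e by simp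
    then obtain g where g: "g \<in> borel_measurable lborel" "AE x in lborel. f x = g x"
      using completion_ex_borel_measurable_real[of f lborel] by auto
    have gint: "integrable lborel g"
    proof -
      have "integrable lebesgue g \<longleftrightarrow> integrable lebesgue f"
        using g f by (intro integrable_cong_AE) (auto simp: AE_completion_iff measurable_completion)
      then show ?thesis using f g(1) by (simp add: integrable_completion)
    qed
    have "AE x in lborel. g x = 0"
    proof (rule AE_zero_if_box_integrals_zero[OF gint])
      fix p q :: "real^'n"
      let ?p = "\<chi> i. max (a $ i) (p $ i)" and ?q = "\<chi> i. min (b $ i) (q $ i)"
      have sub1: "box ?p ?q = box a b \<inter> box p q" "box ?p ?q \<subseteq> cbox a b"
        using box_subset_cbox[of a b] by (force simp: set_eq_iff mem_box_cart)+
      have ind: "indicat_real (box p q) x *\<^sub>R (indicat_real (box a b) x * (d x \<bullet> v)) =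
          (indicat_real (box ?p ?q) x *\<^sub>R indicat_real (cbox a b) x *\<^sub>R d x) \<bullet> v" for x
        using sub1 by (cases "x \<in> box p q"; cases "x \<in> box a b"; cases "x \<in> cbox a b"; auto)
      have ind2: "indicat_real (box ?p ?q) x *\<^sub>R indicat_real (cbox a b) x *\<^sub>R d x =
          indicat_real (box ?p ?q) x *\<^sub>R d x" for x
        using sub1 by (cases "x \<in> box p q"; cases "x \<in> box a b"; cases "x \<in> cbox a b"; auto)
      have "(LINT x:box p q|lborel. g x) = (LINT x:box p q|lebesgue. g x)"
        using g(1) unfolding set_lebesgue_integral_def by (intro integral_completion[symmetric]) auto
      also have "\<dots> = (LINT x:box p q|lebesgue. f x)"
        unfolding set_lebesgue_integral_def using g(1) f AE_completion[OF g(2)]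
        by (intro integral_cong_AE borel_measurable_scaleR borel_measurable_indicator)
           (auto simp: measurable_completion)
      also have "\<dots> = (LINT x|lebesgue. (indicator (box ?p ?q) x *\<^sub>R e x) \<bullet> v)"
        unfolding set_lebesgue_integral_def f_def e_def by (simp only: ind)
      also have "\<dots> = (LINT x|lebesgue. indicator (box ?p ?q) x *\<^sub>R e x) \<bullet> v"
        using e by (intro integral_inner_left integrable_mult_indicator) auto
      also have "(LINT x|lebesgue. indicator (box ?p ?q) x *\<^sub>R e x) = (LINT x:box ?p ?q|lebesgue. d x)"
        unfolding set_lebesgue_integral_def e_def by (simp only: ind2)
      also have "\<dots> = 0"
        by (rule sub) (auto simp: mem_box_cart)
      finally show "(LINT x:box p q|lborel. g x) = 0" by simp
    qed
    with g(2) have "AE x in lborel. f x = 0" by eventually_elim simp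
    then have "AE x in lebesgue. f x = 0" by (rule AE_completion)
    with bdry show ?thesis by eventually_elim (auto simp: f_def split: split_indicator_asm)
  qed
  have "AE x in lebesgue. \<forall>v\<in>Basis. x \<in> cbox a b \<longrightarrow> d x \<bullet> v = 0"
    by (intro AE_finite_allI comp) auto
  then show ?thesis by eventually_elim (auto simp: euclidean_eq_iff[where 'a='b])
qed

lemma test_function_support:
  assumes "\<eta> \<in> test_functions \<Omega>"
  shows "\<exists>K. compact K \<and> K \<subseteq> \<Omega> \<and> (\<forall>x. x \<notin> K \<longrightarrow> \<eta> x = 0) \<and>
    (\<forall>x i. x \<notin> K \<longrightarrow> partial_deriv i \<eta> x = 0)"
proof (intro exI conjI allI impI)
  let ?K = "closure {x. \<eta> x \<noteq> 0}"
  show "compact ?K" "?K \<subseteq> \<Omega>" using assms by (auto simp: test_functions_def)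
  show z: "\<eta> x = 0" if "x \<notin> ?K" for x
    using that closure_subset[of "{x. \<eta> x \<noteq> 0}"] by blast
  fix x i assume x: "x \<notin> ?K"
  have "open (- ?K)" by (intro open_Compl closed_closure)
  have "((\<lambda>x. 0) has_derivative (\<lambda>h. 0)) (at x)" by simp
  then have "(\<eta> has_derivative (\<lambda>h. 0)) (at x)"
  proof (rule has_derivative_transform_within_open[OF _ \<open>open (- ?K)\<close>])
    show "x \<in> - ?K" using x by blast
    show "0 = \<eta> y" if "y \<in> - ?K" for y using z[of y] that by simp
  qed
  from partial_deriv_eq[OF this, of i] show "partial_deriv i \<eta> x = 0" by simp
qed

lemma test_function_C1:
  assumes "\<eta> \<in> test_functions \<Omega>"
  shows "continuous_on UNIV \<eta>" "\<eta> differentiable_on UNIV"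
    "continuous_on UNIV (partial_deriv i \<eta>)"
proof -
  have "Ck 0 \<eta>" "Ck (Suc 0) \<eta>" using assms by (auto simp: test_functions_def simp del: Ck.simps)
  then show "continuous_on UNIV \<eta>" "\<eta> differentiable_on UNIV"
    "continuous_on UNIV (partial_deriv i \<eta>)" by auto
qed

lemma weak_deriv_integrable:
  assumes "has_weak_deriv \<Omega> u D" "compact K" "K \<subseteq> \<Omega>"
  shows "integrable (lebesgue_on K) u" "integrable (lebesgue_on K) (\<lambda>x. D x)"
    "integrable (lebesgue_on K) (\<lambda>x. D x $ i)"
  using assms unfolding has_weak_deriv_def
  by (auto intro!: integrable_bounded_linear[OF bounded_linear_vec_nth])

lemma weak_deriv_test_integrable:
  assumes u: "has_weak_deriv \<Omega> u D" and \<eta>: "\<eta> \<in> test_functions \<Omega>"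
  shows "integrable lebesgue (\<lambda>x. partial_deriv i \<eta> x *\<^sub>R u x)"
    "integrable lebesgue (\<lambda>x. \<eta> x *\<^sub>R (D x $ i))"
proof -
  obtain K where K: "compact K" "K \<subseteq> \<Omega>" "\<forall>x. x \<notin> K \<longrightarrow> \<eta> x = 0"
    "\<forall>x i. x \<notin> K \<longrightarrow> partial_deriv i \<eta> x = 0"
    using test_function_support[OF \<eta>] by (elim exE conjE)
  show "integrable lebesgue (\<lambda>x. partial_deriv i \<eta> x *\<^sub>R u x)"
    "integrable lebesgue (\<lambda>x. \<eta> x *\<^sub>R (D x $ i))"
    by (rule integrable_cutoff[OF K(1)];
        use weak_deriv_integrable[OF u K(1,2)] test_function_C1[OF \<eta>] K in auto)+
qed

lemma integral_test_support:
  assumes \<eta>: "\<eta> \<in> test_functions \<Omega>" and "open \<Omega>"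
  shows "integral\<^sup>L (lebesgue_on \<Omega>) (\<lambda>x. partial_deriv i \<eta> x *\<^sub>R (u x::'b::euclidean_space)) =
      integral\<^sup>L lebesgue (\<lambda>x. partial_deriv i \<eta> x *\<^sub>R u x)"
    "integral\<^sup>L (lebesgue_on \<Omega>) (\<lambda>x. \<eta> x *\<^sub>R u x) = integral\<^sup>L lebesgue (\<lambda>x. \<eta> x *\<^sub>R u x)"
proof -
  obtain K where K: "compact K" "K \<subseteq> \<Omega>" "\<forall>x. x \<notin> K \<longrightarrow> \<eta> x = 0"
    "\<forall>x i. x \<notin> K \<longrightarrow> partial_deriv i \<eta> x = 0"
    using test_function_support[OF \<eta>] by (elim exE conjE)
  have sets: "\<Omega> \<in> sets lebesgue" using \<open>open \<Omega>\<close> by auto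
  have "partial_deriv i \<eta> x *\<^sub>R u x = 0" "\<eta> x *\<^sub>R u x = 0" if "x \<notin> \<Omega>" for x
    using K that by (metis scaleR_zero_left subsetD)+
  note zero = this
  show "integral\<^sup>L (lebesgue_on \<Omega>) (\<lambda>x. partial_deriv i \<eta> x *\<^sub>R u x) =
      integral\<^sup>L lebesgue (\<lambda>x. partial_deriv i \<eta> x *\<^sub>R u x)"
    by (rule integral_lebesgue_on_support[OF sets zero(1)])
  show "integral\<^sup>L (lebesgue_on \<Omega>) (\<lambda>x. \<eta> x *\<^sub>R u x) = integral\<^sup>L lebesgue (\<lambda>x. \<eta> x *\<^sub>R u x)"
    by (rule integral_lebesgue_on_support[OF sets zero(2)])
qed

text \<open>Test functions vanish outside the domain, so the defining identity may be integrated over the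
  whole space, where translations are available.\<close>

lemma has_weak_deriv_iff:
  assumes "open \<Omega>"
  shows "has_weak_deriv \<Omega> u D \<longleftrightarrow>
     (\<forall>K. compact K \<and> K \<subseteq> \<Omega> \<longrightarrow> integrable (lebesgue_on K) u \<and> integrable (lebesgue_on K) D) \<and>
     (\<forall>\<eta> \<in> test_functions \<Omega>. \<forall>i.
        integral\<^sup>L lebesgue (\<lambda>x. partial_deriv i \<eta> x *\<^sub>R u x) =
        - integral\<^sup>L lebesgue (\<lambda>x. \<eta> x *\<^sub>R (D x $ i)))"
  unfolding has_weak_deriv_def
  by (simp add: integral_test_support[OF _ assms] cong: ball_cong)

lemma has_weak_deriv_integral:
  assumes "open \<Omega>" "has_weak_deriv \<Omega> u D" "\<eta> \<in> test_functions \<Omega>"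
  shows "integral\<^sup>L lebesgue (\<lambda>x. partial_deriv i \<eta> x *\<^sub>R u x) =
        - integral\<^sup>L lebesgue (\<lambda>x. \<eta> x *\<^sub>R (D x $ i))"
  using assms(2,3) unfolding has_weak_deriv_iff[OF assms(1)] by blast

text \<open>An open set is a countable union of closed boxes, so it suffices to test the difference with
  bump functions supported in one closed box.\<close>

lemma weak_deriv_AE_unique:
  assumes "open \<Omega>" and D: "has_weak_deriv \<Omega> u D" "has_weak_deriv \<Omega> u D'"
  shows "AE x in lebesgue_on \<Omega>. D x = D' x"
proof -
  obtain \<D> where \<D>: "countable \<D>" "\<D> \<subseteq> Pow \<Omega>" "\<And>X. X \<in> \<D> \<Longrightarrow> \<exists>a b. X = cbox a b" "\<Union>\<D> = \<Omega>"
    using open_countable_Union_open_cbox[OF \<open>open \<Omega>\<close>] by metis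
  have "AE x in lebesgue. x \<in> X \<longrightarrow> D x $ i - D' x $ i = 0" if "X \<in> \<D>" for X i
  proof -
    obtain a b where "X = cbox a b" using \<D>(3) \<open>X \<in> \<D>\<close> by meson
    with \<D>(2) \<open>X \<in> \<D>\<close> have X: "X = cbox a b" "cbox a b \<subseteq> \<Omega>" by auto
    show ?thesis unfolding X
    proof (rule AE_zero_if_bump_integrals_zero)
      show "integrable (lebesgue_on (cbox a b)) (\<lambda>x. D x $ i - D' x $ i)"
        using X D by (intro Bochner_Integration.integrable_diff weak_deriv_integrable) auto
      fix p q :: "real^'a" and m :: real
      assume "m > 0" "cbox p q \<subseteq> cbox a b"
      then have \<eta>: "bump p q m \<in> test_functions \<Omega>" using X by (intro bump_test_function) auto
      have "integral\<^sup>L lebesgue (\<lambda>x. bump p q m x *\<^sub>R D x $ i) =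
          integral\<^sup>L lebesgue (\<lambda>x. bump p q m x *\<^sub>R D' x $ i)"
        using has_weak_deriv_integral[OF \<open>open \<Omega>\<close> D(1) \<eta>, of i]
          has_weak_deriv_integral[OF \<open>open \<Omega>\<close> D(2) \<eta>, of i] by simp
      then show "integral\<^sup>L lebesgue (\<lambda>x. bump p q m x *\<^sub>R (D x $ i - D' x $ i)) = 0"
        using weak_deriv_test_integrable(2)[OF D(1) \<eta>] weak_deriv_test_integrable(2)[OF D(2) \<eta>]
        by (simp add: scaleR_diff_right)
    qed
  qed
  then have "AE x in lebesgue. \<forall>i\<in>UNIV. x \<in> X \<longrightarrow> D x $ i - D' x $ i = 0" if "X \<in> \<D>" for X
    using that by (intro AE_finite_allI) auto
  then have "AE x in lebesgue. \<forall>X\<in>\<D>. \<forall>i\<in>UNIV. x \<in> X \<longrightarrow> D x $ i - D' x $ i = 0"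
    unfolding AE_ball_countable[OF \<D>(1)] by blast
  then have "AE x in lebesgue. x \<in> \<Omega> \<longrightarrow> D x = D' x"
  proof eventually_elim
    case (elim x)
    show ?case
    proof
      assume "x \<in> \<Omega>"
      with \<D>(4) obtain X where "X \<in> \<D>" "x \<in> X" by blast
      with elim have "\<forall>i. D x $ i - D' x $ i = 0" by blast
      then show "D x = D' x" by (simp add: vec_eq_iff)
    qed
  qed
  then show ?thesis using \<open>open \<Omega>\<close> by (simp add: AE_lebesgue_on_iff)
qed

section \<open>Square-integrable functions\<close>

definition square_integrable :: "'a measure \<Rightarrow> ('a \<Rightarrow> 'b::euclidean_space) \<Rightarrow> bool" where
  "square_integrable M f \<longleftrightarrow> f \<in> borel_measurable M \<and> integrable M (\<lambda>x. (norm (f x))\<^sup>2)"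

abbreviation L2_sq :: "(real^'n) set \<Rightarrow> (real^'n \<Rightarrow> 'b::euclidean_space) \<Rightarrow> real" where
  "L2_sq \<Omega> f \<equiv> integral\<^sup>L (lebesgue_on \<Omega>) (\<lambda>x. (norm (f x))\<^sup>2)"

text \<open>This replaces the triangle inequality in \<open>L\<^sup>2\<close>: below only the order of magnitude of squared norms
  matters, so the factor \<open>2\<close> is harmless.\<close>

lemma norm_lincomb_sq_le:
  fixes x y :: "'a::real_inner"
  shows "(norm (a *\<^sub>R x + b *\<^sub>R y))\<^sup>2 \<le> 2 * a\<^sup>2 * (norm x)\<^sup>2 + 2 * b\<^sup>2 * (norm y)\<^sup>2"
proof -
  have "(norm (u + v))\<^sup>2 \<le> 2 * (norm u)\<^sup>2 + 2 * (norm v)\<^sup>2" for u v :: 'a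
  proof -
    have "0 \<le> (u - v) \<bullet> (u - v)" by simp
    then show ?thesis by (simp add: power2_norm_eq_inner inner_simps inner_commute)
  qed
  from this[of "a *\<^sub>R x" "b *\<^sub>R y"] show ?thesis by (simp add: power_mult_distrib mult.assoc)
qed

lemma square_integrable_lincomb:
  assumes "square_integrable M f" "square_integrable M g"
  shows "square_integrable M (\<lambda>x. a *\<^sub>R f x + b *\<^sub>R g x)"
    and "(\<integral>x. (norm (a *\<^sub>R f x + b *\<^sub>R g x))\<^sup>2 \<partial>M) \<le>
      2 * a\<^sup>2 * (\<integral>x. (norm (f x))\<^sup>2 \<partial>M) + 2 * b\<^sup>2 * (\<integral>x. (norm (g x))\<^sup>2 \<partial>M)"
proof -
  have m: "f \<in> borel_measurable M" "g \<in> borel_measurable M"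
    and i: "integrable M (\<lambda>x. (norm (f x))\<^sup>2)" "integrable M (\<lambda>x. (norm (g x))\<^sup>2)"
    using assms by (auto simp: square_integrable_def)
  have bi: "integrable M (\<lambda>x. 2 * a\<^sup>2 * (norm (f x))\<^sup>2 + 2 * b\<^sup>2 * (norm (g x))\<^sup>2)"
    using i by simp
  have int: "integrable M (\<lambda>x. (norm (a *\<^sub>R f x + b *\<^sub>R g x))\<^sup>2)"
  proof (rule Bochner_Integration.integrable_bound[OF bi])
    show "(\<lambda>x. (norm (a *\<^sub>R f x + b *\<^sub>R g x))\<^sup>2) \<in> borel_measurable M"
      using m by measurable
    show "AE x in M. norm ((norm (a *\<^sub>R f x + b *\<^sub>R g x))\<^sup>2) \<le>
        norm (2 * a\<^sup>2 * (norm (f x))\<^sup>2 + 2 * b\<^sup>2 * (norm (g x))\<^sup>2)"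
    proof (rule AE_I2)
      fix x
      show "norm ((norm (a *\<^sub>R f x + b *\<^sub>R g x))\<^sup>2) \<le>
        norm (2 * a\<^sup>2 * (norm (f x))\<^sup>2 + 2 * b\<^sup>2 * (norm (g x))\<^sup>2)"
        using norm_lincomb_sq_le[of a "f x" b "g x"] by (simp add: abs_of_nonneg)
    qed
  qed
  show "square_integrable M (\<lambda>x. a *\<^sub>R f x + b *\<^sub>R g x)"
    using m int by (simp add: square_integrable_def)
  have "(\<integral>x. (norm (a *\<^sub>R f x + b *\<^sub>R g x))\<^sup>2 \<partial>M) \<le>
      (\<integral>x. 2 * a\<^sup>2 * (norm (f x))\<^sup>2 + 2 * b\<^sup>2 * (norm (g x))\<^sup>2 \<partial>M)"
    by (intro integral_mono int bi norm_lincomb_sq_le)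
  also have "\<dots> = 2 * a\<^sup>2 * (\<integral>x. (norm (f x))\<^sup>2 \<partial>M) + 2 * b\<^sup>2 * (\<integral>x. (norm (g x))\<^sup>2 \<partial>M)"
    using i by simp
  finally show "(\<integral>x. (norm (a *\<^sub>R f x + b *\<^sub>R g x))\<^sup>2 \<partial>M) \<le>
      2 * a\<^sup>2 * (\<integral>x. (norm (f x))\<^sup>2 \<partial>M) + 2 * b\<^sup>2 * (\<integral>x. (norm (g x))\<^sup>2 \<partial>M)" .
qed

lemma integral_square_triangle:
  assumes "square_integrable M f" "square_integrable M g"
  shows "(\<integral>x. (norm (f x))\<^sup>2 \<partial>M) \<le> 2 * (\<integral>x. (norm (f x - g x))\<^sup>2 \<partial>M) + 2 * (\<integral>x. (norm (g x))\<^sup>2 \<partial>M)"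
proof -
  have "square_integrable M (\<lambda>x. f x - g x)"
    using square_integrable_lincomb(1)[OF assms, of 1 "-1"] by simp
  from square_integrable_lincomb(2)[OF this assms(2), of 1 1] show ?thesis by simp
qed

lemma square_integrable_AE_cong:
  assumes "square_integrable M f" "g \<in> borel_measurable M" "AE x in M. f x = g x"
  shows "square_integrable M g" "(\<integral>x. (norm (g x))\<^sup>2 \<partial>M) = (\<integral>x. (norm (f x))\<^sup>2 \<partial>M)"
proof -
  have m: "f \<in> borel_measurable M" using assms by (simp add: square_integrable_def)
  have ae: "AE x in M. (norm (f x))\<^sup>2 = (norm (g x))\<^sup>2" using assms(3) by eventually_elim simp
  have "integrable M (\<lambda>x. (norm (f x))\<^sup>2) = integrable M (\<lambda>x. (norm (g x))\<^sup>2)"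
    by (rule integrable_cong_AE[OF _ _ ae]) (use m assms(2) in measurable)
  then show "square_integrable M g" using assms by (simp add: square_integrable_def)
  show "(\<integral>x. (norm (g x))\<^sup>2 \<partial>M) = (\<integral>x. (norm (f x))\<^sup>2 \<partial>M)"
    by (rule integral_cong_AE[symmetric, OF _ _ ae]) (use m assms(2) in measurable)
qed

section \<open>Integration by parts\<close>

definition gradient :: "(real^'n::finite \<Rightarrow> 'b::real_normed_vector) \<Rightarrow> real^'n \<Rightarrow> 'b^'n" where
  "gradient f x = (\<chi> i. partial_deriv i f x)"

lemma vector_derivative_line:
  fixes f :: "real^'n \<Rightarrow> 'b::real_normed_vector"
  assumes "f differentiable_on UNIV"
  shows "((\<lambda>t. f (x + t *\<^sub>R axis i 1)) has_vector_derivative partial_deriv i f (x + t *\<^sub>R axis i 1)) (at t)"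
proof -
  have "((\<lambda>t. x + t *\<^sub>R axis i 1) has_derivative (\<lambda>h. h *\<^sub>R axis i 1)) (at t)"
    by (auto intro!: derivative_eq_intros)
  from has_derivative_compose[OF this differentiable_on_UNIV_has_derivative[OF assms]]
  show ?thesis
    by (simp add: has_vector_derivative_def partial_deriv_def
        linear_cmul[OF has_derivative_linear[OF differentiable_on_UNIV_has_derivative[OF assms]]])
qed

lemma compact_support_integrable:
  fixes f :: "'a::euclidean_space \<Rightarrow> 'b::euclidean_space"
  assumes "continuous_on UNIV f" "compact K" "\<forall>x. x \<notin> K \<longrightarrow> f x = 0"
  shows "integrable lebesgue f"
proof -
  have "integrable lborel (\<lambda>x. indicator K x *\<^sub>R f x)"
    by (rule borel_integrable_compact[OF assms(2) continuous_on_subset[OF assms(1)]]) simp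
  moreover have "(\<lambda>x. indicator K x *\<^sub>R f x) = f"
    using assms(3) by (auto simp: fun_eq_iff indicator_def)
  ultimately have *: "integrable lborel f" by simp
  then show ?thesis by (simp add: integrable_completion)
qed

lemma compact_support_bounded:
  fixes f :: "'a::euclidean_space \<Rightarrow> 'b::real_normed_vector"
  assumes "continuous_on UNIV f" "compact K" "\<forall>x. x \<notin> K \<longrightarrow> f x = 0"
  shows "\<exists>M\<ge>0. \<forall>x. norm (f x) \<le> M"
proof -
  have "bounded (f ` K)"
    using compact_continuous_image[OF continuous_on_subset[OF assms(1)] assms(2)]
    by (auto dest!: compact_imp_bounded)
  then obtain M where M: "\<forall>y\<in>f ` K. norm y \<le> M" unfolding bounded_iff by blast
  have "norm (f x) \<le> \<bar>M\<bar>" for x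
  proof (cases "x \<in> K")
    case True
    then have "norm (f x) \<le> M" using M by blast
    then show ?thesis by simp
  next
    case False
    then show ?thesis using assms(3) by simp
  qed
  then show ?thesis by (intro exI[of _ "\<bar>M\<bar>"]) simp
qed

lemma integral_translate:
  fixes f :: "'a::euclidean_space \<Rightarrow> 'b::euclidean_space"
  assumes "continuous_on UNIV f"
  shows "integral\<^sup>L lebesgue (\<lambda>x. f (x + v)) = integral\<^sup>L lebesgue f"
proof -
  have f: "f \<in> borel_measurable borel" by (rule borel_measurable_continuous_onI[OF assms])
  have "(\<lambda>x. f (x + v)) \<in> borel_measurable borel"
    by (intro borel_measurable_continuous_onI continuous_on_compose2[OF assms]) (auto intro!: continuous_intros)
  then have "integral\<^sup>L lebesgue (\<lambda>x. f (x + v)) = integral\<^sup>L lborel (\<lambda>x. f (v + x))"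
    by (simp add: integral_completion add.commute)
  also have "\<dots> = integral\<^sup>L (distr lborel borel ((+) v)) f"
    using f by (subst integral_distr) auto
  also have "\<dots> = integral\<^sup>L lebesgue f"
    using f by (simp add: lborel_distr_plus integral_completion)
  finally show ?thesis .
qed

text \<open>The mean value inequality on the segment from \<open>x\<close> to \<open>x + h e\<close>; for negative \<open>h\<close> the quotient is
  that of the segment traversed backwards.\<close>

lemma difference_quotient_bound:
  fixes f :: "real^'n \<Rightarrow> 'b::euclidean_space"
  assumes f: "f differentiable_on UNIV" and M: "\<forall>x. norm (partial_deriv i f x) \<le> M" and "h \<noteq> 0"
  shows "norm ((f (x + h *\<^sub>R axis i 1) - f x) /\<^sub>R h) \<le> M"
proof -
  have pos: "norm ((f (x + h *\<^sub>R axis i 1) - f x) /\<^sub>R h) \<le> M" if "h > 0" for x h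
  proof -
    let ?g = "\<lambda>t. f (x + t *\<^sub>R axis i 1)"
    have "continuous_on {0..h} ?g"
      using vector_derivative_line[OF f]
      by (meson continuous_at_imp_continuous_on has_vector_derivative_continuous)
    from mvt_general[OF \<open>h > 0\<close> this vector_derivative_line[OF f, unfolded has_vector_derivative_def]]
    obtain t where "norm (?g h - ?g 0) \<le> norm ((h - 0) *\<^sub>R partial_deriv i f (x + t *\<^sub>R axis i 1))" by blast
    also have "\<dots> \<le> h * M" using M \<open>h > 0\<close> by simp
    finally have *: "norm (?g h - ?g 0) \<le> h * M" .
    have "norm (y /\<^sub>R h) = norm y / h" for y :: 'b
      using \<open>h > 0\<close> by (simp add: divide_inverse_commute)
    with * \<open>h > 0\<close> show ?thesis by (simp add: pos_divide_le_eq mult.commute)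
  qed
  show ?thesis
  proof (cases "h > 0")
    case True
    then show ?thesis by (rule pos)
  next
    case False
    with \<open>h \<noteq> 0\<close> have "- h > 0" by simp
    have "(f (x + h *\<^sub>R axis i 1) - f x) /\<^sub>R h =
        (f (x + h *\<^sub>R axis i 1 + (- h) *\<^sub>R axis i 1) - f (x + h *\<^sub>R axis i 1)) /\<^sub>R (- h)"
      by (simp add: scaleR_diff_right)
    then show ?thesis using pos[OF \<open>- h > 0\<close>, of "x + h *\<^sub>R axis i 1"] by simp
  qed
qed

lemma has_vector_derivative_iff_quotient:
  fixes g :: "real \<Rightarrow> 'b::real_normed_vector"
  shows "(g has_vector_derivative v) (at 0) \<longleftrightarrow> (\<lambda>t. (g t - g 0) /\<^sub>R t) \<midarrow>0\<rightarrow> v"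
proof -
  have "norm (g t - g 0 - t *\<^sub>R v) / norm t = norm ((g t - g 0) /\<^sub>R t - v)" if "t \<noteq> 0" for t
  proof -
    have "(g t - g 0) /\<^sub>R t - v = inverse t *\<^sub>R (g t - g 0 - t *\<^sub>R v)"
      using that by (simp add: scaleR_diff_right)
    then show ?thesis by (simp add: divide_inverse_commute)
  qed
  then have "(\<lambda>t. norm (g t - g 0 - t *\<^sub>R v) / norm t) \<midarrow>0\<rightarrow> 0 \<longleftrightarrow>
      (\<lambda>t. norm ((g t - g 0) /\<^sub>R t - v)) \<midarrow>0\<rightarrow> 0"
    by (intro filterlim_cong refl) (auto simp: eventually_at_filter)
  then show ?thesis
    unfolding has_vector_derivative_def has_derivative_at
    by (simp add: bounded_linear_scaleR_left tendsto_norm_zero_iff LIM_zero_iff)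
qed

lemma difference_quotient_tendsto:
  fixes f :: "real^'n \<Rightarrow> 'b::euclidean_space"
  assumes f: "f differentiable_on UNIV" and h: "filterlim h (at 0) sequentially"
  shows "(\<lambda>n. (f (x + h n *\<^sub>R axis i 1) - f x) /\<^sub>R h n) \<longlonglongrightarrow> partial_deriv i f x"
proof -
  have "((\<lambda>t. f (x + t *\<^sub>R axis i 1)) has_vector_derivative partial_deriv i f x) (at 0)"
    using vector_derivative_line[OF f, of x i 0] by simp
  then have "(\<lambda>t. (f (x + t *\<^sub>R axis i 1) - f x) /\<^sub>R t) \<midarrow>0\<rightarrow> partial_deriv i f x"
    by (simp add: has_vector_derivative_iff_quotient)
  from filterlim_compose[OF this h] show ?thesis .
qed

lemma partial_deriv_zero_outside:
  assumes "compact K" "\<forall>x. x \<notin> K \<longrightarrow> f x = 0" "x \<notin> K"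
  shows "partial_deriv i f x = 0"
proof -
  have "open (- K)" using assms(1) by (intro open_Compl compact_imp_closed)
  have "((\<lambda>x. 0) has_derivative (\<lambda>h. 0)) (at x)" by simp
  then have "(f has_derivative (\<lambda>h. 0)) (at x)"
    by (rule has_derivative_transform_within_open[OF _ \<open>open (- K)\<close>]) (use assms in simp_all)
  from partial_deriv_eq[OF this, of i] show ?thesis by simp
qed

lemma continuous_translate: "continuous_on UNIV f \<Longrightarrow> continuous_on UNIV (\<lambda>x. f (x + v))"
  for f :: "'a::real_normed_vector \<Rightarrow> 'b::topological_space"
  by (rule continuous_on_compose2[of UNIV f]) (auto intro!: continuous_intros)

lemma partial_deriv_translate:
  assumes "f differentiable_on UNIV"
  shows "(\<lambda>x. f (x + v)) differentiable_on UNIV"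
    and "partial_deriv i (\<lambda>x. f (x + v)) = (\<lambda>x. partial_deriv i f (x + v))"
proof -
  have *: "((\<lambda>x. f (x + v)) has_derivative frechet_derivative f (at (x + v))) (at x)" for x
  proof -
    have "((\<lambda>x. x + v) has_derivative (\<lambda>h. h)) (at x)" by (auto intro!: derivative_eq_intros)
    from has_derivative_compose[OF this differentiable_on_UNIV_has_derivative[OF assms]]
    show ?thesis .
  qed
  then show "(\<lambda>x. f (x + v)) differentiable_on UNIV"
    unfolding differentiable_on_def differentiable_def by blast
  show "partial_deriv i (\<lambda>x. f (x + v)) = (\<lambda>x. partial_deriv i f (x + v))"
    using partial_deriv_eq[OF *] by (simp add: partial_deriv_def fun_eq_iff)
qed

lemma compact_support_translate:
  fixes f :: "'a::real_normed_vector \<Rightarrow> 'b::zero"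
  assumes "compact K" "\<forall>x. x \<notin> K \<longrightarrow> f x = 0"
  shows "compact ((\<lambda>x. x - v) ` K)" "\<forall>x. x \<notin> (\<lambda>x. x - v) ` K \<longrightarrow> f (x + v) = 0"
proof -
  show "compact ((\<lambda>x. x - v) ` K)"
    using assms(1) by (intro compact_continuous_image) (auto intro!: continuous_intros)
  show "\<forall>x. x \<notin> (\<lambda>x. x - v) ` K \<longrightarrow> f (x + v) = 0"
    using assms(2) by (metis add_diff_cancel_right' image_eqI)
qed

text \<open>The integral of a difference quotient vanishes by translation invariance, and the quotients
  converge to the derivative under a common integrable bound.\<close>

lemma integral_partial_deriv_zero:
  fixes f :: "real^'n \<Rightarrow> 'b::euclidean_space"
  assumes f: "f differentiable_on UNIV" and pf: "continuous_on UNIV (partial_deriv i f)"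
    and K: "compact K" "\<forall>x. x \<notin> K \<longrightarrow> f x = 0"
  shows "integral\<^sup>L lebesgue (partial_deriv i f) = 0"
proof -
  have cf: "continuous_on UNIV f" by (rule differentiable_imp_continuous_on[OF f])
  define e :: "real^'n" where "e = axis i 1"
  define h where "h n = inverse (real (Suc n))" for n
  have h: "0 < h n" "h n \<le> 1" for n by (auto simp: h_def inverse_le_1_iff)
  have hlim: "filterlim h (at 0) sequentially"
    unfolding filterlim_at using h LIMSEQ_inverse_real_of_nat by (auto simp: h_def[abs_def])
  let ?q = "\<lambda>n x. (f (x + h n *\<^sub>R e) - f x) /\<^sub>R h n"
  obtain M where M: "\<forall>x. norm (partial_deriv i f x) \<le> M"
    using compact_support_bounded[OF pf K(1)] partial_deriv_zero_outside[OF K] by blast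
  \<comment> \<open>A compact set containing the supports of all difference quotients with step at most \<open>1\<close>.\<close>
  define K' where "K' = (\<lambda>(y, t). y - t *\<^sub>R e) ` (K \<times> {0..1::real})"
  have K': "compact K'"
    unfolding K'_def split_beta
    by (intro compact_continuous_image compact_Times K compact_Icc continuous_intros)
  have int: "integrable lebesgue f" "integrable lebesgue (\<lambda>x. f (x + v))" for v
    using compact_support_integrable[OF cf K]
      compact_support_integrable[OF continuous_translate[OF cf] compact_support_translate[OF K]] by auto
  have zero: "integral\<^sup>L lebesgue (?q n) = 0" for n
    using int integral_translate[OF cf, of "h n *\<^sub>R e"] by simp
  have "(\<lambda>n. integral\<^sup>L lebesgue (?q n)) \<longlonglongrightarrow> integral\<^sup>L lebesgue (partial_deriv i f)"
  proof (rule integral_dominated_convergence[where w = "\<lambda>x. M * indicator K' x"])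
    show "partial_deriv i f \<in> borel_measurable lebesgue"
      by (intro borel_imp_lebesgue_measurable borel_measurable_continuous_onI pf)
    show "?q n \<in> borel_measurable lebesgue" for n
      by (intro borel_imp_lebesgue_measurable borel_measurable_continuous_onI continuous_intros
          continuous_translate cf)
    have L: "K' \<in> lmeasurable" using K' by (rule lmeasurable_compact)
    have "emeasure lebesgue K' < \<infinity>" using fmeasurableD2[OF L] by (simp add: less_top)
    then show "integrable lebesgue (\<lambda>x. M * indicator K' x)"
      using fmeasurableD[OF L] by (intro integrable_mult_right integrable_real_indicator)
    show "AE x in lebesgue. (\<lambda>n. ?q n x) \<longlonglongrightarrow> partial_deriv i f x"
      unfolding e_def by (intro AE_I2 difference_quotient_tendsto f hlim)
    show "AE x in lebesgue. norm (?q n x) \<le> M * indicator K' x" for n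
    proof (rule AE_I2)
      fix x
      show "norm (?q n x) \<le> M * indicator K' x"
      proof (cases "x \<in> K'")
        case True
        then show ?thesis using difference_quotient_bound[OF f M less_imp_neq[OF h(1), symmetric]] by (simp add: e_def)
      next
        case False
        have "x \<notin> K" "x + h n *\<^sub>R e \<notin> K"
        proof -
          show "x \<notin> K"
          proof
            assume "x \<in> K"
            then have "x \<in> K'" unfolding K'_def by (intro image_eqI[of _ _ "(x, 0)"]) auto
            with False show False ..
          qed
          show "x + h n *\<^sub>R e \<notin> K"
          proof
            assume "x + h n *\<^sub>R e \<in> K"
            then have "x \<in> K'" unfolding K'_def
              using h[of n] by (intro image_eqI[of _ _ "(x + h n *\<^sub>R e, h n)"]) auto
            with False show False ..
          qed
        qed
        then show ?thesis using K(2) False by simp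
      qed
    qed
  qed
  then show ?thesis by (simp only: zero LIMSEQ_const_iff)
qed

lemma integration_by_parts:
  fixes f :: "real^'n \<Rightarrow> 'b::euclidean_space" and g :: "real^'n \<Rightarrow> 'c::euclidean_space"
    and m :: "'b \<Rightarrow> 'c \<Rightarrow> 'd::euclidean_space"
  assumes m: "bounded_bilinear m"
    and f: "f differentiable_on UNIV" "continuous_on UNIV (partial_deriv i f)"
    and g: "g differentiable_on UNIV" "continuous_on UNIV (partial_deriv i g)"
    and K: "compact K" "\<forall>x. x \<notin> K \<longrightarrow> f x = 0"
  shows "integral\<^sup>L lebesgue (\<lambda>x. m (partial_deriv i f x) (g x)) = - integral\<^sup>L lebesgue (\<lambda>x. m (f x) (partial_deriv i g x))"
    and "integrable lebesgue (\<lambda>x. m (partial_deriv i f x) (g x))"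
    and "integrable lebesgue (\<lambda>x. m (f x) (partial_deriv i g x))"
proof -
  interpret bounded_bilinear m by (rule m)
  have c: "continuous_on UNIV f" "continuous_on UNIV g"
    using f(1) g(1) by (auto intro: differentiable_imp_continuous_on)
  have c1: "continuous_on UNIV (\<lambda>x. m (partial_deriv i f x) (g x))"
    by (rule continuous_on[OF f(2) c(2)])
  have c2: "continuous_on UNIV (\<lambda>x. m (f x) (partial_deriv i g x))"
    by (rule continuous_on[OF c(1) g(2)])
  have z: "partial_deriv i f x = 0" if "x \<notin> K" for x
    by (rule partial_deriv_zero_outside[OF K that])
  show i1: "integrable lebesgue (\<lambda>x. m (partial_deriv i f x) (g x))"
    using z by (intro compact_support_integrable[OF c1 K(1)]) (simp add: zero_left)
  show i2: "integrable lebesgue (\<lambda>x. m (f x) (partial_deriv i g x))"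
    using K(2) by (intro compact_support_integrable[OF c2 K(1)]) (simp add: zero_left)
  note bil = partial_deriv_bilinear[OF m f(1) g(1)]
  have "integral\<^sup>L lebesgue (partial_deriv i (\<lambda>x. m (f x) (g x))) = 0"
  proof (rule integral_partial_deriv_zero[OF bil(1) _ K(1)])
    show "continuous_on UNIV (partial_deriv i (\<lambda>x. m (f x) (g x)))"
      unfolding bil(2) by (rule continuous_on_add[OF c1 c2])
    show "\<forall>x. x \<notin> K \<longrightarrow> m (f x) (g x) = 0" using K(2) by (simp add: zero_left)
  qed
  then show "integral\<^sup>L lebesgue (\<lambda>x. m (partial_deriv i f x) (g x)) = - integral\<^sup>L lebesgue (\<lambda>x. m (f x) (partial_deriv i g x))"
    unfolding bil(2) using i1 i2 by (simp add: eq_neg_iff_add_eq_0)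
qed

text \<open>For a test function the weak derivative is the classical gradient, by partial integration against
  another test function.\<close>

lemma test_weak_deriv:
  fixes \<eta> :: "real^'n \<Rightarrow> 'b::euclidean_space"
  assumes "open \<Omega>" and \<eta>: "\<eta> \<in> test_functions \<Omega>"
  shows "has_weak_deriv \<Omega> \<eta> (gradient \<eta>)"
  unfolding has_weak_deriv_iff[OF \<open>open \<Omega>\<close>]
proof (intro conjI allI impI ballI)
  fix K assume K: "compact K \<and> K \<subseteq> \<Omega>"
  have *: "integrable (lebesgue_on K) f" if "continuous_on UNIV f" for f :: "real^'n \<Rightarrow> 'd::euclidean_space"
  proof -
    have "integrable lborel (\<lambda>x. indicator K x *\<^sub>R f x)"
      using K by (intro borel_integrable_compact continuous_on_subset[OF that]) auto
    then have "integrable lebesgue (\<lambda>x. indicator K x *\<^sub>R f x)"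
      by (simp add: integrable_completion)
    then show ?thesis using K by (subst integrable_restrict_space) (auto simp: compact_imp_closed)
  qed
  have "continuous_on UNIV (gradient \<eta>)"
    unfolding gradient_def[abs_def] by (intro continuous_on_vec_lambda test_function_C1[OF \<eta>])
  then show "integrable (lebesgue_on K) \<eta>" "integrable (lebesgue_on K) (gradient \<eta>)"
    using test_function_C1[OF \<eta>] by (auto intro: *)
next
  fix \<zeta> :: "real^'n \<Rightarrow> real" and i assume \<zeta>: "\<zeta> \<in> test_functions \<Omega>"
  obtain K where K: "compact K" "\<forall>x. x \<notin> K \<longrightarrow> \<zeta> x = 0"
    using test_function_support[OF \<zeta>] by (elim exE conjE)
  show "integral\<^sup>L lebesgue (\<lambda>x. partial_deriv i \<zeta> x *\<^sub>R \<eta> x) =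
        - integral\<^sup>L lebesgue (\<lambda>x. \<zeta> x *\<^sub>R (gradient \<eta> x $ i))"
    unfolding gradient_def vec_lambda_beta
    by (rule integration_by_parts(1)[OF bounded_bilinear_scaleR test_function_C1(2,3)[OF \<zeta>]
        test_function_C1(2,3)[OF \<eta>] K])
qed

section \<open>The inequalities of Poincare and Korn for test functions\<close>

text \<open>The coordinate \<open>x\<^sub>i\<close> has derivative \<open>1\<close> in direction \<open>i\<close>, so partial integration gives
  \<open>\<integral> \<bar>\<eta>\<bar>\<^sup>2 = - 2 \<integral> x\<^sub>i (\<eta> \<bullet> \<partial>\<^sub>i \<eta>)\<close>; Young's inequality then absorbs half of the left-hand side.\<close>

lemma poincare_test:
  fixes \<eta> :: "real^'n \<Rightarrow> 'b::euclidean_space"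
  assumes \<eta>: "\<eta> \<in> test_functions \<Omega>" and R: "\<And>x. x \<in> \<Omega> \<Longrightarrow> \<bar>x $ i\<bar> \<le> R"
  shows "integral\<^sup>L lebesgue (\<lambda>x. (norm (\<eta> x))\<^sup>2) \<le>
      4 * R\<^sup>2 * integral\<^sup>L lebesgue (\<lambda>x. (norm (partial_deriv i \<eta> x))\<^sup>2)"
proof -
  note C = test_function_C1[OF \<eta>]
  obtain K where K: "compact K" "K \<subseteq> \<Omega>" "\<forall>x. x \<notin> K \<longrightarrow> \<eta> x = 0"
    "\<forall>x i. x \<notin> K \<longrightarrow> partial_deriv i \<eta> x = 0"
    using test_function_support[OF \<eta>] by (elim exE conjE)
  let ?f = "\<lambda>x. \<eta> x \<bullet> \<eta> x" and ?g = "\<lambda>x::real^'n. x $ i"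
  have f: "?f differentiable_on UNIV"
    "partial_deriv i ?f = (\<lambda>x. partial_deriv i \<eta> x \<bullet> \<eta> x + \<eta> x \<bullet> partial_deriv i \<eta> x)"
    using partial_deriv_bilinear[OF bounded_bilinear_inner C(2) C(2)] by auto
  have g': "(?g has_derivative (\<lambda>h. h $ i)) (at x)" for x
    by (rule bounded_linear_imp_has_derivative[OF bounded_linear_vec_nth])
  have g: "?g differentiable_on UNIV" "partial_deriv i ?g = (\<lambda>x. 1)"
    using g' partial_deriv_eq[OF g', of i] by (auto simp: differentiable_on_def differentiable_def fun_eq_iff)
  have cf: "continuous_on UNIV (partial_deriv i ?f)"
    unfolding f(2) by (intro continuous_intros C)
  have cg: "continuous_on UNIV (partial_deriv i ?g)" unfolding g(2) by simp
  have Kf: "\<forall>x. x \<notin> K \<longrightarrow> ?f x = 0" using K(3) by simp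
  note ibp = integration_by_parts[OF bounded_bilinear_mult f(1) cf g(1) cg K(1) Kf]
  have sq: "integrable lebesgue (\<lambda>x. (norm (\<eta> x))\<^sup>2)"
    using K by (intro compact_support_integrable[OF _ K(1)] continuous_intros C) auto
  have sq': "integrable lebesgue (\<lambda>x. (norm (partial_deriv i \<eta> x))\<^sup>2)"
    using K by (intro compact_support_integrable[OF _ K(1)] continuous_intros C) auto
  have "integral\<^sup>L lebesgue (\<lambda>x. (norm (\<eta> x))\<^sup>2) = - integral\<^sup>L lebesgue (\<lambda>x. partial_deriv i ?f x * x $ i)"
    using ibp(1) unfolding g(2) by (simp add: power2_norm_eq_inner)
  also have "\<dots> = integral\<^sup>L lebesgue (\<lambda>x. - (partial_deriv i ?f x * x $ i))"
    using ibp(2) by simp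
  also have "\<dots> \<le> integral\<^sup>L lebesgue (\<lambda>x. 1/2 * (norm (\<eta> x))\<^sup>2 + 2 * R\<^sup>2 * (norm (partial_deriv i \<eta> x))\<^sup>2)"
  proof (rule integral_mono)
    show "integrable lebesgue (\<lambda>x. - (partial_deriv i ?f x * x $ i))" using ibp(2) by simp
    show "integrable lebesgue (\<lambda>x. 1/2 * (norm (\<eta> x))\<^sup>2 + 2 * R\<^sup>2 * (norm (partial_deriv i \<eta> x))\<^sup>2)"
      using sq sq' by simp
    fix x
    show "- (partial_deriv i ?f x * x $ i) \<le> 1/2 * (norm (\<eta> x))\<^sup>2 + 2 * R\<^sup>2 * (norm (partial_deriv i \<eta> x))\<^sup>2"
    proof (cases "x \<in> \<Omega>")
      case True
      define a b where "a = norm (\<eta> x)" and "b = norm (partial_deriv i \<eta> x)"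
      have "\<bar>\<eta> x \<bullet> partial_deriv i \<eta> x\<bar> * \<bar>x $ i\<bar> \<le> (a * b) * R"
        using Cauchy_Schwarz_ineq2 R[OF True] unfolding a_def b_def by (intro mult_mono) auto
      then have "- ((\<eta> x \<bullet> partial_deriv i \<eta> x) * x $ i) \<le> a * (b * R)"
        by (simp add: abs_mult[symmetric] mult.assoc abs_le_iff)
      moreover have "0 \<le> (a - 2 * (b * R))\<^sup>2" by simp
      then have "2 * (a * (b * R)) \<le> 1/2 * a\<^sup>2 + 2 * R\<^sup>2 * b\<^sup>2"
        by (simp add: power2_eq_square algebra_simps)
      ultimately show ?thesis
        unfolding f(2) a_def[symmetric] b_def[symmetric] by (simp add: inner_commute algebra_simps)
    next
      case False
      then have "\<eta> x = 0" "partial_deriv i \<eta> x = 0" using K by blast+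
      then show ?thesis unfolding f(2) by simp
    qed
  qed
  also have "\<dots> = 1/2 * integral\<^sup>L lebesgue (\<lambda>x. (norm (\<eta> x))\<^sup>2) +
      2 * R\<^sup>2 * integral\<^sup>L lebesgue (\<lambda>x. (norm (partial_deriv i \<eta> x))\<^sup>2)"
    using sq sq' by simp
  finally show ?thesis by simp
qed

text \<open>Integrating by parts twice would require commuting second derivatives. Replacing one derivative
  by a difference quotient avoids this: the quotient commutes with \<open>\<partial>\<^sub>i\<close> and, by translation
  invariance, can be moved to the other factor with the step reversed. Only first derivatives occur.\<close>

lemma exchange_derivatives:
  fixes f g :: "real^'n \<Rightarrow> real"
  assumes f: "f differentiable_on UNIV" "\<And>i. continuous_on UNIV (partial_deriv i f)"
    and g: "g differentiable_on UNIV" "\<And>i. continuous_on UNIV (partial_deriv i g)"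
    and K: "compact K" "\<forall>x. x \<notin> K \<longrightarrow> f x = 0" "\<forall>x. x \<notin> K \<longrightarrow> g x = 0"
  shows "integral\<^sup>L lebesgue (\<lambda>x. partial_deriv i f x * partial_deriv j g x) =
    integral\<^sup>L lebesgue (\<lambda>x. partial_deriv j f x * partial_deriv i g x)"
proof -
  have cf: "continuous_on UNIV f" and cg: "continuous_on UNIV g"
    using f(1) g(1) by (auto intro: differentiable_imp_continuous_on)
  have zf: "\<forall>x. x \<notin> K \<longrightarrow> partial_deriv k f x = 0" for k
    using partial_deriv_zero_outside[OF K(1,2)] by blast
  have zg: "\<forall>x. x \<notin> K \<longrightarrow> partial_deriv k g x = 0" for k
    using partial_deriv_zero_outside[OF K(1,3)] by blast
  define e :: "real^'n" where "e = axis j 1"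
  define h where "h n = inverse (real (Suc n))" for n
  have h: "h n \<noteq> 0" "- h n \<noteq> 0" for n by (auto simp: h_def)
  have h0: "h \<longlonglongrightarrow> 0" unfolding h_def by (rule LIMSEQ_inverse_real_of_nat)
  have hlim: "filterlim h (at 0) sequentially" "filterlim (\<lambda>n. - h n) (at 0) sequentially"
    unfolding filterlim_at using h h0 tendsto_minus[OF h0] by auto
  let ?q = "\<lambda>u t x. (u (x + t *\<^sub>R e) - u x) /\<^sub>R t"
  have lim: "(\<lambda>n. integral\<^sup>L lebesgue (\<lambda>x. v x * ?q u (t n) x)) \<longlonglongrightarrow>
      integral\<^sup>L lebesgue (\<lambda>x. v x * partial_deriv j u x)"
    if u: "u differentiable_on UNIV" "continuous_on UNIV (partial_deriv j u)" "\<forall>x. x \<notin> K \<longrightarrow> u x = 0"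
      and v: "continuous_on UNIV v" "\<forall>x. x \<notin> K \<longrightarrow> v x = 0"
      and t: "filterlim t (at 0) sequentially" "\<And>n. t n \<noteq> 0" for u v :: "real^'n \<Rightarrow> real" and t :: "nat \<Rightarrow> real"
  proof -
    obtain M where M: "\<forall>x. norm (partial_deriv j u x) \<le> M"
      using compact_support_bounded[OF u(2) K(1)] partial_deriv_zero_outside[OF K(1) u(3)] by blast
    have cu: "continuous_on UNIV u" using u(1) by (rule differentiable_imp_continuous_on)
    show ?thesis
    proof (rule integral_dominated_convergence[where w = "\<lambda>x. M * \<bar>v x\<bar>"])
      show "(\<lambda>x. v x * partial_deriv j u x) \<in> borel_measurable lebesgue"
        by (intro borel_imp_lebesgue_measurable borel_measurable_continuous_onI continuous_intros u v)
      show "(\<lambda>x. v x * ?q u (t n) x) \<in> borel_measurable lebesgue" for n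
        by (intro borel_imp_lebesgue_measurable borel_measurable_continuous_onI continuous_intros
            continuous_translate cu v)
      show "integrable lebesgue (\<lambda>x. M * \<bar>v x\<bar>)"
        using compact_support_integrable[OF v(1) K(1) v(2)] by simp
      show "AE x in lebesgue. (\<lambda>n. v x * ?q u (t n) x) \<longlonglongrightarrow> v x * partial_deriv j u x"
        unfolding e_def by (intro AE_I2 tendsto_mult tendsto_const difference_quotient_tendsto u t)
      show "AE x in lebesgue. norm (v x * ?q u (t n) x) \<le> M * \<bar>v x\<bar>" for n
      proof (rule AE_I2)
        fix x
        have "norm (?q u (t n) x) \<le> M" unfolding e_def by (rule difference_quotient_bound[OF u(1) M t(2)])
        then have "\<bar>v x\<bar> * norm (?q u (t n) x) \<le> \<bar>v x\<bar> * M" by (intro mult_left_mono) auto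
        then show "norm (v x * ?q u (t n) x) \<le> M * \<bar>v x\<bar>" by (simp only: abs_mult real_norm_def mult.commute)
      qed
    qed
  qed
  have eq: "integral\<^sup>L lebesgue (\<lambda>x. partial_deriv i f x * ?q g (h n) x) =
      integral\<^sup>L lebesgue (\<lambda>x. partial_deriv i g x * ?q f (- h n) x)" for n
  proof -
    let ?h = "h n" and ?v = "h n *\<^sub>R e"
    have i1: "integrable lebesgue (\<lambda>x. a x * b (x + w))"
      if "continuous_on UNIV a" "continuous_on UNIV b" "\<forall>x. x \<notin> K \<longrightarrow> a x = 0" for a b :: "real^'n \<Rightarrow> real" and w
      using that by (intro compact_support_integrable[OF _ K(1)] continuous_intros continuous_translate) auto
    have ibp: "integral\<^sup>L lebesgue (\<lambda>x. partial_deriv i f x * g (x + w)) =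
       - integral\<^sup>L lebesgue (\<lambda>x. f x * partial_deriv i g (x + w))" for w
      using integration_by_parts(1)[OF bounded_bilinear_mult f partial_deriv_translate(1)[OF g(1)] _ K(1,2), of i w]
      unfolding partial_deriv_translate(2)[OF g(1)] by (simp add: continuous_translate[OF g(2)])
    have tr: "integral\<^sup>L lebesgue (\<lambda>x. f x * partial_deriv i g (x + ?v)) =
        integral\<^sup>L lebesgue (\<lambda>x. f (x + - ?v) * partial_deriv i g x)"
      using integral_translate[OF continuous_on_mult[OF continuous_translate[OF cf, of "- ?v"] g(2)[of i]], of ?v]
      by simp
    have "integral\<^sup>L lebesgue (\<lambda>x. partial_deriv i f x * ?q g ?h x) =
        inverse ?h * integral\<^sup>L lebesgue (\<lambda>x. partial_deriv i f x * g (x + ?v) - partial_deriv i f x * g (x + 0))"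
      by (subst integral_mult_right_zero[symmetric]) (simp add: algebra_simps)
    also have "\<dots> = inverse ?h * (integral\<^sup>L lebesgue (\<lambda>x. partial_deriv i f x * g (x + ?v)) -
       integral\<^sup>L lebesgue (\<lambda>x. partial_deriv i f x * g (x + 0)))"
      by (subst Bochner_Integration.integral_diff[OF i1[OF f(2) cg zf] i1[OF f(2) cg zf]]) (rule refl)
    also have "\<dots> = inverse (- ?h) * (integral\<^sup>L lebesgue (\<lambda>x. f (x + - ?v) * partial_deriv i g x) -
       integral\<^sup>L lebesgue (\<lambda>x. f x * partial_deriv i g (x + 0)))"
      unfolding ibp tr by (simp add: algebra_simps)
    also have "\<dots> = inverse (- ?h) * integral\<^sup>L lebesgue (\<lambda>x. partial_deriv i g x * f (x + - ?v) - partial_deriv i g x * f (x + 0))"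
      by (subst Bochner_Integration.integral_diff[OF i1[OF g(2) cf zg] i1[OF g(2) cf zg]]) (simp add: mult.commute)
    also have "\<dots> = integral\<^sup>L lebesgue (\<lambda>x. partial_deriv i g x * ?q f (- ?h) x)"
      by (subst integral_mult_right_zero[symmetric]) (simp add: algebra_simps)
    finally show ?thesis .
  qed
  have "(\<lambda>n. integral\<^sup>L lebesgue (\<lambda>x. partial_deriv i f x * ?q g (h n) x)) \<longlonglongrightarrow>
      integral\<^sup>L lebesgue (\<lambda>x. partial_deriv i f x * partial_deriv j g x)"
    by (rule lim[OF g K(3) f(2) zf hlim(1) h(1)])
  moreover have "(\<lambda>n. integral\<^sup>L lebesgue (\<lambda>x. partial_deriv i g x * ?q f (- h n) x)) \<longlonglongrightarrow>
      integral\<^sup>L lebesgue (\<lambda>x. partial_deriv i g x * partial_deriv j f x)"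
    by (rule lim[OF f K(2) g(2) zg hlim(2) h(2)])
  ultimately have "integral\<^sup>L lebesgue (\<lambda>x. partial_deriv i f x * partial_deriv j g x) =
      integral\<^sup>L lebesgue (\<lambda>x. partial_deriv i g x * partial_deriv j f x)"
    unfolding eq by (rule LIMSEQ_unique)
  then show ?thesis by (simp only: mult.commute)
qed

lemma norm_matrix_sq: "(norm (A::real^'n^'m))\<^sup>2 = (\<Sum>i\<in>UNIV. \<Sum>j\<in>UNIV. (A $ i $ j)\<^sup>2)"
  unfolding power2_norm_eq_inner inner_vec_def by (simp add: power2_eq_square)

definition sym_part :: "real^'n^'n \<Rightarrow> real^'n^'n" where
  "sym_part A = (1/2) *\<^sub>R (A + transpose A)"

lemma norm_sym_part_sq:
  "(norm (sym_part A))\<^sup>2 = 1/2 * (norm A)\<^sup>2 + 1/2 * (\<Sum>i\<in>UNIV. \<Sum>j\<in>UNIV. A $ i $ j * A $ j $ i)"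
proof -
  have "(norm (sym_part A))\<^sup>2 = (\<Sum>i\<in>UNIV. \<Sum>j\<in>UNIV. 1/4 * ((A $ i $ j)\<^sup>2 + (A $ j $ i)\<^sup>2 + 2 * (A $ i $ j * A $ j $ i)))"
    unfolding norm_matrix_sq sym_part_def
    by (intro sum.cong refl) (simp add: transpose_def power2_eq_square algebra_simps)
  also have "\<dots> = 1/4 * ((\<Sum>i\<in>UNIV. \<Sum>j\<in>UNIV. (A $ i $ j)\<^sup>2) + (\<Sum>i\<in>UNIV. \<Sum>j\<in>UNIV. (A $ j $ i)\<^sup>2)
      + 2 * (\<Sum>i\<in>UNIV. \<Sum>j\<in>UNIV. A $ i $ j * A $ j $ i))"
    by (simp add: sum.distrib sum_distrib_left algebra_simps)
  also have "(\<Sum>i\<in>UNIV. \<Sum>j\<in>UNIV. (A $ j $ i)\<^sup>2) = (\<Sum>i\<in>UNIV. \<Sum>j\<in>UNIV. (A $ i $ j)\<^sup>2)"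
    by (rule sum.swap)
  finally show ?thesis unfolding norm_matrix_sq by simp
qed

lemma partial_deriv_component:
  fixes f :: "real^'n \<Rightarrow> real^'m"
  assumes "f differentiable_on UNIV"
  shows "(\<lambda>x. f x $ j) differentiable_on UNIV" "partial_deriv i (\<lambda>x. f x $ j) = (\<lambda>x. partial_deriv i f x $ j)"
proof -
  have *: "((\<lambda>x. f x $ j) has_derivative (\<lambda>h. frechet_derivative f (at x) h $ j)) (at x)" for x
    by (rule bounded_linear.has_derivative[OF bounded_linear_vec_nth differentiable_on_UNIV_has_derivative[OF assms]])
  then show "(\<lambda>x. f x $ j) differentiable_on UNIV"
    unfolding differentiable_on_def differentiable_def by blast
  show "partial_deriv i (\<lambda>x. f x $ j) = (\<lambda>x. partial_deriv i f x $ j)"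
    using partial_deriv_eq[OF *] by (simp add: partial_deriv_def fun_eq_iff)
qed

text \<open>Expanding \<open>\<bar>sym_part G\<bar>\<^sup>2\<close> leaves the mixed term \<open>\<Sum> G\<^sub>i\<^sub>j G\<^sub>j\<^sub>i\<close>, which after exchanging the
  derivatives integrates to the integral of \<open>(div \<eta>)\<^sup>2 \<ge> 0\<close>.\<close>

lemma korn_test:
  fixes \<eta> :: "real^'n \<Rightarrow> real^'n"
  assumes \<eta>: "\<eta> \<in> test_functions \<Omega>"
  shows "integral\<^sup>L lebesgue (\<lambda>x. (norm (gradient \<eta> x))\<^sup>2) \<le>
      2 * integral\<^sup>L lebesgue (\<lambda>x. (norm (sym_part (gradient \<eta> x)))\<^sup>2)"
proof -
  note C = test_function_C1[OF \<eta>]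
  obtain K where K: "compact K" "\<forall>x. x \<notin> K \<longrightarrow> \<eta> x = 0"
    "\<forall>x i. x \<notin> K \<longrightarrow> partial_deriv i \<eta> x = 0"
    using test_function_support[OF \<eta>] by (elim exE conjE)
  let ?p = "\<lambda>i j x. partial_deriv i \<eta> x $ j"
  note pc = partial_deriv_component[OF C(2)]
  have cp: "continuous_on UNIV (?p i j)" for i j
    by (intro continuous_intros C)
  have ip: "integrable lebesgue (\<lambda>x. ?p i j x * ?p k l x)" for i j k l
    using K by (intro compact_support_integrable[OF _ K(1)] continuous_on_mult cp) auto
  have swap: "integral\<^sup>L lebesgue (\<lambda>x. ?p i j x * ?p j i x) = integral\<^sup>L lebesgue (\<lambda>x. ?p i i x * ?p j j x)" for i j
  proof -
    have "integral\<^sup>L lebesgue (\<lambda>x. partial_deriv i (\<lambda>x. \<eta> x $ j) x * partial_deriv j (\<lambda>x. \<eta> x $ i) x) =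
      integral\<^sup>L lebesgue (\<lambda>x. partial_deriv j (\<lambda>x. \<eta> x $ j) x * partial_deriv i (\<lambda>x. \<eta> x $ i) x)"
      by (rule exchange_derivatives[OF pc(1) _ pc(1) _ K(1)]) (use K(2) cp in \<open>simp_all add: pc(2)\<close>)
    then show ?thesis unfolding pc(2) by (simp only: mult.commute)
  qed
  have "(\<Sum>i\<in>UNIV. \<Sum>j\<in>UNIV. integral\<^sup>L lebesgue (\<lambda>x. ?p i j x * ?p j i x)) =
      integral\<^sup>L lebesgue (\<lambda>x. \<Sum>i\<in>UNIV. \<Sum>j\<in>UNIV. ?p i i x * ?p j j x)"
    by (simp add: swap ip)
  also have "\<dots> = integral\<^sup>L lebesgue (\<lambda>x. (\<Sum>i\<in>UNIV. ?p i i x)\<^sup>2)"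
    by (simp add: power2_eq_square sum_product)
  also have "\<dots> \<ge> 0" by (intro Bochner_Integration.integral_nonneg) simp
  finally have nn: "0 \<le> (\<Sum>i\<in>UNIV. \<Sum>j\<in>UNIV. integral\<^sup>L lebesgue (\<lambda>x. ?p i j x * ?p j i x))" .
  have sq: "integrable lebesgue (\<lambda>x. (norm (gradient \<eta> x))\<^sup>2)"
    unfolding norm_matrix_sq unfolding gradient_def vec_lambda_beta power2_eq_square
    by (intro Bochner_Integration.integrable_sum ip)
  have sq2: "integrable lebesgue (\<lambda>x. \<Sum>i\<in>UNIV. \<Sum>j\<in>UNIV. gradient \<eta> x $ i $ j * gradient \<eta> x $ j $ i)"
    unfolding gradient_def vec_lambda_beta by (intro Bochner_Integration.integrable_sum ip)
  have "integral\<^sup>L lebesgue (\<lambda>x. (norm (sym_part (gradient \<eta> x)))\<^sup>2) =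
      1/2 * integral\<^sup>L lebesgue (\<lambda>x. (norm (gradient \<eta> x))\<^sup>2) +
      1/2 * integral\<^sup>L lebesgue (\<lambda>x. \<Sum>i\<in>UNIV. \<Sum>j\<in>UNIV. gradient \<eta> x $ i $ j * gradient \<eta> x $ j $ i)"
    unfolding norm_sym_part_sq using sq sq2
    by (subst Bochner_Integration.integral_add) (auto simp only: integrable_mult_right integral_mult_right_zero)
  also have "integral\<^sup>L lebesgue (\<lambda>x. \<Sum>i\<in>UNIV. \<Sum>j\<in>UNIV. gradient \<eta> x $ i $ j * gradient \<eta> x $ j $ i) =
      (\<Sum>i\<in>UNIV. \<Sum>j\<in>UNIV. integral\<^sup>L lebesgue (\<lambda>x. ?p i j x * ?p j i x))"
    unfolding gradient_def vec_lambda_beta by (simp add: ip)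
  finally show ?thesis using nn by simp
qed

section \<open>The space \<open>H\<^sub>0\<^sup>1\<close>\<close>

lemma has_weak_deriv_weak_deriv: "has_weak_deriv \<Omega> u D \<Longrightarrow> has_weak_deriv \<Omega> u (weak_deriv \<Omega> u)"
  unfolding weak_deriv_def by (rule someI[of "has_weak_deriv \<Omega> u"])

lemma weak_deriv_AE_eq:
  "open \<Omega> \<Longrightarrow> has_weak_deriv \<Omega> u D \<Longrightarrow> AE x in lebesgue_on \<Omega>. weak_deriv \<Omega> u x = D x"
  by (rule weak_deriv_AE_unique[OF _ has_weak_deriv_weak_deriv])

text \<open>A weak derivative is measurable on each compact subset, and countably many closed boxes exhaust
  the open domain.\<close>

lemma has_weak_deriv_measurable:
  fixes u :: "real^'n \<Rightarrow> 'b::euclidean_space"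
  assumes "open \<Omega>" "has_weak_deriv \<Omega> u D"
  shows "D \<in> borel_measurable (lebesgue_on \<Omega>)"
proof -
  obtain \<D> where \<D>: "countable \<D>" "\<D> \<subseteq> Pow \<Omega>" "\<And>X. X \<in> \<D> \<Longrightarrow> \<exists>a b. X = cbox a b" "\<Union>\<D> = \<Omega>"
    using open_countable_Union_open_cbox[OF \<open>open \<Omega>\<close>] by metis
  show ?thesis
  proof (rule measurable_piecewise_restrict[OF \<D>(1)])
    show "space (lebesgue_on \<Omega>) \<subseteq> \<Union>\<D>" using \<D>(4) by simp
    fix X assume X: "X \<in> \<D>"
    then obtain a b where ab: "X = cbox a b" using \<D>(3) by meson
    have sub: "X \<subseteq> \<Omega>" using \<D>(2) X by auto
    show "X \<inter> space (lebesgue_on \<Omega>) \<in> sets (lebesgue_on \<Omega>)"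
      using sub ab \<open>open \<Omega>\<close> by (auto simp: sets_restrict_space_iff Int_absorb2)
    have "restrict_space (lebesgue_on \<Omega>) X = lebesgue_on X"
      using sub \<open>open \<Omega>\<close> ab by (subst restrict_restrict_space) (auto simp: Int_absorb1)
    moreover have "D \<in> borel_measurable (lebesgue_on X)"
      using weak_deriv_integrable(2)[OF assms(2) _ sub] ab by (auto dest: borel_measurable_integrable)
    ultimately show "D \<in> borel_measurable (restrict_space (lebesgue_on \<Omega>) X)" by simp
  qed
qed

lemma has_weak_deriv_lincomb:
  assumes "open \<Omega>" and u: "has_weak_deriv \<Omega> u D" and v: "has_weak_deriv \<Omega> v E"
  shows "has_weak_deriv \<Omega> (\<lambda>x. a *\<^sub>R u x + b *\<^sub>R v x) (\<lambda>x. a *\<^sub>R D x + b *\<^sub>R E x)"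
  unfolding has_weak_deriv_iff[OF \<open>open \<Omega>\<close>]
proof (intro conjI allI impI ballI)
  fix K assume K: "compact K \<and> K \<subseteq> \<Omega>"
  then show "integrable (lebesgue_on K) (\<lambda>x. a *\<^sub>R u x + b *\<^sub>R v x)"
    "integrable (lebesgue_on K) (\<lambda>x. a *\<^sub>R D x + b *\<^sub>R E x)"
    using weak_deriv_integrable[OF u] weak_deriv_integrable[OF v] by auto
next
  fix \<eta> :: "real^'a \<Rightarrow> real" and i assume \<eta>: "\<eta> \<in> test_functions \<Omega>"
  note I = weak_deriv_test_integrable[OF u \<eta>, of i] weak_deriv_test_integrable[OF v \<eta>, of i]
  have "integral\<^sup>L lebesgue (\<lambda>x. partial_deriv i \<eta> x *\<^sub>R (a *\<^sub>R u x + b *\<^sub>R v x)) =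
      integral\<^sup>L lebesgue (\<lambda>x. a *\<^sub>R (partial_deriv i \<eta> x *\<^sub>R u x) + b *\<^sub>R (partial_deriv i \<eta> x *\<^sub>R v x))"
    by (simp add: scaleR_add_right mult.commute)
  also have "\<dots> = a *\<^sub>R integral\<^sup>L lebesgue (\<lambda>x. partial_deriv i \<eta> x *\<^sub>R u x) + b *\<^sub>R integral\<^sup>L lebesgue (\<lambda>x. partial_deriv i \<eta> x *\<^sub>R v x)"
    using I by (subst Bochner_Integration.integral_add) (auto simp only: integrable_scaleR_right integral_scaleR_right)
  also have "\<dots> = - (a *\<^sub>R integral\<^sup>L lebesgue (\<lambda>x. \<eta> x *\<^sub>R D x $ i) + b *\<^sub>R integral\<^sup>L lebesgue (\<lambda>x. \<eta> x *\<^sub>R E x $ i))"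
    unfolding has_weak_deriv_integral[OF \<open>open \<Omega>\<close> u \<eta>] has_weak_deriv_integral[OF \<open>open \<Omega>\<close> v \<eta>] by simp
  also have "a *\<^sub>R integral\<^sup>L lebesgue (\<lambda>x. \<eta> x *\<^sub>R D x $ i) + b *\<^sub>R integral\<^sup>L lebesgue (\<lambda>x. \<eta> x *\<^sub>R E x $ i) =
    integral\<^sup>L lebesgue (\<lambda>x. a *\<^sub>R (\<eta> x *\<^sub>R D x $ i) + b *\<^sub>R (\<eta> x *\<^sub>R E x $ i))"
    using I by (subst Bochner_Integration.integral_add) (auto simp only: integrable_scaleR_right integral_scaleR_right)
  also have "\<dots> = integral\<^sup>L lebesgue (\<lambda>x. \<eta> x *\<^sub>R ((a *\<^sub>R D x + b *\<^sub>R E x) $ i))"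
    by (simp add: scaleR_add_right mult.commute)
  finally show "integral\<^sup>L lebesgue (\<lambda>x. partial_deriv i \<eta> x *\<^sub>R (a *\<^sub>R u x + b *\<^sub>R v x)) =
    - integral\<^sup>L lebesgue (\<lambda>x. \<eta> x *\<^sub>R ((a *\<^sub>R D x + b *\<^sub>R E x) $ i))" .
qed

lemma test_functions_lincomb:
  assumes "\<eta> \<in> test_functions \<Omega>" "\<zeta> \<in> test_functions \<Omega>"
  shows "(\<lambda>x. a *\<^sub>R \<eta> x + b *\<^sub>R \<zeta> x) \<in> test_functions \<Omega>"
    and "gradient (\<lambda>x. a *\<^sub>R \<eta> x + b *\<^sub>R \<zeta> x) x = a *\<^sub>R gradient \<eta> x + b *\<^sub>R gradient \<zeta> x"
proof -
  let ?f = "\<lambda>x. a *\<^sub>R \<eta> x + b *\<^sub>R \<zeta> x"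
  let ?S = "closure {x. \<eta> x \<noteq> 0} \<union> closure {x. \<zeta> x \<noteq> 0}"
  have ck: "Ck k ?f" for k
    using assms by (intro Ck_add Ck_scaleR Ck_const) (auto simp: test_functions_def)
  have cl: "closure {x. ?f x \<noteq> 0} \<subseteq> ?S"
  proof (rule closure_minimal)
    show "{x. ?f x \<noteq> 0} \<subseteq> ?S"
      using closure_subset[of "{x. \<eta> x \<noteq> 0}"] closure_subset[of "{x. \<zeta> x \<noteq> 0}"] by force
  qed auto
  have "compact ?S" "?S \<subseteq> \<Omega>" using assms by (auto simp: test_functions_def)
  then have "compact (closure {x. ?f x \<noteq> 0})" "closure {x. ?f x \<noteq> 0} \<subseteq> \<Omega>"
    using cl by (meson bounded_subset closed_closure compact_eq_bounded_closed subset_trans)+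
  then show "?f \<in> test_functions \<Omega>" using ck by (simp add: test_functions_def)
  note d = test_function_C1(2)[OF assms(1)] test_function_C1(2)[OF assms(2)]
  have "(?f has_derivative (\<lambda>h. a *\<^sub>R frechet_derivative \<eta> (at x) h + b *\<^sub>R frechet_derivative \<zeta> (at x) h)) (at x)"
    by (intro has_derivative_add has_derivative_scaleR_right differentiable_on_UNIV_has_derivative d)
  from partial_deriv_eq[OF this] show "gradient ?f x = a *\<^sub>R gradient \<eta> x + b *\<^sub>R gradient \<zeta> x"
    by (simp add: gradient_def vec_eq_iff partial_deriv_def)
qed

lemma test_square_integrable:
  fixes \<eta> :: "real^'n \<Rightarrow> 'b::euclidean_space"
  assumes "open \<Omega>" and \<eta>: "\<eta> \<in> test_functions \<Omega>"
  shows "square_integrable (lebesgue_on \<Omega>) \<eta>" "square_integrable (lebesgue_on \<Omega>) (gradient \<eta>)"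
    and "L2_sq \<Omega> \<eta> = (\<integral>x. (norm (\<eta> x))\<^sup>2 \<partial>lebesgue)"
    and "\<And>f. f 0 = 0 \<Longrightarrow> (\<integral>x. (f (gradient \<eta> x) :: real) \<partial>lebesgue_on \<Omega>) = (\<integral>x. f (gradient \<eta> x) \<partial>lebesgue)"
proof -
  note C = test_function_C1[OF \<eta>]
  obtain K where K: "compact K" "K \<subseteq> \<Omega>" "\<forall>x. x \<notin> K \<longrightarrow> \<eta> x = 0"
    "\<forall>x i. x \<notin> K \<longrightarrow> partial_deriv i \<eta> x = 0"
    using test_function_support[OF \<eta>] by (elim exE conjE)
  have S: "\<Omega> \<in> sets lebesgue" using \<open>open \<Omega>\<close> by auto
  have z: "gradient \<eta> x = 0" if "x \<notin> K" for x using K that by (simp add: gradient_def vec_eq_iff)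
  have cg: "continuous_on UNIV (gradient \<eta>)"
    unfolding gradient_def[abs_def] by (intro continuous_on_vec_lambda C)
  have *: "square_integrable (lebesgue_on \<Omega>) f"
    if "continuous_on UNIV f" "\<forall>x. x \<notin> K \<longrightarrow> f x = 0" for f :: "real^'n \<Rightarrow> 'd::euclidean_space"
    unfolding square_integrable_def
  proof
    show "f \<in> borel_measurable (lebesgue_on \<Omega>)"
      by (intro measurable_restrict_space1 borel_imp_lebesgue_measurable borel_measurable_continuous_onI that)
    have i: "integrable lebesgue (\<lambda>x. (norm (f x))\<^sup>2)"
      by (rule compact_support_integrable[OF _ K(1)]) (use that in \<open>auto intro!: continuous_intros\<close>)
    have o: "(norm (f x))\<^sup>2 = 0" if "x \<notin> \<Omega>" for x
      using \<open>\<forall>x. x \<notin> K \<longrightarrow> f x = 0\<close> K(2) that by auto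
    show "integrable (lebesgue_on \<Omega>) (\<lambda>x. (norm (f x))\<^sup>2)"
      using i o integral_lebesgue_on_support(2)[OF S, of "\<lambda>x. (norm (f x))\<^sup>2"] by blast
  qed
  show "square_integrable (lebesgue_on \<Omega>) \<eta>" "square_integrable (lebesgue_on \<Omega>) (gradient \<eta>)"
    using * C(1) K(3) cg z by blast+
  show "L2_sq \<Omega> \<eta> = (\<integral>x. (norm (\<eta> x))\<^sup>2 \<partial>lebesgue)"
    by (rule integral_lebesgue_on_support(1)[OF S]) (use K in auto)
  show "(\<integral>x. f (gradient \<eta> x) \<partial>lebesgue_on \<Omega>) = (\<integral>x. f (gradient \<eta> x) \<partial>lebesgue)"
    if "f 0 = 0" for f :: "'b^'n \<Rightarrow> real"
  proof (rule integral_lebesgue_on_support(1)[OF S])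
    fix x assume "x \<notin> \<Omega>"
    then have "x \<notin> K" using K(2) by blast
    from z[OF this] that show "f (gradient \<eta> x) = 0" by simp
  qed
qed

lemma weak_deriv_square_integrable:
  assumes "open \<Omega>" "has_weak_deriv \<Omega> u D" "square_integrable (lebesgue_on \<Omega>) D"
  shows "square_integrable (lebesgue_on \<Omega>) (weak_deriv \<Omega> u)"
    "L2_sq \<Omega> (weak_deriv \<Omega> u) = L2_sq \<Omega> D"
proof -
  have ae: "AE x in lebesgue_on \<Omega>. D x = weak_deriv \<Omega> u x"
    using weak_deriv_AE_eq[OF assms(1,2)] by eventually_elim simp
  have m: "weak_deriv \<Omega> u \<in> borel_measurable (lebesgue_on \<Omega>)"
    by (rule has_weak_deriv_measurable[OF assms(1) has_weak_deriv_weak_deriv[OF assms(2)]])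
  show "square_integrable (lebesgue_on \<Omega>) (weak_deriv \<Omega> u)"
    "L2_sq \<Omega> (weak_deriv \<Omega> u) = L2_sq \<Omega> D"
    by (rule square_integrable_AE_cong[OF assms(3) m ae])+
qed

lemma L2_norm_norm: "L2_norm \<Omega> (\<lambda>x. norm (f x)) = sqrt (L2_sq \<Omega> f)"
  by (simp add: L2_norm_def)

lemma sobolev_norm_diff_test:
  assumes "open \<Omega>" "has_weak_deriv \<Omega> u D" "square_integrable (lebesgue_on \<Omega>) D" "\<eta> \<in> test_functions \<Omega>"
  shows "sobolev_norm (L2_norm \<Omega>) \<Omega> (\<lambda>x. u x - \<eta> x) =
    sqrt (L2_sq \<Omega> (\<lambda>x. u x - \<eta> x)) + sqrt (L2_sq \<Omega> (\<lambda>x. D x - gradient \<eta> x))"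
proof -
  have d: "has_weak_deriv \<Omega> (\<lambda>x. u x - \<eta> x) (\<lambda>x. D x - gradient \<eta> x)"
    using has_weak_deriv_lincomb[OF assms(1,2) test_weak_deriv[OF assms(1,4)], of 1 "-1"] by simp
  have s: "square_integrable (lebesgue_on \<Omega>) (\<lambda>x. D x - gradient \<eta> x)"
    using square_integrable_lincomb(1)[OF assms(3) test_square_integrable(2)[OF assms(1,4)], of 1 "-1"] by simp
  show ?thesis
    unfolding sobolev_norm_def L2_norm_norm weak_deriv_square_integrable(2)[OF assms(1) d s] by (rule refl)
qed

text \<open>A formulation free of the choice in \<open>weak_deriv\<close> and of square roots: the two approximation
  errors can be handled separately because only their smallness matters.\<close>

lemma H10_iff:
  fixes u :: "real^'n \<Rightarrow> 'b::euclidean_space"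
  assumes "open \<Omega>"
  shows "u \<in> H10 \<Omega> \<longleftrightarrow> (\<exists>D. has_weak_deriv \<Omega> u D \<and>
    square_integrable (lebesgue_on \<Omega>) u \<and> square_integrable (lebesgue_on \<Omega>) D \<and>
    (\<forall>e>0. \<exists>\<eta>\<in>test_functions \<Omega>. L2_sq \<Omega> (\<lambda>x. u x - \<eta> x) < e \<and>
        L2_sq \<Omega> (\<lambda>x. D x - gradient \<eta> x) < e))" (is "?l \<longleftrightarrow> ?r")
proof
  assume u: ?l
  then obtain D where D: "has_weak_deriv \<Omega> u D" "(\<lambda>x. norm (D x)) \<in> L2_space \<Omega>"
    and m: "u \<in> borel_measurable (lebesgue_on \<Omega>)" "(\<lambda>x. norm (u x)) \<in> L2_space \<Omega>"
    by (auto simp: H10_def sobolev0_def sobolev_def)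
  have su: "square_integrable (lebesgue_on \<Omega>) u" using m by (auto simp: square_integrable_def L2_space_def)
  have sD: "square_integrable (lebesgue_on \<Omega>) D"
    using D has_weak_deriv_measurable[OF assms D(1)] by (auto simp: square_integrable_def L2_space_def)
  have "\<exists>\<eta>\<in>test_functions \<Omega>. L2_sq \<Omega> (\<lambda>x. u x - \<eta> x) < e \<and>
        L2_sq \<Omega> (\<lambda>x. D x - gradient \<eta> x) < e" if "e > 0" for e
  proof -
    have "sqrt e > 0" using that by simp
    then obtain \<eta> where \<eta>: "\<eta> \<in> test_functions \<Omega>" "sobolev_norm (L2_norm \<Omega>) \<Omega> (\<lambda>x. u x - \<eta> x) < sqrt e"
      using u unfolding H10_def sobolev0_def by blast
    let ?a = "\<integral>x. (norm (u x - \<eta> x))\<^sup>2 \<partial>lebesgue_on \<Omega>"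
    let ?b = "\<integral>x. (norm (D x - gradient \<eta> x))\<^sup>2 \<partial>lebesgue_on \<Omega>"
    have "0 \<le> ?a" "0 \<le> ?b" by (intro Bochner_Integration.integral_nonneg; simp)+
    moreover have "sqrt ?a + sqrt ?b < sqrt e"
      using \<eta>(2) unfolding sobolev_norm_diff_test[OF assms D(1) sD \<eta>(1)] .
    moreover have "0 \<le> sqrt ?a" "0 \<le> sqrt ?b" using calculation by simp_all
    ultimately have "sqrt ?a < sqrt e" "sqrt ?b < sqrt e" by linarith+
    then have "?a < e" "?b < e" by (simp_all only: real_sqrt_less_iff)
    with \<eta>(1) show ?thesis by blast
  qed
  with su sD D(1) show ?r by blast
next
  assume ?r
  then obtain D where D: "has_weak_deriv \<Omega> u D" "square_integrable (lebesgue_on \<Omega>) u"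
    "square_integrable (lebesgue_on \<Omega>) D"
    and app: "\<And>e. e > 0 \<Longrightarrow> \<exists>\<eta>\<in>test_functions \<Omega>. L2_sq \<Omega> (\<lambda>x. u x - \<eta> x) < e \<and>
        L2_sq \<Omega> (\<lambda>x. D x - gradient \<eta> x) < e"
    by blast
  have "u \<in> sobolev (L2_space \<Omega>) \<Omega>"
    using D by (auto simp: sobolev_def square_integrable_def L2_space_def intro!: exI[of _ D])
  moreover have "\<exists>\<eta>\<in>test_functions \<Omega>. sobolev_norm (L2_norm \<Omega>) \<Omega> (\<lambda>x. u x - \<eta> x) < e" if "e > 0" for e
  proof -
    have "(e / 2)\<^sup>2 > 0" using that by simp
    from app[OF this] obtain \<eta> where \<eta>: "\<eta> \<in> test_functions \<Omega>"
      "L2_sq \<Omega> (\<lambda>x. u x - \<eta> x) < (e / 2)\<^sup>2"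
      "L2_sq \<Omega> (\<lambda>x. D x - gradient \<eta> x) < (e / 2)\<^sup>2" by blast
    have "sqrt a < e / 2" if "a < (e / 2)\<^sup>2" for a
      using that \<open>e > 0\<close> real_less_lsqrt[of a "e / 2"] real_sqrt_less_mono[OF that] by simp
    from this[OF \<eta>(2)] this[OF \<eta>(3)] have "sobolev_norm (L2_norm \<Omega>) \<Omega> (\<lambda>x. u x - \<eta> x) < e"
      unfolding sobolev_norm_diff_test[OF assms D(1,3) \<eta>(1)] by simp
    with \<eta>(1) show ?thesis by blast
  qed
  ultimately show ?l by (simp add: H10_def sobolev0_def)
qed

lemma H10_weak_deriv:
  fixes u :: "real^'n \<Rightarrow> 'b::euclidean_space"
  assumes "open \<Omega>" and u: "u \<in> H10 \<Omega>"
  shows "has_weak_deriv \<Omega> u (weak_deriv \<Omega> u)"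
    "square_integrable (lebesgue_on \<Omega>) u" "square_integrable (lebesgue_on \<Omega>) (weak_deriv \<Omega> u)"
    "\<And>e. e > 0 \<Longrightarrow> \<exists>\<eta>\<in>test_functions \<Omega>. L2_sq \<Omega> (\<lambda>x. u x - \<eta> x) < e \<and>
        L2_sq \<Omega> (\<lambda>x. weak_deriv \<Omega> u x - gradient \<eta> x) < e"
proof -
  obtain D where D: "has_weak_deriv \<Omega> u D" "square_integrable (lebesgue_on \<Omega>) u"
    "square_integrable (lebesgue_on \<Omega>) D"
    and app: "\<And>e. e > 0 \<Longrightarrow> \<exists>\<eta>\<in>test_functions \<Omega>. L2_sq \<Omega> (\<lambda>x. u x - \<eta> x) < e \<and>
        L2_sq \<Omega> (\<lambda>x. D x - gradient \<eta> x) < e"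
    using u unfolding H10_iff[OF assms(1)] by blast
  show "has_weak_deriv \<Omega> u (weak_deriv \<Omega> u)" by (rule has_weak_deriv_weak_deriv[OF D(1)])
  show "square_integrable (lebesgue_on \<Omega>) u" by (rule D(2))
  show s: "square_integrable (lebesgue_on \<Omega>) (weak_deriv \<Omega> u)"
    by (rule weak_deriv_square_integrable(1)[OF assms(1) D(1,3)])
  fix e :: real assume "e > 0"
  from app[OF this] obtain \<eta> where \<eta>: "\<eta> \<in> test_functions \<Omega>" "L2_sq \<Omega> (\<lambda>x. u x - \<eta> x) < e"
     "L2_sq \<Omega> (\<lambda>x. D x - gradient \<eta> x) < e" by blast
  have g: "square_integrable (lebesgue_on \<Omega>) (\<lambda>x. F x - gradient \<eta> x)"
    if "square_integrable (lebesgue_on \<Omega>) F" for F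
    using square_integrable_lincomb(1)[OF that test_square_integrable(2)[OF assms(1) \<eta>(1)], of 1 "-1"] by simp
  have ae: "AE x in lebesgue_on \<Omega>. D x - gradient \<eta> x = weak_deriv \<Omega> u x - gradient \<eta> x"
    using weak_deriv_AE_eq[OF assms(1) D(1)] by eventually_elim simp
  have "(\<lambda>x. weak_deriv \<Omega> u x - gradient \<eta> x) \<in> borel_measurable (lebesgue_on \<Omega>)"
    using g[OF s] by (simp add: square_integrable_def)
  from square_integrable_AE_cong(2)[OF g[OF D(3)] this ae] \<eta>
  show "\<exists>\<eta>\<in>test_functions \<Omega>. L2_sq \<Omega> (\<lambda>x. u x - \<eta> x) < e \<and>
        L2_sq \<Omega> (\<lambda>x. weak_deriv \<Omega> u x - gradient \<eta> x) < e"
    by (intro bexI[of _ \<eta>]) auto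
qed

lemma weak_deriv_lincomb:
  assumes "open \<Omega>" "has_weak_deriv \<Omega> u D" "has_weak_deriv \<Omega> v E"
  shows "AE x in lebesgue_on \<Omega>. weak_deriv \<Omega> (\<lambda>x. a *\<^sub>R u x + b *\<^sub>R v x) x = a *\<^sub>R D x + b *\<^sub>R E x"
  by (rule weak_deriv_AE_eq[OF assms(1) has_weak_deriv_lincomb[OF assms]])

text \<open>The same combination of approximating test functions approximates the combination; \<open>c\<close> absorbs the
  factors produced by \<open>square_integrable_lincomb\<close>.\<close>

lemma H10_lincomb:
  fixes u v :: "real^'n \<Rightarrow> 'b::euclidean_space"
  assumes "open \<Omega>" and u: "u \<in> H10 \<Omega>" and v: "v \<in> H10 \<Omega>"
  shows "(\<lambda>x. a *\<^sub>R u x + b *\<^sub>R v x) \<in> H10 \<Omega>"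
  unfolding H10_iff[OF assms(1)]
proof (intro exI conjI allI impI)
  note U = H10_weak_deriv[OF assms(1) u] and V = H10_weak_deriv[OF assms(1) v]
  let ?D = "\<lambda>x. a *\<^sub>R weak_deriv \<Omega> u x + b *\<^sub>R weak_deriv \<Omega> v x"
  show "has_weak_deriv \<Omega> (\<lambda>x. a *\<^sub>R u x + b *\<^sub>R v x) ?D"
    by (rule has_weak_deriv_lincomb[OF assms(1) U(1) V(1)])
  show "square_integrable (lebesgue_on \<Omega>) (\<lambda>x. a *\<^sub>R u x + b *\<^sub>R v x)"
    "square_integrable (lebesgue_on \<Omega>) ?D"
    by (intro square_integrable_lincomb U V)+
  fix e :: real assume "e > 0"
  define c where "c = 2 * a\<^sup>2 + 2 * b\<^sup>2 + 1"
  have "c > 0" unfolding c_def by (intro add_nonneg_pos add_nonneg_nonneg) auto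
  have "e / c > 0" using \<open>e > 0\<close> \<open>c > 0\<close> by simp
  obtain \<eta> where \<eta>: "\<eta> \<in> test_functions \<Omega>" "L2_sq \<Omega> (\<lambda>x. u x - \<eta> x) < e / c"
     "L2_sq \<Omega> (\<lambda>x. weak_deriv \<Omega> u x - gradient \<eta> x) < e / c"
    using U(4)[OF \<open>e / c > 0\<close>] by blast
  obtain \<zeta> where \<zeta>: "\<zeta> \<in> test_functions \<Omega>" "L2_sq \<Omega> (\<lambda>x. v x - \<zeta> x) < e / c"
     "L2_sq \<Omega> (\<lambda>x. weak_deriv \<Omega> v x - gradient \<zeta> x) < e / c"
    using V(4)[OF \<open>e / c > 0\<close>] by blast
  have diff: "square_integrable (lebesgue_on \<Omega>) (\<lambda>x. f x - g x)"
    if "square_integrable (lebesgue_on \<Omega>) f" "square_integrable (lebesgue_on \<Omega>) g"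
    for f g :: "real^'n \<Rightarrow> 'd::euclidean_space"
    using square_integrable_lincomb(1)[OF that, of 1 "-1"] by simp
  have small: "2 * a\<^sup>2 * s + 2 * b\<^sup>2 * t < e" if "s < e / c" "t < e / c" for s t
  proof -
    have "2 * a\<^sup>2 * s + 2 * b\<^sup>2 * t \<le> 2 * a\<^sup>2 * (e / c) + 2 * b\<^sup>2 * (e / c)"
      using that by (intro add_mono mult_left_mono) auto
    also have "\<dots> < (2 * a\<^sup>2 + 2 * b\<^sup>2 + 1) * (e / c)"
      using \<open>e / c > 0\<close> by (simp only: distrib_right mult_1)
    also have "\<dots> = c * (e / c)" by (simp only: c_def)
    also have "\<dots> = e" using \<open>c > 0\<close> by simp
    finally show ?thesis .
  qed
  note tu = test_square_integrable[OF assms(1) \<eta>(1)] and tv = test_square_integrable[OF assms(1) \<zeta>(1)]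
  let ?\<theta> = "\<lambda>x. a *\<^sub>R \<eta> x + b *\<^sub>R \<zeta> x"
  have "L2_sq \<Omega> (\<lambda>x. (a *\<^sub>R u x + b *\<^sub>R v x) - ?\<theta> x) =
      L2_sq \<Omega> (\<lambda>x. a *\<^sub>R (u x - \<eta> x) + b *\<^sub>R (v x - \<zeta> x))"
    by (simp add: algebra_simps)
  also have "\<dots> \<le> 2 * a\<^sup>2 * L2_sq \<Omega> (\<lambda>x. u x - \<eta> x) + 2 * b\<^sup>2 * L2_sq \<Omega> (\<lambda>x. v x - \<zeta> x)"
    by (intro square_integrable_lincomb diff U V tu tv)
  also have "\<dots> < e" by (rule small[OF \<eta>(2) \<zeta>(2)])
  finally have 1: "L2_sq \<Omega> (\<lambda>x. (a *\<^sub>R u x + b *\<^sub>R v x) - ?\<theta> x) < e" .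
  have "L2_sq \<Omega> (\<lambda>x. ?D x - gradient ?\<theta> x) =
      L2_sq \<Omega> (\<lambda>x. a *\<^sub>R (weak_deriv \<Omega> u x - gradient \<eta> x) + b *\<^sub>R (weak_deriv \<Omega> v x - gradient \<zeta> x))"
    unfolding test_functions_lincomb(2)[OF \<eta>(1) \<zeta>(1)] by (simp add: algebra_simps)
  also have "\<dots> \<le> 2 * a\<^sup>2 * L2_sq \<Omega> (\<lambda>x. weak_deriv \<Omega> u x - gradient \<eta> x) +
      2 * b\<^sup>2 * L2_sq \<Omega> (\<lambda>x. weak_deriv \<Omega> v x - gradient \<zeta> x)"
    by (intro square_integrable_lincomb diff U V tu tv)
  also have "\<dots> < e" by (rule small[OF \<eta>(3) \<zeta>(3)])
  finally have 2: "L2_sq \<Omega> (\<lambda>x. ?D x - gradient ?\<theta> x) < e" .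
  show "\<exists>\<theta>\<in>test_functions \<Omega>. L2_sq \<Omega> (\<lambda>x. (a *\<^sub>R u x + b *\<^sub>R v x) - \<theta> x) < e \<and>
     L2_sq \<Omega> (\<lambda>x. ?D x - gradient \<theta> x) < e"
    by (rule bexI[OF _ test_functions_lincomb(1)[OF \<eta>(1) \<zeta>(1)]]) (use 1 2 in blast)
qed

text \<open>Nonemptiness is essential: over an empty set the infimum defining \<open>J_F\<close> would be \<open>\<infinity>\<close>, and the
  energy \<open>- J_F\<close> of the convex case would be \<open>- \<infinity>\<close>.\<close>

lemma H10_zero:
  assumes "open \<Omega>"
  shows "(\<lambda>x::real^'n. 0 :: 'b::euclidean_space) \<in> H10 \<Omega>"
    "AE x in lebesgue_on \<Omega>. weak_deriv \<Omega> (\<lambda>x::real^'n. 0 :: 'b) x = 0"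
proof -
  let ?z = "\<lambda>x::real^'n. 0 :: 'b"
  have t: "?z \<in> test_functions \<Omega>" using Ck_const by (auto simp: test_functions_def)
  have g: "gradient ?z = (\<lambda>x. 0)"
    using test_functions_lincomb(2)[OF t t, of 0 0] by (auto simp: fun_eq_iff)
  have d: "has_weak_deriv \<Omega> ?z (\<lambda>x. 0)" using test_weak_deriv[OF assms t] unfolding g .
  show "?z \<in> H10 \<Omega>"
    unfolding H10_iff[OF assms]
    by (intro exI[of _ "\<lambda>x. 0"] conjI d allI impI bexI[OF _ t])
      (simp_all add: g square_integrable_def)
  show "AE x in lebesgue_on \<Omega>. weak_deriv \<Omega> ?z x = 0"
    by (rule weak_deriv_AE_eq[OF assms d])
qed

lemma norm_gradient_ge: "(norm (partial_deriv i f x))\<^sup>2 \<le> (norm (gradient f x))\<^sup>2"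
proof -
  have "norm (gradient f x $ i) \<le> norm (gradient f x)" by (rule Finite_Cartesian_Product.norm_nth_le)
  then show ?thesis by (simp add: gradient_def power_mono)
qed

text \<open>Density of test functions; the constant grows from \<open>4\<close> to \<open>16\<close> because two passages to the
  approximating function each cost a factor \<open>2\<close>.\<close>

lemma H10_poincare:
  fixes u :: "real^'n \<Rightarrow> 'b::euclidean_space"
  assumes "open \<Omega>" and u: "u \<in> H10 \<Omega>" and R: "\<And>x. x \<in> \<Omega> \<Longrightarrow> norm x \<le> R"
  shows "L2_sq \<Omega> u \<le>
      16 * R\<^sup>2 * L2_sq \<Omega> (weak_deriv \<Omega> u)"
proof (rule field_le_epsilon)
  fix d :: real assume "d > 0"
  note U = H10_weak_deriv[OF assms(1) u]
  \<comment> \<open>Chosen so that the accumulated approximation errors \<open>2 e + 16 R\<^sup>2 e\<close> add up to \<open>d\<close>.\<close>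
  define e where "e = d / (2 + 16 * R\<^sup>2)"
  have c: "2 + 16 * R\<^sup>2 > 0" by (intro add_pos_nonneg) auto
  then have "e > 0" using \<open>d > 0\<close> by (simp add: e_def)
  have "2 * e + 16 * R\<^sup>2 * e = (2 + 16 * R\<^sup>2) * e" by (simp only: distrib_right)
  also have "\<dots> = d" using c unfolding e_def by simp
  finally have ed: "2 * e + 16 * R\<^sup>2 * e = d" .
  obtain \<eta> where \<eta>: "\<eta> \<in> test_functions \<Omega>" "L2_sq \<Omega> (\<lambda>x. u x - \<eta> x) < e"
     "L2_sq \<Omega> (\<lambda>x. weak_deriv \<Omega> u x - gradient \<eta> x) < e"
    using U(4)[OF \<open>e > 0\<close>] by blast
  note t = test_square_integrable[OF assms(1) \<eta>(1)]
  obtain i :: 'n where True by blast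
  have "\<bar>x $ i\<bar> \<le> R" if "x \<in> \<Omega>" for x using R[OF that] component_le_norm_cart[of x i] by linarith
  then have "(\<integral>x. (norm (\<eta> x))\<^sup>2 \<partial>lebesgue) \<le> 4 * R\<^sup>2 * (\<integral>x. (norm (partial_deriv i \<eta> x))\<^sup>2 \<partial>lebesgue)"
    by (rule poincare_test[OF \<eta>(1)])
  also have "\<dots> \<le> 4 * R\<^sup>2 * (\<integral>x. (norm (gradient \<eta> x))\<^sup>2 \<partial>lebesgue)"
  proof (intro mult_left_mono integral_mono norm_gradient_ge)
    obtain K where K: "compact K" "\<forall>x i. x \<notin> K \<longrightarrow> partial_deriv i \<eta> x = 0"
      using test_function_support[OF \<eta>(1)] by (elim exE conjE)
    note C = test_function_C1[OF \<eta>(1)]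
    have cg: "continuous_on UNIV (gradient \<eta>)"
      unfolding gradient_def[abs_def] by (intro continuous_on_vec_lambda C)
    have z: "\<forall>x. x \<notin> K \<longrightarrow> gradient \<eta> x = 0" using K(2) by (simp add: gradient_def vec_eq_iff)
    show "integrable lebesgue (\<lambda>x. (norm (partial_deriv i \<eta> x))\<^sup>2)"
      by (rule compact_support_integrable[OF _ K(1)]) (use K(2) in \<open>auto intro!: continuous_intros C\<close>)
    show "integrable lebesgue (\<lambda>x. (norm (gradient \<eta> x))\<^sup>2)"
      by (rule compact_support_integrable[OF _ K(1)])
        (use z in \<open>auto intro!: continuous_intros cg\<close>)
  qed simp
  finally have p: "L2_sq \<Omega> \<eta> \<le> 4 * R\<^sup>2 * L2_sq \<Omega> (gradient \<eta>)" using t(3) t(4)[of "\<lambda>v. (norm v)\<^sup>2"] by simp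
  have "L2_sq \<Omega> u \<le> 2 * L2_sq \<Omega> (\<lambda>x. u x - \<eta> x) + 2 * L2_sq \<Omega> \<eta>"
    by (rule integral_square_triangle[OF U(2) t(1)])
  moreover have "L2_sq \<Omega> (gradient \<eta>) \<le> 2 * L2_sq \<Omega> (\<lambda>x. gradient \<eta> x - weak_deriv \<Omega> u x) + 2 * L2_sq \<Omega> (weak_deriv \<Omega> u)"
    by (rule integral_square_triangle[OF t(2) U(3)])
  then have "L2_sq \<Omega> (gradient \<eta>) \<le> 2 * e + 2 * L2_sq \<Omega> (weak_deriv \<Omega> u)" using \<eta>(3) by (simp add: norm_minus_commute)
  then have "4 * R\<^sup>2 * L2_sq \<Omega> (gradient \<eta>) \<le> 4 * R\<^sup>2 * (2 * e + 2 * L2_sq \<Omega> (weak_deriv \<Omega> u))"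
    by (rule mult_left_mono) simp
  ultimately have "L2_sq \<Omega> u \<le> (2 * e + 16 * R\<^sup>2 * e) + 16 * R\<^sup>2 * L2_sq \<Omega> (weak_deriv \<Omega> u)"
    using p \<eta>(2) by (simp add: algebra_simps)
  then show "L2_sq \<Omega> u \<le> 16 * R\<^sup>2 * L2_sq \<Omega> (weak_deriv \<Omega> u) + d" unfolding ed by simp
qed

lemma sym_part_linear: "sym_part (a *\<^sub>R A + b *\<^sub>R B) = a *\<^sub>R sym_part A + b *\<^sub>R sym_part B"
  by (simp add: sym_part_def vec_eq_iff transpose_def algebra_simps)

lemma sym_part_diff: "sym_part (A - B) = sym_part A - sym_part B"
  using sym_part_linear[of 1 A "-1" B] by simp

lemma norm_sym_part_le: "norm (sym_part A) \<le> norm A"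
proof -
  have "(norm (transpose A))\<^sup>2 = (norm A)\<^sup>2"
    unfolding norm_matrix_sq by (simp add: transpose_def) (rule sum.swap)
  then have "norm (transpose A) = norm A" by simp
  then show ?thesis using norm_triangle_ineq[of A "transpose A"] by (simp add: sym_part_def)
qed

lemma square_integrable_sym_part:
  assumes "square_integrable M D"
  shows "square_integrable M (\<lambda>x. sym_part (D x))"
    "(\<integral>x. (norm (sym_part (D x)))\<^sup>2 \<partial>M) \<le> (\<integral>x. (norm (D x))\<^sup>2 \<partial>M)"
proof -
  have D: "D \<in> borel_measurable M" "integrable M (\<lambda>x. (norm (D x))\<^sup>2)"
    using assms by (auto simp: square_integrable_def)
  have "linear sym_part"
    by (rule linearI) (simp_all add: sym_part_def vec_eq_iff transpose_def algebra_simps)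
  then have "continuous_on UNIV sym_part" by (rule linear_continuous_on[OF linear_conv_bounded_linear[THEN iffD1]])
  then have m: "(\<lambda>x. sym_part (D x)) \<in> borel_measurable M"
    using D(1) borel_measurable_continuous_onI measurable_compose by blast
  have le: "(norm (sym_part (D x)))\<^sup>2 \<le> (norm (D x))\<^sup>2" for x
    by (intro power_mono norm_sym_part_le) simp
  have i: "integrable M (\<lambda>x. (norm (sym_part (D x)))\<^sup>2)"
    by (rule Bochner_Integration.integrable_bound[OF D(2)]) (use m le in \<open>auto intro!: AE_I2\<close>)
  show "square_integrable M (\<lambda>x. sym_part (D x))" using m i by (simp add: square_integrable_def)
  show "(\<integral>x. (norm (sym_part (D x)))\<^sup>2 \<partial>M) \<le> (\<integral>x. (norm (D x))\<^sup>2 \<partial>M)"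
    by (intro integral_mono i D le)
qed

text \<open>Density of test functions, using that taking the symmetric part does not increase the norm.\<close>

lemma H10_korn:
  fixes u :: "real^'n \<Rightarrow> real^'n"
  assumes "open \<Omega>" and u: "u \<in> H10 \<Omega>"
  shows "L2_sq \<Omega> (weak_deriv \<Omega> u) \<le>
      8 * L2_sq \<Omega> (\<lambda>x. sym_part (weak_deriv \<Omega> u x))"
proof (rule field_le_epsilon)
  fix d :: real assume "d > 0"
  note U = H10_weak_deriv[OF assms(1) u]
  \<comment> \<open>The errors below add up to \<open>2 e + 8 e\<close>.\<close>
  define e where "e = d / 10"
  then have "e > 0" using \<open>d > 0\<close> by simp
  let ?D = "weak_deriv \<Omega> u"
  obtain \<eta> where \<eta>: "\<eta> \<in> test_functions \<Omega>"
     "L2_sq \<Omega> (\<lambda>x. ?D x - gradient \<eta> x) < e"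
    using U(4)[OF \<open>e > 0\<close>] by blast
  note t = test_square_integrable[OF assms(1) \<eta>(1)]
  have "L2_sq \<Omega> (gradient \<eta>) \<le> 2 * L2_sq \<Omega> (\<lambda>x. sym_part (gradient \<eta> x))"
    using korn_test[OF \<eta>(1)] t(4)[of "\<lambda>v. (norm v)\<^sup>2"] t(4)[of "\<lambda>v. (norm (sym_part v))\<^sup>2"]
    by (simp add: sym_part_def transpose_def zero_vec_def)
  moreover have "L2_sq \<Omega> ?D \<le> 2 * L2_sq \<Omega> (\<lambda>x. ?D x - gradient \<eta> x) + 2 * L2_sq \<Omega> (gradient \<eta>)"
    by (rule integral_square_triangle[OF U(3) t(2)])
  moreover have "L2_sq \<Omega> (\<lambda>x. sym_part (gradient \<eta> x)) \<le>
      2 * L2_sq \<Omega> (\<lambda>x. sym_part (gradient \<eta> x) - sym_part (?D x)) + 2 * L2_sq \<Omega> (\<lambda>x. sym_part (?D x))"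
    by (intro integral_square_triangle square_integrable_sym_part t U)
  moreover have "L2_sq \<Omega> (\<lambda>x. sym_part (gradient \<eta> x) - sym_part (?D x)) \<le> L2_sq \<Omega> (\<lambda>x. ?D x - gradient \<eta> x)"
  proof -
    have "square_integrable (lebesgue_on \<Omega>) (\<lambda>x. ?D x - gradient \<eta> x)"
      using square_integrable_lincomb(1)[OF U(3) t(2), of 1 "-1"] by simp
    from square_integrable_sym_part(2)[OF this] show ?thesis
      by (simp add: sym_part_diff norm_minus_commute)
  qed
  ultimately show "L2_sq \<Omega> ?D \<le> 8 * L2_sq \<Omega> (\<lambda>x. sym_part (?D x)) + d" using \<eta>(2) unfolding e_def by linarith
qed

section \<open>Viscosity and the transformation \<open>psi\<close>\<close>

text \<open>The regularity and growth properties of the N-function on which everything rests; \<open>q\<close> bounds the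
  elasticity \<open>r \<phi>' / \<phi>\<close> from above.\<close>

locale density =
  fixes \<phi> :: "real \<Rightarrow> real" and q :: real
  assumes zero: "\<phi> 0 = 0" and pos: "\<And>r. r > 0 \<Longrightarrow> \<phi> r > 0"
    and cont: "continuous_on {0..} \<phi>"
    and superlinear: "filterlim (\<lambda>r. \<phi> r / r) at_top at_top"
    and deriv1: "\<And>r. r > 0 \<Longrightarrow> (\<phi> has_real_derivative deriv \<phi> r) (at r)"
    and deriv2: "\<And>r. r > 0 \<Longrightarrow> (deriv \<phi> has_real_derivative deriv (deriv \<phi>) r) (at r)"
    and deriv3: "\<And>r. r > 0 \<Longrightarrow> deriv (deriv \<phi>) differentiable (at r)"
    and index_lower: "\<And>r. r > 0 \<Longrightarrow> \<phi> r \<le> r * deriv \<phi> r"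
    and index_upper: "\<And>r. r > 0 \<Longrightarrow> r * deriv \<phi> r \<le> q * \<phi> r"
begin

lemma nonneg: "r \<ge> 0 \<Longrightarrow> \<phi> r \<ge> 0"
  using zero pos[of r] by (cases "r = 0") simp_all

lemma deriv_pos: "r > 0 \<Longrightarrow> deriv \<phi> r > 0"
proof -
  assume r: "r > 0"
  then have "0 < r * deriv \<phi> r" using pos index_lower less_le_trans by blast
  with r show ?thesis by (rule zero_less_mult_pos[rotated])
qed

lemma q_pos: "q > 0"
proof -
  have p: "\<phi> 1 > 0" and d: "deriv \<phi> 1 > 0" by (simp_all add: pos deriv_pos)
  have "1 * deriv \<phi> 1 \<le> q * \<phi> 1" by (rule index_upper) simp
  with d have "0 < q * \<phi> 1" by linarith
  with p show ?thesis by (simp add: zero_less_mult_iff)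
qed

lemma Phi_has_derivative_aux:
  assumes "r > 0" shows "(Phi \<phi> has_real_derivative deriv \<phi> (sqrt r) / (2 * sqrt r)) (at r)"
proof -
  have "((\<lambda>r. \<phi> (sqrt r)) has_real_derivative deriv \<phi> (sqrt r) * (inverse (sqrt r) / 2)) (at r)"
    by (rule DERIV_chain2[OF deriv1 DERIV_real_sqrt[OF assms]]) (use assms in simp)
  moreover have "deriv \<phi> (sqrt r) * (inverse (sqrt r) / 2) = deriv \<phi> (sqrt r) / (2 * sqrt r)"
    by (simp add: inverse_eq_divide)
  ultimately show ?thesis unfolding Phi_def[abs_def] by (simp only:)
qed

lemma mu_eq: "r > 0 \<Longrightarrow> mu \<phi> r = deriv \<phi> (sqrt r) / sqrt r"
proof -
  assume "r > 0"
  from DERIV_imp_deriv[OF Phi_has_derivative_aux[OF this]] show ?thesis unfolding mu_def by simp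
qed

lemma mu_pos: "r > 0 \<Longrightarrow> mu \<phi> r > 0"
proof -
  assume "r > 0"
  then show ?thesis unfolding mu_eq[OF \<open>r > 0\<close>] by (intro divide_pos_pos deriv_pos) auto
qed

lemma Phi_has_derivative: "r > 0 \<Longrightarrow> (Phi \<phi> has_real_derivative mu \<phi> r / 2) (at r)"
proof -
  assume "r > 0"
  have "mu \<phi> r / 2 = deriv \<phi> (sqrt r) / (2 * sqrt r)" unfolding mu_eq[OF \<open>r > 0\<close>] by simp
  then show ?thesis using Phi_has_derivative_aux[OF \<open>r > 0\<close>] by (simp only:)
qed

text \<open>The explicit formula for \<open>\<mu>'\<close> in terms of \<open>\<phi>'\<close> and \<open>\<phi>''\<close> at \<open>sqrt r\<close>; it is differentiable because
  \<open>\<phi>\<close> has a third derivative.\<close>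

definition dmu :: "real \<Rightarrow> real" where
  "dmu r = (deriv (deriv \<phi>) (sqrt r) - deriv \<phi> (sqrt r) / sqrt r) / (2 * r)"

lemma mu_has_derivative_aux:
  assumes "r > 0" shows "(mu \<phi> has_real_derivative dmu r) (at r)"
proof -
  have d: "((\<lambda>r. deriv \<phi> (sqrt r)) has_real_derivative deriv (deriv \<phi>) (sqrt r) * (inverse (sqrt r) / 2)) (at r)"
    by (rule DERIV_chain2[OF deriv2 DERIV_real_sqrt[OF assms]]) (use assms in simp)
  have "((\<lambda>r. deriv \<phi> (sqrt r) / sqrt r) has_real_derivative
     (deriv (deriv \<phi>) (sqrt r) * (inverse (sqrt r) / 2) * sqrt r - deriv \<phi> (sqrt r) * (inverse (sqrt r) / 2)) / (sqrt r * sqrt r)) (at r)"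
    by (rule DERIV_divide[OF d DERIV_real_sqrt[OF assms]]) (use assms in simp)
  moreover have "(deriv (deriv \<phi>) (sqrt r) * (inverse (sqrt r) / 2) * sqrt r - deriv \<phi> (sqrt r) * (inverse (sqrt r) / 2)) / (sqrt r * sqrt r) = dmu r"
    using assms by (simp add: dmu_def field_simps)
  ultimately have "((\<lambda>r. deriv \<phi> (sqrt r) / sqrt r) has_real_derivative dmu r) (at r)" by simp
  then show ?thesis
    by (rule has_field_derivative_transform_within_open[OF _ open_greaterThan[of 0]])
       (use assms mu_eq in simp_all)
qed

lemma deriv_mu: "r > 0 \<Longrightarrow> deriv (mu \<phi>) r = dmu r"
  by (rule DERIV_imp_deriv[OF mu_has_derivative_aux])

lemma mu_has_derivative: "r > 0 \<Longrightarrow> (mu \<phi> has_real_derivative deriv (mu \<phi>) r) (at r)"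
proof -
  assume "r > 0"
  from mu_has_derivative_aux[OF this] show ?thesis unfolding deriv_mu[OF \<open>r > 0\<close>] .
qed

lemma deriv_mu_has_derivative:
  assumes "r > 0"
  shows "(deriv (mu \<phi>) has_real_derivative deriv (deriv (mu \<phi>)) r) (at r)"
proof -
  obtain D where D: "(deriv (deriv \<phi>) has_real_derivative D) (at (sqrt r))"
    using deriv3[of "sqrt r"] assms by (auto simp: real_differentiable_def)
  have s: "(sqrt has_real_derivative inverse (sqrt r) / 2) (at r)"
    using assms by (rule DERIV_real_sqrt)
  have d1: "((\<lambda>r. deriv \<phi> (sqrt r)) has_real_derivative deriv (deriv \<phi>) (sqrt r) * (inverse (sqrt r) / 2)) (at r)"
    by (rule DERIV_chain2[OF deriv2 s]) (use assms in simp)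
  have d2: "((\<lambda>r. deriv (deriv \<phi>) (sqrt r)) has_real_derivative D * (inverse (sqrt r) / 2)) (at r)"
    by (rule DERIV_chain2[OF D s])
  have "\<exists>E. (dmu has_real_derivative E) (at r)"
    unfolding dmu_def[abs_def]
    by (rule exI, rule DERIV_divide[OF DERIV_diff[OF d2 DERIV_divide[OF d1 s]] DERIV_cmult[OF DERIV_ident]])
       (use assms in auto)
  then obtain E where "(dmu has_real_derivative E) (at r)" ..
  then have "(deriv (mu \<phi>) has_real_derivative E) (at r)"
    by (rule has_field_derivative_transform_within_open[OF _ open_greaterThan[of 0]])
       (use assms deriv_mu in simp_all)
  then show ?thesis using DERIV_imp_deriv by blast
qed

text \<open>Whether \<open>\<mu>\<close> increases or decreases at \<open>t\<^sup>2\<close> depends on whether \<open>t \<phi>''(t) / \<phi>'(t)\<close> exceeds \<open>1\<close>.\<close>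

lemma deriv_mu_index:
  assumes "r > 0"
  shows "deriv (mu \<phi>) r = mu \<phi> r / (2 * r) * (sqrt r * deriv (deriv \<phi>) (sqrt r) / deriv \<phi> (sqrt r) - 1)"
proof -
  define t where "t = sqrt r"
  have t: "t > 0" "r = t * t" using assms by (auto simp: t_def)
  have "deriv \<phi> t > 0" using t by (intro deriv_pos)
  then show ?thesis
    unfolding deriv_mu[OF assms] dmu_def mu_eq[OF assms] t_def[symmetric]
    using t by (simp add: field_simps)
qed

end

text \<open>The sign \<open>\<kappa>\<close> is \<open>omega \<phi>\<close>, and \<open>\<alpha>\<close> and \<open>\<beta>\<close> bound the distance of \<open>r \<phi>'' / \<phi>'\<close> from the critical
  value \<open>1\<close> on the correct side. In this form the convex and the concave case are treated together.\<close>

locale profile = density +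
  fixes \<kappa> \<alpha> \<beta> :: real
  assumes sign: "omega \<phi> = \<kappa>" "\<kappa> = 1 \<or> \<kappa> = - 1"
    and \<alpha>_pos: "\<alpha> > 0"
    and second_index: "\<And>r. r > 0 \<Longrightarrow> \<alpha> \<le> \<kappa> * (r * deriv (deriv \<phi>) r / deriv \<phi> r - 1)"
      "\<And>r. r > 0 \<Longrightarrow> \<kappa> * (r * deriv (deriv \<phi>) r / deriv \<phi> r - 1) \<le> \<beta>"
begin

lemma \<beta>_pos: "\<beta> > 0"
  using \<alpha>_pos second_index[of 1] by linarith

text \<open>The derivative of \<open>psi \<phi>\<close> on the positive axis.\<close>

definition speed :: "real \<Rightarrow> real" where
  "speed r = sqrt (\<kappa> / 2 * deriv (mu \<phi>) r)"

lemma deriv_mu_signed: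
  assumes "r > 0"
  shows "\<kappa> / 2 * deriv (mu \<phi>) r =
    mu \<phi> r / (4 * r) * (\<kappa> * (sqrt r * deriv (deriv \<phi>) (sqrt r) / deriv \<phi> (sqrt r) - 1))"
  unfolding deriv_mu_index[OF assms] by simp

lemma speed_bounds_sq:
  assumes "r > 0"
  shows "\<alpha> * mu \<phi> r / (4 * r) \<le> \<kappa> / 2 * deriv (mu \<phi>) r" "\<kappa> / 2 * deriv (mu \<phi>) r \<le> \<beta> * mu \<phi> r / (4 * r)"
proof -
  have s: "sqrt r > 0" using assms by simp
  have c: "0 \<le> mu \<phi> r / (4 * r)" using mu_pos[OF assms] assms by simp
  show "\<alpha> * mu \<phi> r / (4 * r) \<le> \<kappa> / 2 * deriv (mu \<phi>) r"
    unfolding deriv_mu_signed[OF assms]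
    using mult_left_mono[OF second_index(1)[OF s] c] by (simp add: mult.commute)
  show "\<kappa> / 2 * deriv (mu \<phi>) r \<le> \<beta> * mu \<phi> r / (4 * r)"
    unfolding deriv_mu_signed[OF assms]
    using mult_left_mono[OF second_index(2)[OF s] c] by (simp add: mult.commute)
qed

lemma speed_sq_pos: "r > 0 \<Longrightarrow> \<kappa> / 2 * deriv (mu \<phi>) r > 0"
  by (rule less_le_trans[OF _ speed_bounds_sq(1)]) (simp_all add: \<alpha>_pos mu_pos)

lemma speed_pos: "r > 0 \<Longrightarrow> speed r > 0"
  unfolding speed_def by (intro real_sqrt_gt_zero speed_sq_pos)

lemma speed_sq: "r > 0 \<Longrightarrow> (speed r)\<^sup>2 = \<kappa> / 2 * deriv (mu \<phi>) r"
  unfolding speed_def by (intro real_sqrt_pow2 less_imp_le speed_sq_pos)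

lemma deriv_mu_speed: "r > 0 \<Longrightarrow> deriv (mu \<phi>) r = 2 * \<kappa> * (speed r)\<^sup>2"
proof -
  assume "r > 0"
  have "\<kappa> * \<kappa> = 1" using sign(2) by auto
  moreover have "2 * \<kappa> * (speed r)\<^sup>2 = \<kappa> * \<kappa> * deriv (mu \<phi>) r"
    unfolding speed_sq[OF \<open>r > 0\<close>] by simp
  ultimately show ?thesis by simp
qed

text \<open>The logarithmic derivative of \<open>speed\<close> is \<open>\<mu>'' / (2 \<mu>')\<close>, the quantity that occurs in the
  convexity constant.\<close>

lemma speed_has_derivative:
  assumes "r > 0"
  shows "(speed has_real_derivative speed r * (deriv (deriv (mu \<phi>)) r / (2 * deriv (mu \<phi>) r))) (at r)"
proof -
  have d: "((\<lambda>r. \<kappa> / 2 * deriv (mu \<phi>) r) has_real_derivative \<kappa> / 2 * deriv (deriv (mu \<phi>)) r) (at r)"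
    by (rule DERIV_cmult[OF deriv_mu_has_derivative[OF assms]])
  have "(speed has_real_derivative inverse (speed r) / 2 * (\<kappa> / 2 * deriv (deriv (mu \<phi>)) r)) (at r)"
    unfolding speed_def[abs_def]
    by (rule DERIV_chain2[OF DERIV_real_sqrt[OF speed_sq_pos[OF assms]] d])
  moreover have "inverse (speed r) / 2 * (\<kappa> / 2 * deriv (deriv (mu \<phi>)) r) =
     speed r * (deriv (deriv (mu \<phi>)) r / (2 * deriv (mu \<phi>) r))"
  proof -
    define p where "p = speed r"
    have "p > 0" unfolding p_def by (rule speed_pos[OF assms])
    then show ?thesis
      unfolding deriv_mu_speed[OF assms] p_def[symmetric] using sign(2)
      by (elim disjE) (simp_all add: field_simps power2_eq_square)
  qed
  ultimately show ?thesis by simp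
qed

lemma speed_continuous: "continuous_on {0<..} speed"
proof (intro continuous_at_imp_continuous_on ballI)
  fix r :: real assume "r \<in> {0<..}"
  then have "r > 0" by simp
  from DERIV_isCont[OF speed_has_derivative[OF this]] show "isCont speed r" .
qed

definition sqrt_Phi :: "real \<Rightarrow> real" where "sqrt_Phi r = sqrt (Phi \<phi> r)"

lemma Phi_pos: "r > 0 \<Longrightarrow> Phi \<phi> r > 0" by (simp add: Phi_def pos)

lemma sqrt_Phi_has_derivative:
  assumes "r > 0" shows "(sqrt_Phi has_real_derivative mu \<phi> r / (4 * sqrt_Phi r)) (at r)"
proof -
  have "(sqrt_Phi has_real_derivative inverse (sqrt_Phi r) / 2 * (mu \<phi> r / 2)) (at r)"
    unfolding sqrt_Phi_def[abs_def]
    by (rule DERIV_chain2[OF DERIV_real_sqrt[OF Phi_pos[OF assms]] Phi_has_derivative[OF assms]])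
  moreover have "inverse (sqrt_Phi r) / 2 * (mu \<phi> r / 2) = mu \<phi> r / (4 * sqrt_Phi r)"
    by (simp add: inverse_eq_divide)
  ultimately show ?thesis by (simp only:)
qed

text \<open>Up to constants, \<open>speed\<close> is the derivative of \<open>sqrt \<Phi>\<close>: both squares are of the order of \<open>\<mu> / r\<close>,
  the first by \<open>second_index\<close> and the second because \<open>\<Phi>\<close> is of the order of \<open>r \<mu>\<close>.\<close>

lemma speed_bounds:
  assumes "r > 0"
  shows "sqrt (4 * \<alpha> / q) * (mu \<phi> r / (4 * sqrt_Phi r)) \<le> speed r"
    "speed r \<le> sqrt (4 * \<beta>) * (mu \<phi> r / (4 * sqrt_Phi r))"
proof -
  define m where "m = mu \<phi> r"
  define P where "P = Phi \<phi> r"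
  have m: "m > 0" and P: "P > 0" unfolding m_def P_def using mu_pos Phi_pos assms by auto
  have s: "sqrt r > 0" using assms by simp
  have "P \<le> r * m" "r * m \<le> q * P"
    using index_lower[OF s] index_upper[OF s] assms
    unfolding P_def m_def Phi_def mu_eq[OF assms] by (simp_all add: real_div_sqrt flip: times_divide_eq_left)
  then have b: "1 / r \<le> m / P" "m / (q * P) \<le> 1 / r"
    using assms P q_pos by (simp_all add: field_simps)
  have sq: "(m / (4 * sqrt_Phi r))\<^sup>2 = m / 16 * (m / P)"
    using P unfolding sqrt_Phi_def P_def[symmetric] by (simp add: power_divide power2_eq_square)
  have r: "sqrt_Phi r > 0" using P unfolding sqrt_Phi_def P_def by simp
  have "(4 * \<alpha> / q) * (m / (4 * sqrt_Phi r))\<^sup>2 = \<alpha> * m / 4 * (m / (q * P))"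
    unfolding sq by (simp add: field_simps)
  also have "\<dots> \<le> \<alpha> * m / 4 * (1 / r)" using b(2) \<alpha>_pos m by (intro mult_left_mono) auto
  also have "\<dots> \<le> \<kappa> / 2 * deriv (mu \<phi>) r" using speed_bounds_sq(1)[OF assms] unfolding m_def by simp
  finally have "sqrt ((4 * \<alpha> / q) * (m / (4 * sqrt_Phi r))\<^sup>2) \<le> speed r"
    unfolding speed_def by (rule real_sqrt_le_mono)
  then show "sqrt (4 * \<alpha> / q) * (mu \<phi> r / (4 * sqrt_Phi r)) \<le> speed r"
    using m r unfolding real_sqrt_mult m_def[symmetric] by simp
  have "\<kappa> / 2 * deriv (mu \<phi>) r \<le> \<beta> * m / 4 * (1 / r)" using speed_bounds_sq(2)[OF assms] unfolding m_def by simp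
  also have "\<dots> \<le> \<beta> * m / 4 * (m / P)" using b(1) \<beta>_pos m by (intro mult_left_mono) auto
  also have "\<dots> = 4 * \<beta> * (m / (4 * sqrt_Phi r))\<^sup>2" unfolding sq by simp
  finally have "speed r \<le> sqrt (4 * \<beta> * (m / (4 * sqrt_Phi r))\<^sup>2)"
    unfolding speed_def by (rule real_sqrt_le_mono)
  then show "speed r \<le> sqrt (4 * \<beta>) * (mu \<phi> r / (4 * sqrt_Phi r))"
    using m r unfolding real_sqrt_mult m_def[symmetric] by simp
qed

lemma sqrt_Phi_integral:
  assumes "R \<ge> 0"
  shows "((\<lambda>r. mu \<phi> r / (4 * sqrt_Phi r)) has_integral sqrt_Phi R) {0..R}"
proof -
  have "((\<lambda>r. mu \<phi> r / (4 * sqrt_Phi r)) has_integral (sqrt_Phi R - sqrt_Phi 0)) {0..R}"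
  proof (rule fundamental_theorem_of_calculus_interior[OF assms])
    show "continuous_on {0..R} sqrt_Phi"
      unfolding sqrt_Phi_def[abs_def] Phi_def
      by (intro continuous_on_real_sqrt continuous_on_compose2[OF cont] continuous_intros) auto
    show "(sqrt_Phi has_vector_derivative mu \<phi> r / (4 * sqrt_Phi r)) (at r)" if "r \<in> {0<..<R}" for r
      using sqrt_Phi_has_derivative[of r] that by (simp add: has_real_derivative_iff_has_vector_derivative)
  qed
  then show ?thesis by (simp add: sqrt_Phi_def Phi_def zero)
qed

text \<open>Near \<open>0\<close> the integrand may be unbounded; it is dominated by a multiple of the derivative of
  \<open>sqrt_Phi\<close>, which is integrable since \<open>sqrt_Phi\<close> is continuous at \<open>0\<close>.\<close>

lemma speed_integrable:
  assumes "0 \<le> a" shows "speed integrable_on {a..b}"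
proof (cases "0 \<le> b")
  case True
  have "speed integrable_on {0<..b}"
  proof (rule measurable_bounded_by_integrable_imp_integrable_real)
    show "speed \<in> borel_measurable (lebesgue_on {0<..b})"
      by (intro continuous_imp_measurable_on_sets_lebesgue continuous_on_subset[OF speed_continuous]) auto
    have "(\<lambda>r. sqrt (4 * \<beta>) * (mu \<phi> r / (4 * sqrt_Phi r))) integrable_on {0..b}"
      by (rule has_integral_integrable[OF has_integral_mult_right[OF sqrt_Phi_integral[OF True]]])
    then show "(\<lambda>r. sqrt (4 * \<beta>) * (mu \<phi> r / (4 * sqrt_Phi r))) integrable_on {0<..b}"
      by (rule integrable_spike_set_eq[THEN iffD1, rotated])
        (auto intro: negligible_subset[of "{0}"])
    show "\<bar>speed r\<bar> \<le> sqrt (4 * \<beta>) * (mu \<phi> r / (4 * sqrt_Phi r))" if "r \<in> {0<..b}" for r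
      using speed_bounds(2)[of r] speed_pos[of r] that by simp
  qed auto
  then have "speed integrable_on {0..b}"
    by (rule integrable_spike_set_eq[THEN iffD1, rotated])
      (auto intro: negligible_subset[of "{0}"])
  then show ?thesis by (rule integrable_on_subinterval) (use assms in auto)
next
  case False
  then have "{a..b} = {}" using assms by simp
  then show ?thesis by (simp add: integrable_on_empty)
qed

lemma psi_nonneg_eq: "r \<ge> 0 \<Longrightarrow> psi \<phi> r = integral {0..r} speed"
  by (cases "r = 0") (auto simp: psi_def sign(1) speed_def[abs_def])

lemma psi_odd: "psi \<phi> (- r) = - psi \<phi> r"
  by (simp add: psi_def sgn_minus)

lemma psi_bounds:
  assumes "r \<ge> 0"
  shows "sqrt (4 * \<alpha> / q) * sqrt_Phi r \<le> psi \<phi> r" "psi \<phi> r \<le> sqrt (4 * \<beta>) * sqrt_Phi r"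
proof -
  have i: "(speed has_integral psi \<phi> r) {0..r}"
    unfolding psi_nonneg_eq[OF assms] by (rule integrable_integral[OF speed_integrable]) simp
  then have i': "(speed has_integral psi \<phi> r) {0<..r}"
    by (rule has_integral_spike_set_eq[THEN iffD1, rotated 2]) (auto intro: negligible_subset[of "{0}"])
  have b: "((\<lambda>x. k * (mu \<phi> x / (4 * sqrt_Phi x))) has_integral k * sqrt_Phi r) {0<..r}" for k
    using has_integral_mult_right[OF sqrt_Phi_integral[OF assms], of k]
    by (rule has_integral_spike_set_eq[THEN iffD1, rotated 2]) (auto intro: negligible_subset[of "{0}"])
  show "sqrt (4 * \<alpha> / q) * sqrt_Phi r \<le> psi \<phi> r"
    by (rule has_integral_le[OF b i']) (use speed_bounds(1) in auto)
  show "psi \<phi> r \<le> sqrt (4 * \<beta>) * sqrt_Phi r"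
    by (rule has_integral_le[OF i' b]) (use speed_bounds(2) in auto)
qed

text \<open>The fundamental theorem of calculus is applied on \<open>[r/2, r+1]\<close>, away from the singularity at \<open>0\<close>.\<close>

lemma psi_has_derivative:
  assumes "r > 0" shows "(psi \<phi> has_real_derivative speed r) (at r)"
proof -
  have c: "continuous_on {r/2..r+1} speed" by (rule continuous_on_subset[OF speed_continuous]) (use assms in auto)
  have "((\<lambda>x. integral {r/2..x} speed) has_real_derivative speed r) (at r within {r/2..r+1})"
    by (rule integral_has_real_derivative[OF c]) (use assms in auto)
  moreover have "at r within {r/2..r+1} = at r" by (rule at_within_interior) (use assms in auto)
  ultimately have "((\<lambda>x. integral {0..r/2} speed + integral {r/2..x} speed) has_real_derivative speed r) (at r)"
    using DERIV_add[OF DERIV_const] by fastforce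
  then show ?thesis
  proof (rule has_field_derivative_transform_within_open[OF _ open_greaterThan[of "r/2"]])
    fix x assume x: "x \<in> {r/2<..}"
    have "integral {0..r/2} speed + integral {r/2..x} speed = integral {0..x} speed"
      by (rule Henstock_Kurzweil_Integration.integral_combine) (use assms x in \<open>auto intro!: speed_integrable\<close>)
    then show "integral {0..r/2} speed + integral {r/2..x} speed = psi \<phi> x"
      using x assms by (subst psi_nonneg_eq) auto
  qed (use assms in auto)
qed

lemma psi_0: "psi \<phi> 0 = 0" by (simp add: psi_def)

lemma sqrt_Phi_pos: "r > 0 \<Longrightarrow> sqrt_Phi r > 0" by (simp add: sqrt_Phi_def Phi_pos)

lemma psi_pos: "r > 0 \<Longrightarrow> psi \<phi> r > 0"
  using psi_bounds(1)[of r] sqrt_Phi_pos[of r] \<alpha>_pos q_pos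
  by (metis divide_pos_pos less_eq_real_def less_le_trans mult_pos_pos real_sqrt_gt_zero zero_less_numeral)

lemma psi_strict_mono: "strict_mono (psi \<phi>)"
proof -
  have pp: "psi \<phi> a < psi \<phi> b" if "0 \<le> a" "a < b" for a b
  proof (cases "a = 0")
    case True
    then show ?thesis using psi_pos that by (simp add: psi_0)
  next
    case False
    then show ?thesis using that
      by (intro DERIV_pos_imp_increasing[OF \<open>a < b\<close>])
         (metis less_le_trans order_less_le psi_has_derivative speed_pos)
  qed
  show ?thesis
  proof (rule strict_monoI)
    fix a b :: real assume "a < b"
    consider "0 \<le> a" | "b \<le> 0" | "a < 0" "0 < b" by linarith
    then show "psi \<phi> a < psi \<phi> b"
    proof cases
      case 1 then show ?thesis using pp \<open>a < b\<close> by blast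
    next
      case 2
      then show ?thesis using pp[of "- b" "- a"] \<open>a < b\<close> by (simp add: psi_odd)
    next
      case 3
      then show ?thesis using psi_pos[of b] psi_pos[of "- a"] by (simp add: psi_odd)
    qed
  qed
qed

lemma psi_le_iff: "psi \<phi> a \<le> psi \<phi> b \<longleftrightarrow> a \<le> b"
  by (rule strict_mono_less_eq[OF psi_strict_mono])

text \<open>Away from \<open>0\<close> this is differentiability and oddness; at \<open>0\<close> it follows from the upper bound by a
  multiple of \<open>sqrt_Phi\<close>.\<close>

lemma psi_continuous: "continuous_on UNIV (psi \<phi>)"
proof -
  have 1: "isCont (psi \<phi>) r" if "r > 0" for r
    using psi_has_derivative[OF that] by (rule DERIV_isCont)
  have 2: "isCont (psi \<phi>) r" if "r < 0" for r
  proof -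
    have "isCont (\<lambda>x. - psi \<phi> (- x)) r"
      using that by (intro isCont_minus isCont_o2[OF _ 1]) auto
    then show ?thesis by (simp add: psi_odd)
  qed
  have 3: "isCont (psi \<phi>) 0"
  proof -
    have "continuous_on UNIV (\<lambda>r. sqrt (4 * \<beta>) * sqrt (\<phi> (sqrt \<bar>r\<bar>)))"
      by (intro continuous_intros continuous_on_compose2[OF cont]) auto
    then have "isCont (\<lambda>r. sqrt (4 * \<beta>) * sqrt (\<phi> (sqrt \<bar>r\<bar>))) 0"
      by (simp add: continuous_on_eq_continuous_at)
    then have lim: "(\<lambda>r. sqrt (4 * \<beta>) * sqrt (\<phi> (sqrt \<bar>r\<bar>))) \<midarrow>0\<rightarrow> 0"
      by (simp add: isCont_def zero)
    have "norm (psi \<phi> r) \<le> sqrt (4 * \<beta>) * sqrt (\<phi> (sqrt \<bar>r\<bar>))" for r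
    proof -
      have "\<bar>psi \<phi> r\<bar> = psi \<phi> \<bar>r\<bar>"
        using psi_pos[of r] psi_pos[of "- r"] by (cases r "0::real" rule: linorder_cases) (auto simp: psi_odd psi_0)
      then show ?thesis using psi_bounds(2)[of "\<bar>r\<bar>"] by (simp add: sqrt_Phi_def Phi_def)
    qed
    then have "psi \<phi> \<midarrow>0\<rightarrow> 0"
      by (intro Lim_null_comparison[OF _ lim]) simp
    then show ?thesis by (simp add: isCont_def psi_0)
  qed
  show ?thesis
    unfolding continuous_on_eq_continuous_at[OF open_UNIV]
    using 1 2 3 by (metis linorder_neqE_linordered_idom)
qed

text \<open>By the lower bound in terms of \<open>sqrt_Phi\<close> and the superlinear growth of \<open>\<phi>\<close>.\<close>

lemma psi_unbounded: "\<exists>r\<ge>0. psi \<phi> r \<ge> y"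
proof -
  define k where "k = sqrt (4 * \<alpha> / q)"
  have k: "k > 0" using \<alpha>_pos q_pos by (simp add: k_def)
  have "eventually (\<lambda>t. \<phi> t / t \<ge> (y / k)\<^sup>2) at_top"
    using superlinear by (simp add: filterlim_at_top)
  moreover have "eventually (\<lambda>t::real. t \<ge> 1) at_top" by (rule eventually_ge_at_top)
  ultimately have "eventually (\<lambda>t. \<phi> t / t \<ge> (y / k)\<^sup>2 \<and> t \<ge> 1) at_top" by eventually_elim simp
  then obtain t where t: "\<phi> t / t \<ge> (y / k)\<^sup>2" "t \<ge> 1" by (auto simp: eventually_at_top_linorder)
  have "\<phi> t / t \<le> \<phi> t" using t(2) nonneg[of t] divide_left_mono[of 1 t "\<phi> t"] by simp
  then have "(y / k)\<^sup>2 \<le> \<phi> t" using t(1) by linarith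
  then have "\<bar>y / k\<bar> \<le> sqrt (\<phi> t)" by (metis real_sqrt_abs real_sqrt_le_mono)
  then have "y / k \<le> sqrt (\<phi> t)" by linarith
  then have "y \<le> k * sqrt (\<phi> t)" using k by (simp add: field_simps)
  also have "\<dots> = k * sqrt_Phi (t\<^sup>2)" using t(2) by (simp add: sqrt_Phi_def Phi_def)
  also have "\<dots> \<le> psi \<phi> (t\<^sup>2)" unfolding k_def by (rule psi_bounds) simp
  finally show ?thesis by (intro exI[of _ "t\<^sup>2"]) simp
qed

lemma psi_surj: "\<exists>x. psi \<phi> x = y"
proof -
  obtain r where r: "r \<ge> 0" "psi \<phi> r \<ge> \<bar>y\<bar>" using psi_unbounded by blast
  then have "psi \<phi> (- r) \<le> y" "y \<le> psi \<phi> r" by (auto simp: psi_odd)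
  then show ?thesis
    using IVT'[of "psi \<phi>" "- r" y r] continuous_on_subset[OF psi_continuous] r(1) by fastforce
qed

definition psi_inv :: "real \<Rightarrow> real" where "psi_inv = inv (psi \<phi>)"

lemma psi_psi_inv [simp]: "psi \<phi> (psi_inv y) = y"
  unfolding psi_inv_def by (rule f_inv_into_f) (use psi_surj in \<open>metis rangeI\<close>)

lemma psi_inv_psi [simp]: "psi_inv (psi \<phi> x) = x"
  unfolding psi_inv_def by (rule inv_f_f) (rule strict_mono_imp_inj_on[OF psi_strict_mono])

lemma psi_inv_measurable: "psi_inv \<in> borel_measurable borel"
proof (rule borel_measurable_mono, rule monoI)
  fix x y :: real assume "x \<le> y"
  then show "psi_inv x \<le> psi_inv y"
    using psi_le_iff[of "psi_inv x" "psi_inv y"] by simp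
qed

lemma psi_measurable: "psi \<phi> \<in> borel_measurable borel"
  by (rule borel_measurable_continuous_onI[OF psi_continuous])

end

context profile
begin

section \<open>The metric space in terms of \<open>psi\<close>\<close>

text \<open>The upper index makes \<open>\<phi>(s) s powr (- q)\<close> nonincreasing; this is the doubling condition.\<close>

lemma growth:
  assumes "k \<ge> 1" "t \<ge> 0" shows "\<phi> (k * t) \<le> k powr q * \<phi> t"
proof (cases "t = 0")
  case True
  then show ?thesis by (simp add: zero)
next
  case False
  with assms have t: "t > 0" and kt: "t \<le> k * t" by simp_all
  have d: "((\<lambda>s. \<phi> s * s powr (- q)) has_real_derivative
      (s * deriv \<phi> s - q * \<phi> s) * s powr (- q - 1)) (at s)" if "s > 0" for s
  proof -
    have "((\<lambda>s. \<phi> s * s powr (- q)) has_real_derivative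
        deriv \<phi> s * s powr (- q) + (- q * s powr (- q - 1)) * \<phi> s) (at s)"
      by (rule DERIV_mult[OF deriv1[OF that] has_real_derivative_powr[OF that]])
    moreover have e: "s powr (- q) = s * s powr (- q - 1)"
      using that by (simp add: powr_diff)
    have "deriv \<phi> s * s powr (- q) + (- q * s powr (- q - 1)) * \<phi> s =
        (s * deriv \<phi> s - q * \<phi> s) * s powr (- q - 1)"
      unfolding e by (simp add: algebra_simps)
    ultimately show ?thesis by (simp only:)
  qed
  have "\<phi> (k * t) * (k * t) powr (- q) \<le> \<phi> t * t powr (- q)"
  proof (rule DERIV_nonpos_imp_nonincreasing[OF kt])
    fix s assume "t \<le> s" "s \<le> k * t"
    then have s: "s > 0" using t by linarith
    have "(s * deriv \<phi> s - q * \<phi> s) * s powr (- q - 1) \<le> 0"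
      using index_upper[OF s] by (intro mult_nonpos_nonneg) auto
    with d[OF s] show "\<exists>y. ((\<lambda>s. \<phi> s * s powr (- q)) has_real_derivative y) (at s) \<and> y \<le> 0" by blast
  qed
  also have "(k * t) powr (- q) = k powr (- q) * t powr (- q)"
    using assms t by (simp add: powr_mult)
  finally have "\<phi> (k * t) * k powr (- q) \<le> \<phi> t"
    using t by (simp add: mult.assoc[symmetric])
  then have "\<phi> (k * t) * (k powr (- q) * k powr q) \<le> \<phi> t * k powr q"
    unfolding mult.assoc[symmetric] by (rule mult_right_mono) simp
  moreover have "k powr (- q) * k powr q = 1"
    using assms(1) by (simp add: powr_add[symmetric])
  ultimately show ?thesis by (simp only: mult_1_right mult.commute)
qed

lemma mono:
  assumes "0 \<le> s" "s \<le> t" shows "\<phi> s \<le> \<phi> t"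
proof (rule DERIV_nonneg_imp_increasing_open[OF assms(2)])
  fix x assume "s < x" "x < t"
  then have "x > 0" using assms by linarith
  then show "\<exists>y. (\<phi> has_real_derivative y) (at x) \<and> 0 \<le> y"
    using deriv1 deriv_pos less_imp_le by blast
next
  show "continuous_on {s..t} \<phi>" by (rule continuous_on_subset[OF cont]) (use assms in auto)
qed

lemma psi_sq_bounds:
  shows "(psi \<phi> r)\<^sup>2 \<le> 4 * \<beta> * \<phi> (sqrt \<bar>r\<bar>)" "\<phi> (sqrt \<bar>r\<bar>) \<le> q / (4 * \<alpha>) * (psi \<phi> r)\<^sup>2"
proof -
  have e: "(psi \<phi> r)\<^sup>2 = (psi \<phi> \<bar>r\<bar>)\<^sup>2"
    by (cases "r \<ge> 0") (simp_all add: psi_odd)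
  have rt: "(sqrt_Phi \<bar>r\<bar>)\<^sup>2 = \<phi> (sqrt \<bar>r\<bar>)" "sqrt_Phi \<bar>r\<bar> \<ge> 0"
    by (simp_all add: sqrt_Phi_def Phi_def nonneg)
  have b: "sqrt (4 * \<alpha> / q) * sqrt_Phi \<bar>r\<bar> \<le> psi \<phi> \<bar>r\<bar>" "psi \<phi> \<bar>r\<bar> \<le> sqrt (4 * \<beta>) * sqrt_Phi \<bar>r\<bar>"
    using psi_bounds[of "\<bar>r\<bar>"] by simp_all
  have c: "0 \<le> sqrt (4 * \<alpha> / q) * sqrt_Phi \<bar>r\<bar>" using rt(2) \<alpha>_pos q_pos by simp
  have "(psi \<phi> \<bar>r\<bar>)\<^sup>2 \<le> (sqrt (4 * \<beta>) * sqrt_Phi \<bar>r\<bar>)\<^sup>2"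
    by (rule power_mono[OF b(2)]) (use b c in linarith)
  also have "\<dots> = 4 * \<beta> * \<phi> (sqrt \<bar>r\<bar>)"
    unfolding power_mult_distrib rt using \<beta>_pos by simp
  finally show "(psi \<phi> r)\<^sup>2 \<le> 4 * \<beta> * \<phi> (sqrt \<bar>r\<bar>)" unfolding e .
  have "4 * \<alpha> / q * \<phi> (sqrt \<bar>r\<bar>) = (sqrt (4 * \<alpha> / q) * sqrt_Phi \<bar>r\<bar>)\<^sup>2"
    unfolding power_mult_distrib rt using \<alpha>_pos q_pos by simp
  also have "\<dots> \<le> (psi \<phi> r)\<^sup>2" unfolding e by (rule power_mono[OF b(1) c])
  finally have "q / (4 * \<alpha>) * (4 * \<alpha> / q * \<phi> (sqrt \<bar>r\<bar>)) \<le> q / (4 * \<alpha>) * (psi \<phi> r)\<^sup>2"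
    by (rule mult_left_mono) (use \<alpha>_pos q_pos in simp)
  moreover have "q / (4 * \<alpha>) * (4 * \<alpha> / q * \<phi> (sqrt \<bar>r\<bar>)) = \<phi> (sqrt \<bar>r\<bar>)"
    using \<alpha>_pos q_pos by simp
  ultimately show "\<phi> (sqrt \<bar>r\<bar>) \<le> q / (4 * \<alpha>) * (psi \<phi> r)\<^sup>2" by (simp only:)
qed

lemma phi_sqrt_measurable: "(\<lambda>r. \<phi> (sqrt \<bar>r\<bar>)) \<in> borel_measurable borel"
  by (intro borel_measurable_continuous_onI continuous_on_compose2[OF cont] continuous_intros) auto

text \<open>By \<open>psi_sq_bounds\<close>, \<open>(psi \<phi> c)\<^sup>2\<close> is comparable to \<open>\<phi>(sqrt \<bar>c\<bar>)\<close>, and by \<open>growth\<close> the scaling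
  parameter in the definition of the Orlicz space does not affect finiteness of the modular.\<close>

lemma LPhi_iff:
  "c \<in> LPhi \<phi> \<Omega> \<longleftrightarrow> c \<in> borel_measurable (lebesgue_on \<Omega>) \<and> integrable (lebesgue_on \<Omega>) (\<lambda>x. (psi \<phi> (c x))\<^sup>2)"
    (is "?l \<longleftrightarrow> ?m \<and> ?i")
proof
  assume l: ?l
  then have m: ?m by (simp add: LPhi_def)
  obtain k where k: "k > 0" "(\<integral>\<^sup>+x. ennreal (\<phi> (\<bar>sqrt \<bar>c x\<bar>\<bar> / k)) \<partial>lebesgue_on \<Omega>) < \<infinity>"
    using l by (auto simp: LPhi_def orlicz_space_def)
  \<comment> \<open>\<open>growth\<close> requires a factor of at least \<open>1\<close>; enlarging \<open>k\<close> is harmless since \<open>\<phi>\<close> is monotone.\<close>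
  define K where "K = max 1 k"
  define C where "C = 4 * \<beta> * K powr q"
  have K: "K \<ge> 1" "k \<le> K" by (auto simp: K_def)
  have C: "C \<ge> 0" using \<beta>_pos by (simp add: C_def)
  have b: "(psi \<phi> r)\<^sup>2 \<le> C * \<phi> (\<bar>sqrt \<bar>r\<bar>\<bar> / k)" for r
  proof -
    have "sqrt \<bar>r\<bar> = k * (\<bar>sqrt \<bar>r\<bar>\<bar> / k)" using k(1) by simp
    also have "\<dots> \<le> K * (\<bar>sqrt \<bar>r\<bar>\<bar> / k)" using K k(1) by (intro mult_right_mono) auto
    finally have "\<phi> (sqrt \<bar>r\<bar>) \<le> \<phi> (K * (\<bar>sqrt \<bar>r\<bar>\<bar> / k))" by (intro mono) auto
    also have "\<dots> \<le> K powr q * \<phi> (\<bar>sqrt \<bar>r\<bar>\<bar> / k)" using k(1) by (intro growth K) auto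
    finally have "4 * \<beta> * \<phi> (sqrt \<bar>r\<bar>) \<le> 4 * \<beta> * (K powr q * \<phi> (\<bar>sqrt \<bar>r\<bar>\<bar> / k))"
      using \<beta>_pos by (intro mult_left_mono) auto
    with psi_sq_bounds(1)[of r] show ?thesis unfolding C_def by (simp add: mult.assoc)
  qed
  have sm: "(\<lambda>x. (psi \<phi> (c x))\<^sup>2) \<in> borel_measurable (lebesgue_on \<Omega>)"
    using m psi_measurable by measurable
  have cm: "(\<lambda>x. ennreal (\<phi> (\<bar>sqrt \<bar>c x\<bar>\<bar> / k))) \<in> borel_measurable (lebesgue_on \<Omega>)"
  proof -
    have "(\<lambda>r. \<phi> (\<bar>sqrt \<bar>r\<bar>\<bar> / k)) \<in> borel_measurable borel"
      using k(1) by (intro borel_measurable_continuous_onI continuous_on_compose2[OF cont] continuous_intros) auto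
    from measurable_compose[OF measurable_compose[OF m this] measurable_ennreal] show ?thesis .
  qed
  have "(\<integral>\<^sup>+x. ennreal (norm ((psi \<phi> (c x))\<^sup>2)) \<partial>lebesgue_on \<Omega>) \<le>
      (\<integral>\<^sup>+x. ennreal C * ennreal (\<phi> (\<bar>sqrt \<bar>c x\<bar>\<bar> / k)) \<partial>lebesgue_on \<Omega>)"
    using b C by (intro nn_integral_mono) (simp add: ennreal_mult'[symmetric] ennreal_leI)
  also have "\<dots> = ennreal C * (\<integral>\<^sup>+x. ennreal (\<phi> (\<bar>sqrt \<bar>c x\<bar>\<bar> / k)) \<partial>lebesgue_on \<Omega>)"
    by (rule nn_integral_cmult[OF cm])
  also have "\<dots> < \<infinity>" using k(2) by (simp add: ennreal_mult_less_top)
  finally have ?i using sm by (intro integrableI_bounded)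
  with m show "?m \<and> ?i" by blast
next
  assume r: "?m \<and> ?i"
  then have m: ?m and i: ?i by blast+
  have sqm: "(\<lambda>x. sqrt \<bar>c x\<bar>) \<in> borel_measurable (lebesgue_on \<Omega>)" using m by measurable
  have i2: "integrable (lebesgue_on \<Omega>) (\<lambda>x. q / (4 * \<alpha>) * (psi \<phi> (c x))\<^sup>2)" using i by simp
  have "integrable (lebesgue_on \<Omega>) (\<lambda>x. \<phi> (sqrt \<bar>c x\<bar>))"
  proof (rule Bochner_Integration.integrable_bound[OF i2])
    show "(\<lambda>x. \<phi> (sqrt \<bar>c x\<bar>)) \<in> borel_measurable (lebesgue_on \<Omega>)"
      by (rule measurable_compose[OF m phi_sqrt_measurable])
    show "AE x in lebesgue_on \<Omega>. norm (\<phi> (sqrt \<bar>c x\<bar>)) \<le> norm (q / (4 * \<alpha>) * (psi \<phi> (c x))\<^sup>2)"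
    proof (rule AE_I2)
      fix x
      have "0 \<le> \<phi> (sqrt \<bar>c x\<bar>)" by (rule nonneg) simp
      then show "norm (\<phi> (sqrt \<bar>c x\<bar>)) \<le> norm (q / (4 * \<alpha>) * (psi \<phi> (c x))\<^sup>2)"
        using psi_sq_bounds(2)[of "c x"] unfolding real_norm_def by linarith
    qed
  qed
  then have "(\<integral>\<^sup>+x. ennreal (norm (\<phi> (sqrt \<bar>c x\<bar>))) \<partial>lebesgue_on \<Omega>) < \<infinity>"
    by (simp add: integrable_iff_bounded)
  moreover have "norm (\<phi> (sqrt \<bar>c x\<bar>)) = \<phi> (\<bar>sqrt \<bar>c x\<bar>\<bar> / 1)" for x
    by (simp add: nonneg)
  ultimately have "(\<integral>\<^sup>+x. ennreal (\<phi> (\<bar>sqrt \<bar>c x\<bar>\<bar> / 1)) \<partial>lebesgue_on \<Omega>) < \<infinity>" by (simp only:)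
  then have "\<exists>k>0. (\<integral>\<^sup>+x. ennreal (\<phi> (\<bar>sqrt \<bar>c x\<bar>\<bar> / k)) \<partial>lebesgue_on \<Omega>) < \<infinity>"
    by (intro exI[of _ 1]) simp
  with m sqm show ?l unfolding LPhi_def orlicz_space_def by blast
qed

section \<open>Convexity along \<open>psi\<close>-segments\<close>

text \<open>The condition says that \<open>dg / d(psi) = h\<close> is nondecreasing. Instead of inverting \<open>psi\<close>, one observes
  that \<open>g - h(c) psi\<close> decreases up to \<open>c\<close> and increases afterwards, so it is minimal at \<open>c\<close>; this is
  the supporting line of \<open>g\<close> as a function of \<open>psi\<close>.\<close>

lemma convex_along_psi:
  assumes g: "\<And>r. r > 0 \<Longrightarrow> (g has_real_derivative speed r * h r) (at r)"
    and h: "\<And>a b. 0 < a \<Longrightarrow> a \<le> b \<Longrightarrow> h a \<le> h b"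
    and pos: "0 < a" "0 < b" "0 < c" and s: "0 \<le> s" "s \<le> 1"
    and c: "psi \<phi> c = (1 - s) * psi \<phi> a + s * psi \<phi> b"
  shows "g c \<le> (1 - s) * g a + s * g b"
proof -
  define f where "f r = g r - h c * psi \<phi> r" for r
  have d: "(f has_real_derivative speed r * (h r - h c)) (at r)" if "r > 0" for r
  proof -
    have "(f has_real_derivative speed r * h r - h c * speed r) (at r)"
      unfolding f_def[abs_def] by (intro DERIV_diff g DERIV_cmult psi_has_derivative that)
    then show ?thesis by (simp add: right_diff_distrib mult.commute)
  qed
  have min: "f c \<le> f r" if r: "r > 0" for r
  proof (cases "c \<le> r")
    case True
    show ?thesis
    proof (rule DERIV_nonneg_imp_nondecreasing[OF True])
      fix x assume x: "c \<le> x" "x \<le> r"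
      then have "x > 0" using pos by linarith
      moreover have "0 \<le> speed x * (h x - h c)"
        using speed_pos[OF \<open>x > 0\<close>] h[OF pos(3) x(1)] by simp
      ultimately show "\<exists>y. (f has_real_derivative y) (at x) \<and> 0 \<le> y" using d by blast
    qed
  next
    case False
    then have "r \<le> c" by simp
    then show ?thesis
    proof (rule DERIV_nonpos_imp_nonincreasing)
      fix x assume x: "r \<le> x" "x \<le> c"
      then have "x > 0" using r by linarith
      moreover have "speed x * (h x - h c) \<le> 0"
        using speed_pos[OF \<open>x > 0\<close>] h[OF \<open>x > 0\<close> x(2)] by (intro mult_nonneg_nonpos) auto
      ultimately show "\<exists>y. (f has_real_derivative y) (at x) \<and> y \<le> 0" using d by blast
    qed
  qed
  have "(1 - s) * f c + s * f c \<le> (1 - s) * f a + s * f b"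
    using s min[OF pos(1)] min[OF pos(2)] by (intro add_mono mult_left_mono) auto
  then have "g c - h c * psi \<phi> c \<le> (1 - s) * g a + s * g b - h c * ((1 - s) * psi \<phi> a + s * psi \<phi> b)"
    unfolding f_def by (simp add: algebra_simps)
  then show ?thesis unfolding c by simp
qed

lemma convex_along_psi_deriv:
  assumes g: "\<And>r. r > 0 \<Longrightarrow> (g has_real_derivative speed r * h r) (at r)"
    and h: "\<And>r. r > 0 \<Longrightarrow> (h has_real_derivative h' r) (at r)" "\<And>r. r > 0 \<Longrightarrow> h' r \<ge> 0"
    and pos: "0 < a" "0 < b" "0 < c" and s: "0 \<le> s" "s \<le> 1"
    and c: "psi \<phi> c = (1 - s) * psi \<phi> a + s * psi \<phi> b"
  shows "g c \<le> (1 - s) * g a + s * g b"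
proof (rule convex_along_psi[OF g _ pos s c])
  fix a b :: real assume ab: "0 < a" "a \<le> b"
  show "h a \<le> h b"
  proof (rule DERIV_nonneg_imp_nondecreasing[OF ab(2)])
    fix x assume "a \<le> x" "x \<le> b"
    then have "x > 0" using ab by linarith
    then show "\<exists>y. (h has_real_derivative y) (at x) \<and> 0 \<le> y" using h by blast
  qed
qed

text \<open>The integrand of \<open>- \<omega> J_c\<close>.\<close>

definition energy_density :: "real \<Rightarrow> real" where
  "energy_density r = - \<kappa> * (Phi \<phi> r - 1/2 * mu \<phi> r * r)"

text \<open>Subtracting \<open>l/2 psi\<^sup>2\<close> turns \<open>l\<close>-convexity into convexity, and the defect of \<open>psi\<^sup>2\<close> on a segment is
  exactly \<open>s (1 - s) (psi b - psi a)\<^sup>2\<close>.\<close>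

lemma energy_density_convex:
  assumes l: "\<And>r. r > 0 \<Longrightarrow> l \<le> 1 + r * deriv (deriv (mu \<phi>)) r / (2 * deriv (mu \<phi>) r)"
    and pos: "0 < a" "0 < b" "0 < c" and s: "0 \<le> s" "s \<le> 1"
    and c: "psi \<phi> c = (1 - s) * psi \<phi> a + s * psi \<phi> b"
  shows "energy_density c \<le> (1 - s) * energy_density a + s * energy_density b
      - l / 2 * s * (1 - s) * (psi \<phi> b - psi \<phi> a)\<^sup>2"
proof -
  let ?g = "\<lambda>r. energy_density r - l / 2 * (psi \<phi> r)\<^sup>2"
  let ?h = "\<lambda>r. r * speed r - l * psi \<phi> r"
  have "?g c \<le> (1 - s) * ?g a + s * ?g b"
  proof (rule convex_along_psi_deriv[OF _ _ _ pos s c, where h = ?h])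
    fix r :: real assume r: "r > 0"
    have "(energy_density has_real_derivative - \<kappa> * (mu \<phi> r / 2 - (1/2 * deriv (mu \<phi>) r * r + 1 * (1/2 * mu \<phi> r)))) (at r)"
      unfolding energy_density_def[abs_def]
      by (intro DERIV_cmult DERIV_diff Phi_has_derivative DERIV_mult mu_has_derivative DERIV_ident r)
    moreover have "- \<kappa> * (mu \<phi> r / 2 - (1/2 * deriv (mu \<phi>) r * r + 1 * (1/2 * mu \<phi> r))) = \<kappa> / 2 * deriv (mu \<phi>) r * r"
      by (simp add: algebra_simps)
    ultimately have e: "(energy_density has_real_derivative (speed r)\<^sup>2 * r) (at r)"
      unfolding speed_sq[OF r] by (simp only:)
    have "((\<lambda>r. (psi \<phi> r)\<^sup>2) has_real_derivative 2 * psi \<phi> r * speed r) (at r)"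
      using DERIV_power[OF psi_has_derivative[OF r], of 2] by (simp add: mult_ac)
    from DERIV_diff[OF e DERIV_cmult[OF this, of "l / 2"]]
    show "(?g has_real_derivative speed r * ?h r) (at r)"
      by (rule DERIV_cong) (simp add: power2_eq_square algebra_simps)
    let ?k = "deriv (deriv (mu \<phi>)) r / (2 * deriv (mu \<phi>) r)"
    have "(?h has_real_derivative (1 * speed r + speed r * ?k * r) - l * speed r) (at r)"
      by (intro DERIV_diff DERIV_mult DERIV_ident speed_has_derivative DERIV_cmult psi_has_derivative r)
    then show "(?h has_real_derivative speed r * (1 + r * deriv (deriv (mu \<phi>)) r / (2 * deriv (mu \<phi>) r) - l)) (at r)"
      by (rule DERIV_cong) (simp add: algebra_simps)
    show "0 \<le> speed r * (1 + r * deriv (deriv (mu \<phi>)) r / (2 * deriv (mu \<phi>) r) - l)"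
      using l[OF r] speed_pos[OF r] by simp
  qed
  moreover define A B X Y Z where "A = psi \<phi> a" and "B = psi \<phi> b" and "X = A\<^sup>2" and "Y = B\<^sup>2"
    and "Z = s * (1 - s) * (B - A)\<^sup>2"
  define k where "k = l / 2"
  have "((1 - s) * A + s * B)\<^sup>2 = (1 - s) * X + s * Y - Z"
    unfolding X_def Y_def Z_def by (simp add: power2_eq_square algebra_simps)
  ultimately have "energy_density c - l / 2 * ((1 - s) * X + s * Y - Z) \<le>
      (1 - s) * (energy_density a - l / 2 * X) + s * (energy_density b - l / 2 * Y)"
    unfolding c X_def Y_def A_def B_def by (simp only:)
  then have "energy_density c \<le> (1 - s) * energy_density a + s * energy_density b - l / 2 * Z"
    unfolding k_def[symmetric] by (simp add: algebra_simps)
  then show ?thesis unfolding Z_def A_def B_def by (simp only: mult.assoc)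
qed

text \<open>In the convex case \<open>d\<mu> / d(psi) = 2 speed\<close>, which is nonincreasing when \<open>\<mu>'' \<le> 0\<close>.\<close>

lemma mu_concave_along_psi:
  assumes conv: "\<kappa> = 1" and m: "\<And>r. r > 0 \<Longrightarrow> deriv (deriv (mu \<phi>)) r \<le> 0"
    and pos: "0 < a" "0 < b" "0 < c" and s: "0 \<le> s" "s \<le> 1"
    and c: "psi \<phi> c = (1 - s) * psi \<phi> a + s * psi \<phi> b"
  shows "(1 - s) * mu \<phi> a + s * mu \<phi> b \<le> mu \<phi> c"
proof -
  have "- mu \<phi> c \<le> (1 - s) * (- mu \<phi> a) + s * (- mu \<phi> b)"
  proof (rule convex_along_psi_deriv[OF _ _ _ pos s c, where h = "\<lambda>r. - 2 * speed r"])
    fix r :: real assume r: "r > 0"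
    have "((\<lambda>r. - mu \<phi> r) has_real_derivative - deriv (mu \<phi>) r) (at r)"
      by (intro DERIV_minus mu_has_derivative r)
    then show "((\<lambda>r. - mu \<phi> r) has_real_derivative speed r * (- 2 * speed r)) (at r)"
      by (rule DERIV_cong) (simp add: deriv_mu_speed[OF r] conv power2_eq_square)
    let ?d = "speed r * (deriv (deriv (mu \<phi>)) r / (2 * deriv (mu \<phi>) r))"
    show "((\<lambda>r. - 2 * speed r) has_real_derivative - 2 * ?d) (at r)"
      by (intro DERIV_cmult speed_has_derivative r)
    have "deriv (mu \<phi>) r > 0" using speed_sq_pos[OF r] conv by simp
    then have "deriv (deriv (mu \<phi>)) r / (2 * deriv (mu \<phi>) r) \<le> 0"
      using m[OF r] by (intro divide_nonpos_pos) auto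
    then have "?d \<le> 0" using speed_pos[OF r] by (intro mult_nonneg_nonpos) auto
    then show "0 \<le> - 2 * ?d" by simp
  qed
  then show ?thesis by simp
qed

text \<open>In the concave case \<open>d(1/\<mu>) / d(psi) = 2 speed / \<mu>\<^sup>2\<close>. Its logarithmic derivative is
  \<open>\<mu>'' / (2 \<mu>') - 2 \<mu>' / \<mu>\<close>, and since \<open>\<mu>' < 0\<close> the hypothesis on \<open>\<mu>''\<close> states precisely that this is
  not positive.\<close>

lemma inverse_mu_concave_along_psi:
  assumes conc: "\<kappa> = - 1" and m: "\<And>r. r > 0 \<Longrightarrow> 4 * (deriv (mu \<phi>) r)\<^sup>2 / mu \<phi> r \<le> deriv (deriv (mu \<phi>)) r"
    and pos: "0 < a" "0 < b" "0 < c" and s: "0 \<le> s" "s \<le> 1"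
    and c: "psi \<phi> c = (1 - s) * psi \<phi> a + s * psi \<phi> b"
  shows "(1 - s) * inverse (mu \<phi> a) + s * inverse (mu \<phi> b) \<le> inverse (mu \<phi> c)"
proof -
  let ?h = "\<lambda>r. - 2 * (speed r / (mu \<phi> r)\<^sup>2)"
  have "- inverse (mu \<phi> c) \<le> (1 - s) * (- inverse (mu \<phi> a)) + s * (- inverse (mu \<phi> b))"
  proof (rule convex_along_psi_deriv[OF _ _ _ pos s c, where h = ?h])
    fix r :: real assume r: "r > 0"
    define \<mu> p \<mu>1 \<mu>2 where "\<mu> = mu \<phi> r" and "p = speed r" and "\<mu>1 = deriv (mu \<phi>) r" and "\<mu>2 = deriv (deriv (mu \<phi>)) r"
    have \<mu>: "\<mu> > 0" unfolding \<mu>_def by (rule mu_pos[OF r])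
    have p: "p > 0" unfolding p_def by (rule speed_pos[OF r])
    have m1: "\<mu>1 = - 2 * p\<^sup>2" unfolding \<mu>1_def p_def deriv_mu_speed[OF r] conc by simp
    have "((\<lambda>r. - inverse (mu \<phi> r)) has_real_derivative - (- (inverse (mu \<phi> r) * deriv (mu \<phi>) r * inverse (mu \<phi> r)))) (at r)"
      using \<mu> by (intro DERIV_minus DERIV_inverse' mu_has_derivative r) (simp add: \<mu>_def)
    then show "((\<lambda>r. - inverse (mu \<phi> r)) has_real_derivative speed r * ?h r) (at r)"
    proof (rule DERIV_cong)
      show "- (- (inverse (mu \<phi> r) * deriv (mu \<phi>) r * inverse (mu \<phi> r))) = speed r * ?h r"
        unfolding \<mu>_def[symmetric] p_def[symmetric] \<mu>1_def[symmetric] m1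
        using \<mu> by (simp add: field_simps power2_eq_square)
    qed
    have dsq: "((\<lambda>r. (mu \<phi> r)\<^sup>2) has_real_derivative 2 * \<mu> * \<mu>1) (at r)"
      using DERIV_power[OF mu_has_derivative[OF r], of 2] by (simp add: \<mu>_def \<mu>1_def mult_ac)
    have "(mu \<phi> r)\<^sup>2 \<noteq> 0" using \<mu> by (simp add: \<mu>_def)
    from DERIV_cmult[OF DERIV_divide[OF speed_has_derivative[OF r] dsq this], of "- 2"]
    show "(?h has_real_derivative - 2 * ((p * (\<mu>2 / (2 * \<mu>1)) * \<mu>\<^sup>2 - p * (2 * \<mu> * \<mu>1)) / (\<mu>\<^sup>2 * \<mu>\<^sup>2))) (at r)"
      unfolding \<mu>_def[symmetric] p_def[symmetric] \<mu>1_def[symmetric] \<mu>2_def[symmetric] .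
    have "4 * \<mu>1\<^sup>2 / \<mu> \<le> \<mu>2" using m[OF r] unfolding \<mu>_def \<mu>1_def \<mu>2_def .
    then have "4 * \<mu>1\<^sup>2 \<le> \<mu>2 * \<mu>" using \<mu> by (simp add: pos_divide_le_eq)
    moreover have "\<mu>1 < 0" using p by (simp add: m1)
    ultimately have "\<mu>2 * \<mu> / (2 * \<mu>1) \<le> 4 * \<mu>1\<^sup>2 / (2 * \<mu>1)"
      by (intro divide_right_mono_neg) auto
    also have "\<dots> = 2 * \<mu>1" using \<open>\<mu>1 < 0\<close> by (simp add: power2_eq_square)
    finally have k: "\<mu>2 * \<mu> / (2 * \<mu>1) - 2 * \<mu>1 \<le> 0" by simp
    have "p * (\<mu>2 / (2 * \<mu>1)) * \<mu>\<^sup>2 - p * (2 * \<mu> * \<mu>1) = (p * \<mu>) * (\<mu>2 * \<mu> / (2 * \<mu>1) - 2 * \<mu>1)"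
      by (simp add: power2_eq_square right_diff_distrib)
    also have "\<dots> \<le> 0" using k p \<mu> by (intro mult_nonneg_nonpos) auto
    finally have "(p * (\<mu>2 / (2 * \<mu>1)) * \<mu>\<^sup>2 - p * (2 * \<mu> * \<mu>1)) / (\<mu>\<^sup>2 * \<mu>\<^sup>2) \<le> 0"
      by (rule divide_nonpos_nonneg) simp
    then show "0 \<le> - 2 * ((p * (\<mu>2 / (2 * \<mu>1)) * \<mu>\<^sup>2 - p * (2 * \<mu> * \<mu>1)) / (\<mu>\<^sup>2 * \<mu>\<^sup>2))"
      by (rule mult_nonpos_nonpos[rotated]) simp
  qed
  then show ?thesis by simp
qed

lemma mu_continuous: "continuous_on {0<..} (mu \<phi>)"
proof (intro continuous_at_imp_continuous_on ballI)
  fix r :: real assume "r \<in> {0<..}"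
  then have "r > 0" by simp
  from DERIV_isCont[OF mu_has_derivative[OF this]] show "isCont (mu \<phi>) r" .
qed

lemma energy_density_continuous: "continuous_on {0<..} energy_density"
proof -
  have "isCont (Phi \<phi>) r" if "r > 0" for r by (rule DERIV_isCont[OF Phi_has_derivative[OF that]])
  then have "continuous_on {0<..} (Phi \<phi>)" by (intro continuous_at_imp_continuous_on ballI) simp
  then show ?thesis
    unfolding energy_density_def[abs_def] by (intro continuous_intros mu_continuous)
qed

end

section \<open>The dissipation functional and its geodesic convexity\<close>

lemma lebesgue_on_measurable_AE_cong:
  fixes f g :: "'a::euclidean_space \<Rightarrow> real"
  assumes "S \<in> sets lebesgue" "f \<in> borel_measurable (lebesgue_on S)" "AE x in lebesgue_on S. f x = g x"
  shows "g \<in> borel_measurable (lebesgue_on S)"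
proof -
  have f: "(\<lambda>x. if x \<in> S then f x else 0) \<in> borel_measurable lebesgue"
    using assms(1,2) by (simp add: borel_measurable_if)
  have "AE x in lebesgue. (if x \<in> S then f x else 0) = (if x \<in> S then g x else 0)"
    using assms(3) unfolding AE_lebesgue_on_iff[OF assms(1)] by eventually_elim simp
  from borel_measurable_AE[OF f this] show ?thesis
    using assms(1) by (simp add: borel_measurable_if)
qed

text \<open>With \<open>w = 1 / m\<close> this is joint convexity of the perspective \<open>\<bar>p\<bar>\<^sup>2 / w\<close> combined with its
  monotonicity in \<open>w\<close>; the middle step is the Cauchy-Schwarz inequality for weighted pairs.\<close>

lemma perspective_inequality:
  fixes p q :: "'a::real_inner"
  assumes m: "m0 > 0" "m1 > 0" "m > 0" and s: "0 \<le> s" "s \<le> 1"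
    and c: "(1 - s) * inverse m0 + s * inverse m1 \<le> inverse m"
  shows "m * (norm ((1 - s) *\<^sub>R p + s *\<^sub>R q))\<^sup>2 \<le> (1 - s) * (m0 * (norm p)\<^sup>2) + s * (m1 * (norm q)\<^sup>2)"
proof -
  let ?w0 = "inverse m0" and ?w1 = "inverse m1"
  define P Q where "P = norm p" and "Q = norm q"
  let ?R = "(1 - s) * (m0 * P\<^sup>2) + s * (m1 * Q\<^sup>2)"
  have pos: "?w0 > 0" "?w1 > 0" using m by simp_all
  have R: "0 \<le> ?R" using m s by (intro add_nonneg_nonneg mult_nonneg_nonneg) auto
  have "norm ((1 - s) *\<^sub>R p + s *\<^sub>R q) \<le> norm ((1 - s) *\<^sub>R p) + norm (s *\<^sub>R q)" by (rule norm_triangle_ineq)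
  also have "\<dots> = (1 - s) * P + s * Q" using s by (simp add: P_def Q_def)
  finally have "(norm ((1 - s) *\<^sub>R p + s *\<^sub>R q))\<^sup>2 \<le> ((1 - s) * P + s * Q)\<^sup>2" by (rule power_mono) simp
  also have "\<dots> \<le> ((1 - s) * ?w0 + s * ?w1) * ?R"
  proof -
    have "((1 - s) * ?w0 + s * ?w1) * ?R - ((1 - s) * P + s * Q)\<^sup>2 =
        ((1 - s) * s) * (inverse m0 * m1 * Q\<^sup>2 + inverse m1 * m0 * P\<^sup>2 - 2 * P * Q)"
      using m by (simp add: power2_eq_square field_simps)
    also have "inverse m0 * m1 * Q\<^sup>2 + inverse m1 * m0 * P\<^sup>2 - 2 * P * Q = (m1 * Q - m0 * P)\<^sup>2 / (m0 * m1)"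
      using m by (simp add: power2_eq_square field_simps)
    finally have "((1 - s) * ?w0 + s * ?w1) * ?R - ((1 - s) * P + s * Q)\<^sup>2 =
      ((1 - s) * s) * ((m1 * Q - m0 * P)\<^sup>2 / (m0 * m1))" .
    moreover have "0 \<le> ((1 - s) * s) * ((m1 * Q - m0 * P)\<^sup>2 / (m0 * m1))"
      using m s by (intro mult_nonneg_nonneg divide_nonneg_pos) auto
    ultimately show ?thesis by linarith
  qed
  also have "\<dots> \<le> inverse m * ?R" by (rule mult_right_mono[OF c R])
  finally have "m * (norm ((1 - s) *\<^sub>R p + s *\<^sub>R q))\<^sup>2 \<le> m * (inverse m * ?R)"
    by (rule mult_left_mono) (use m in simp)
  also have "m * (inverse m * ?R) = ?R" using m(3) by simp
  finally show ?thesis unfolding P_def Q_def .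
qed

context profile
begin

text \<open>The preimage under \<open>psi\<close> of the straight line in \<open>L\<^sup>2\<close>.\<close>

definition segment :: "('a \<Rightarrow> real) \<Rightarrow> ('a \<Rightarrow> real) \<Rightarrow> real \<Rightarrow> 'a \<Rightarrow> real" where
  "segment c0 c1 s x = psi_inv ((1 - s) * psi \<phi> (c0 x) + s * psi \<phi> (c1 x))"

lemma psi_segment: "psi \<phi> (segment c0 c1 s x) = (1 - s) * psi \<phi> (c0 x) + s * psi \<phi> (c1 x)"
  by (simp add: segment_def)

lemma segment_endpoints: "segment c0 c1 0 = c0" "segment c0 c1 1 = c1"
  by (simp_all add: segment_def fun_eq_iff)

lemma segment_LPhi:
  assumes c: "c0 \<in> LPhi \<phi> \<Omega>" "c1 \<in> LPhi \<phi> \<Omega>"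
  shows "segment c0 c1 s \<in> LPhi \<phi> \<Omega>"
proof -
  have sq: "square_integrable (lebesgue_on \<Omega>) (\<lambda>x. psi \<phi> (c x))" if "c \<in> LPhi \<phi> \<Omega>" for c
  proof -
    have "c \<in> borel_measurable (lebesgue_on \<Omega>)" "integrable (lebesgue_on \<Omega>) (\<lambda>x. (psi \<phi> (c x))\<^sup>2)"
      using that unfolding LPhi_iff by blast+
    then show ?thesis
      using measurable_compose[OF _ psi_measurable] by (simp add: square_integrable_def)
  qed
  have l: "square_integrable (lebesgue_on \<Omega>) (\<lambda>x. (1 - s) *\<^sub>R psi \<phi> (c0 x) + s *\<^sub>R psi \<phi> (c1 x))"
    by (rule square_integrable_lincomb(1)[OF sq[OF c(1)] sq[OF c(2)]])
  then have m: "(\<lambda>x. (1 - s) * psi \<phi> (c0 x) + s * psi \<phi> (c1 x)) \<in> borel_measurable (lebesgue_on \<Omega>)"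
    by (simp add: square_integrable_def)
  have "segment c0 c1 s \<in> borel_measurable (lebesgue_on \<Omega>)"
    unfolding segment_def[abs_def] by (rule measurable_compose[OF m psi_inv_measurable])
  moreover have "integrable (lebesgue_on \<Omega>) (\<lambda>x. (psi \<phi> (segment c0 c1 s x))\<^sup>2)"
    using l unfolding psi_segment by (simp add: square_integrable_def)
  ultimately show ?thesis unfolding LPhi_iff by blast
qed

lemma segment_geodesic:
  assumes c: "c0 \<in> LPhi \<phi> \<Omega>" "c1 \<in> LPhi \<phi> \<Omega>"
  shows "geodesic \<phi> \<Omega> c0 c1 (segment c0 c1)"
  unfolding geodesic_def
proof (intro conjI ballI)
  show "segment c0 c1 s \<in> LPhi \<phi> \<Omega>" for s by (rule segment_LPhi[OF c])
  show "AE x in lebesgue_on \<Omega>. segment c0 c1 0 x = c0 x" "AE x in lebesgue_on \<Omega>. segment c0 c1 1 x = c1 x"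
    unfolding segment_endpoints by simp_all
  fix s r :: real
  have e: "(psi \<phi> (segment c0 c1 r x) - psi \<phi> (segment c0 c1 s x))\<^sup>2 = \<bar>s - r\<bar>\<^sup>2 * (psi \<phi> (c1 x) - psi \<phi> (c0 x))\<^sup>2" for x
    unfolding psi_segment power2_abs by (simp add: power2_eq_square algebra_simps)
  show "LPhi_dist \<phi> \<Omega> (segment c0 c1 s) (segment c0 c1 r) = \<bar>s - r\<bar> * LPhi_dist \<phi> \<Omega> c0 c1"
    unfolding LPhi_dist_def L2_norm_def e integral_mult_right_zero real_sqrt_mult by simp
qed

lemma segment_between:
  assumes s: "0 \<le> s" "s \<le> 1" and b: "l \<le> c0 x" "c0 x \<le> u" "l \<le> c1 x" "c1 x \<le> u"
  shows "l \<le> segment c0 c1 s x" "segment c0 c1 s x \<le> u"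
proof -
  let ?p = "\<lambda>y. psi \<phi> y"
  have "(1 - s) * ?p l + s * ?p l \<le> (1 - s) * ?p (c0 x) + s * ?p (c1 x)"
    using s b by (intro add_mono mult_left_mono) (auto simp: psi_le_iff)
  moreover have "(1 - s) * ?p (c0 x) + s * ?p (c1 x) \<le> (1 - s) * ?p u + s * ?p u"
    using s b by (intro add_mono mult_left_mono) (auto simp: psi_le_iff)
  moreover have "(1 - s) * y + s * y = y" for y by (simp add: algebra_simps)
  ultimately have "?p l \<le> ?p (segment c0 c1 s x)" "?p (segment c0 c1 s x) \<le> ?p u"
    unfolding psi_segment by simp_all
  then show "l \<le> segment c0 c1 s x" "segment c0 c1 s x \<le> u" unfolding psi_le_iff by simp_all
qed

text \<open>For \<open>c\<close> with values in \<open>[\<epsilon>, 1/\<epsilon>]\<close> only the restriction of \<open>g\<close> to the positive axis matters.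
  Outside of it \<open>mu \<phi>\<close> has meaningless values, so measurability is obtained from the
  continuous function \<open>r \<mapsto> g (max \<epsilon> r)\<close>.\<close>

lemma bounded_composition:
  fixes g :: "real \<Rightarrow> real"
  assumes \<Omega>: "\<Omega> \<in> sets lebesgue" and \<epsilon>: "\<epsilon> > 0" and g: "continuous_on {0<..} g"
    and c: "c \<in> LPhi_eps \<phi> \<Omega> \<epsilon>"
  shows "(\<lambda>x. g (c x)) \<in> borel_measurable (lebesgue_on \<Omega>)"
    and "\<exists>M. AE x in lebesgue_on \<Omega>. \<bar>g (c x)\<bar> \<le> M"
proof -
  have m: "c \<in> borel_measurable (lebesgue_on \<Omega>)" and b: "AE x in lebesgue_on \<Omega>. \<epsilon> \<le> c x \<and> c x \<le> 1 / \<epsilon>"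
    using c by (auto simp: LPhi_eps_def LPhi_def)
  have "continuous_on UNIV (\<lambda>r. g (max \<epsilon> r))"
    by (rule continuous_on_compose2[OF g]) (use \<epsilon> in \<open>auto intro!: continuous_intros\<close>)
  then have "(\<lambda>r. g (max \<epsilon> r)) \<in> borel_measurable borel" by (rule borel_measurable_continuous_onI)
  from measurable_compose[OF m this]
  have m': "(\<lambda>x. g (max \<epsilon> (c x))) \<in> borel_measurable (lebesgue_on \<Omega>)" .
  have ae: "AE x in lebesgue_on \<Omega>. g (max \<epsilon> (c x)) = g (c x)"
    using b by eventually_elim (simp add: max_absorb2)
  show "(\<lambda>x. g (c x)) \<in> borel_measurable (lebesgue_on \<Omega>)"
    by (rule lebesgue_on_measurable_AE_cong[OF \<Omega> m' ae])
  have "compact (g ` {\<epsilon>..1/\<epsilon>})"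
    by (intro compact_continuous_image continuous_on_subset[OF g]) (use \<epsilon> in auto)
  then obtain M where M: "\<forall>y\<in>g ` {\<epsilon>..1/\<epsilon>}. norm y \<le> M"
    using compact_imp_bounded bounded_iff by metis
  have "AE x in lebesgue_on \<Omega>. \<bar>g (c x)\<bar> \<le> M"
    using b
  proof eventually_elim
    case (elim x)
    then have "g (c x) \<in> g ` {\<epsilon>..1/\<epsilon>}" by simp
    with M show ?case unfolding real_norm_def by blast
  qed
  then show "\<exists>M. AE x in lebesgue_on \<Omega>. \<bar>g (c x)\<bar> \<le> M" ..
qed

lemma mu_lower_bound:
  assumes \<epsilon>: "0 < \<epsilon>" "\<epsilon> < 1"
  obtains m where "m > 0" "\<And>r. \<epsilon> \<le> r \<Longrightarrow> r \<le> 1 / \<epsilon> \<Longrightarrow> m \<le> mu \<phi> r"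
proof -
  have ne: "{\<epsilon>..1/\<epsilon>} \<noteq> {}" using \<epsilon> by (simp add: field_simps mult_le_one less_imp_le)
  have "continuous_on {\<epsilon>..1/\<epsilon>} (mu \<phi>)"
    by (rule continuous_on_subset[OF mu_continuous]) (use \<epsilon> in auto)
  from continuous_attains_inf[OF compact_Icc ne this]
  obtain r where r: "r \<in> {\<epsilon>..1/\<epsilon>}" "\<forall>y\<in>{\<epsilon>..1/\<epsilon>}. mu \<phi> r \<le> mu \<phi> y" by blast
  have "mu \<phi> r > 0" by (rule mu_pos) (use r(1) \<epsilon> in auto)
  with that r(2) show ?thesis by simp
qed

end

text \<open>Scalar fields with \<open>A u\<close> the gradient and solenoidal fields with \<open>A u\<close> the symmetric gradient are
  instances. The functional \<open>F\<close> is measured against \<open>A u\<close> alone, which encodes the inequalities of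
  Poincare and Korn.\<close>

locale dissipation = profile +
  fixes \<Omega> :: "(real^'n) set" and V :: "'v set" and A :: "'v \<Rightarrow> real^'n \<Rightarrow> 'm::euclidean_space"
    and F :: "'v \<Rightarrow> real" and C :: real
  assumes dom: "\<Omega> \<in> lmeasurable"
    and ne: "V \<noteq> {}"
    and sq: "\<And>u. u \<in> V \<Longrightarrow> square_integrable (lebesgue_on \<Omega>) (A u)"
    and comb: "\<And>u v s. u \<in> V \<Longrightarrow> v \<in> V \<Longrightarrow> \<exists>w\<in>V. F w = (1 - s) * F u + s * F v \<and>
       (AE x in lebesgue_on \<Omega>. A w x = (1 - s) *\<^sub>R A u x + s *\<^sub>R A v x)"
    and coercive: "\<And>u. u \<in> V \<Longrightarrow> \<bar>F u\<bar> \<le> C * sqrt (L2_sq \<Omega> (A u))"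
begin

definition energy :: "(real^'n \<Rightarrow> real) \<Rightarrow> 'v \<Rightarrow> real" where
  "energy c u = integral\<^sup>L (lebesgue_on \<Omega>) (\<lambda>x. 1/2 * mu \<phi> (c x) * (norm (A u x))\<^sup>2) - F u"

text \<open>The functional \<open>J_F\<close>; its real value is \<open>real_inf_energy\<close> below.\<close>

definition inf_energy :: "(real^'n \<Rightarrow> real) \<Rightarrow> ereal" where
  "inf_energy c = (INF u\<in>V. ereal (energy c u))"

lemma dom_sets: "\<Omega> \<in> sets lebesgue" using dom by (rule fmeasurableD)

lemma finite_measure_dom: "finite_measure (lebesgue_on \<Omega>)"
  by (rule finite_measure_lebesgue_on[OF dom])

lemma dissipation_integrable:
  assumes "\<epsilon> > 0" "c \<in> LPhi_eps \<phi> \<Omega> \<epsilon>" "u \<in> V"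
  shows "integrable (lebesgue_on \<Omega>) (\<lambda>x. 1/2 * mu \<phi> (c x) * (norm (A u x))\<^sup>2)"
proof -
  note B = bounded_composition[OF dom_sets assms(1) mu_continuous assms(2)]
  obtain M where M: "AE x in lebesgue_on \<Omega>. \<bar>mu \<phi> (c x)\<bar> \<le> M" using B(2) by blast
  have a: "A u \<in> borel_measurable (lebesgue_on \<Omega>)" "integrable (lebesgue_on \<Omega>) (\<lambda>x. (norm (A u x))\<^sup>2)"
    using sq[OF assms(3)] by (auto simp: square_integrable_def)
  have i: "integrable (lebesgue_on \<Omega>) (\<lambda>x. M * (norm (A u x))\<^sup>2)" using a(2) by simp
  show ?thesis
  proof (rule Bochner_Integration.integrable_bound[OF i])
    show "(\<lambda>x. 1/2 * mu \<phi> (c x) * (norm (A u x))\<^sup>2) \<in> borel_measurable (lebesgue_on \<Omega>)"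
      using B(1) a(1) by measurable
    show "AE x in lebesgue_on \<Omega>. norm (1/2 * mu \<phi> (c x) * (norm (A u x))\<^sup>2) \<le> norm (M * (norm (A u x))\<^sup>2)"
      using M
    proof eventually_elim
      case (elim x)
      then have "\<bar>1/2 * mu \<phi> (c x)\<bar> \<le> \<bar>M\<bar>" by (simp add: abs_mult)
      then have "\<bar>1/2 * mu \<phi> (c x)\<bar> * (norm (A u x))\<^sup>2 \<le> \<bar>M\<bar> * (norm (A u x))\<^sup>2"
        by (rule mult_right_mono) simp
      then show ?case by (simp only: real_norm_def abs_mult abs_power2)
    qed
  qed
qed

lemma J_c_integrable:
  assumes "\<epsilon> > 0" "c \<in> LPhi_eps \<phi> \<Omega> \<epsilon>"
  shows "integrable (lebesgue_on \<Omega>) (\<lambda>x. energy_density (c x))"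
    and "- \<kappa> * J_c \<phi> \<Omega> c = (\<integral>x. energy_density (c x) \<partial>lebesgue_on \<Omega>)"
proof -
  note B = bounded_composition[OF dom_sets assms(1) energy_density_continuous assms(2)]
  obtain M where M: "AE x in lebesgue_on \<Omega>. \<bar>energy_density (c x)\<bar> \<le> M" using B(2) by blast
  show "integrable (lebesgue_on \<Omega>) (\<lambda>x. energy_density (c x))"
    by (rule finite_measure.integrable_const_bound[OF finite_measure_dom _ B(1), of M]) (use M in simp)
  show "- \<kappa> * J_c \<phi> \<Omega> c = (\<integral>x. energy_density (c x) \<partial>lebesgue_on \<Omega>)"
    unfolding J_c_def energy_density_def integral_mult_right_zero by (rule refl)
qed

text \<open>Completing the square in \<open>m/2 y\<^sup>2 - C y\<close>, where \<open>y\<close> is the \<open>L\<^sup>2\<close> norm of \<open>A u\<close>, bounds the energy from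
  below.\<close>

lemma inf_energy_real:
  assumes \<epsilon>: "0 < \<epsilon>" "\<epsilon> < 1" and c: "c \<in> LPhi_eps \<phi> \<Omega> \<epsilon>"
  shows "inf_energy c = ereal (INF u\<in>V. energy c u)" "bdd_below (energy c ` V)"
proof -
  obtain m where m: "m > 0" "\<And>r. \<epsilon> \<le> r \<Longrightarrow> r \<le> 1 / \<epsilon> \<Longrightarrow> m \<le> mu \<phi> r"
    using mu_lower_bound[OF \<epsilon>] by metis
  have b: "AE x in lebesgue_on \<Omega>. \<epsilon> \<le> c x \<and> c x \<le> 1 / \<epsilon>"
    using c by (simp add: LPhi_eps_def)
  have low: "- C\<^sup>2 / (2 * m) \<le> energy c u" if u: "u \<in> V" for u
  proof -
    define I where "I = L2_sq \<Omega> (A u)"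
    have I: "I \<ge> 0" unfolding I_def by (rule Bochner_Integration.integral_nonneg) simp
    have i: "integrable (lebesgue_on \<Omega>) (\<lambda>x. m / 2 * (norm (A u x))\<^sup>2)"
      using sq[OF u] by (simp add: square_integrable_def)
    have "m / 2 * I = (\<integral>x. m / 2 * (norm (A u x))\<^sup>2 \<partial>lebesgue_on \<Omega>)"
      unfolding I_def integral_mult_right_zero by (rule refl)
    also have "\<dots> \<le> (\<integral>x. 1/2 * mu \<phi> (c x) * (norm (A u x))\<^sup>2 \<partial>lebesgue_on \<Omega>)"
    proof (rule integral_mono_AE[OF i dissipation_integrable[OF \<epsilon>(1) c u]])
      show "AE x in lebesgue_on \<Omega>. m / 2 * (norm (A u x))\<^sup>2 \<le> 1/2 * mu \<phi> (c x) * (norm (A u x))\<^sup>2"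
        using b
      proof eventually_elim
        case (elim x)
        then have "m \<le> mu \<phi> (c x)" using m(2) by blast
        then show ?case by (intro mult_right_mono) auto
      qed
    qed
    finally have "m / 2 * (sqrt I)\<^sup>2 - C * sqrt I \<le> energy c u"
      using coercive[OF u] I unfolding energy_def I_def[symmetric] by simp
    moreover have "- C\<^sup>2 / (2 * m) \<le> m / 2 * y\<^sup>2 - C * y" for y
    proof -
      have "m / 2 * y\<^sup>2 - C * y + C\<^sup>2 / (2 * m) = (m * y - C)\<^sup>2 / (2 * m)"
        using m(1) by (simp add: power2_eq_square field_simps)
      moreover have "0 \<le> (m * y - C)\<^sup>2 / (2 * m)" using m(1) by simp
      ultimately show ?thesis by simp
    qed
    ultimately show ?thesis using order_trans by blast
  qed
  then show bdd: "bdd_below (energy c ` V)" by (intro bdd_belowI2)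
  have "ereal (INF u\<in>V. energy c u) = (INF u\<in>V. ereal (energy c u))"
  proof -
    have "(INF u\<in>V. ereal (energy c u)) \<noteq> \<infinity>"
    proof -
      obtain u where "u \<in> V" using ne by blast
      then have "(INF u\<in>V. ereal (energy c u)) \<le> ereal (energy c u)" by (rule INF_lower)
      then show ?thesis by auto
    qed
    moreover have "ereal (- C\<^sup>2 / (2 * m)) \<le> (INF u\<in>V. ereal (energy c u))"
      by (rule INF_greatest) (simp only: ereal_less_eq low)
    then have "(INF u\<in>V. ereal (energy c u)) \<noteq> - \<infinity>" by auto
    ultimately have "\<bar>INF u\<in>V. ereal (energy c u)\<bar> \<noteq> \<infinity>" by auto
    then show ?thesis by (rule ereal_INF)
  qed
  then show "inf_energy c = ereal (INF u\<in>V. energy c u)" unfolding inf_energy_def by simp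
qed

lemma segment_LPhi_eps:
  assumes c: "c0 \<in> LPhi_eps \<phi> \<Omega> \<epsilon>" "c1 \<in> LPhi_eps \<phi> \<Omega> \<epsilon>" and s: "0 \<le> s" "s \<le> 1"
  shows "segment c0 c1 s \<in> LPhi_eps \<phi> \<Omega> \<epsilon>"
proof -
  have b: "AE x in lebesgue_on \<Omega>. \<epsilon> \<le> c0 x \<and> c0 x \<le> 1 / \<epsilon>" "AE x in lebesgue_on \<Omega>. \<epsilon> \<le> c1 x \<and> c1 x \<le> 1 / \<epsilon>"
    and l: "c0 \<in> LPhi \<phi> \<Omega>" "c1 \<in> LPhi \<phi> \<Omega>"
    using c by (simp_all add: LPhi_eps_def)
  from b have "AE x in lebesgue_on \<Omega>. \<epsilon> \<le> segment c0 c1 s x \<and> segment c0 c1 s x \<le> 1 / \<epsilon>"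
  proof eventually_elim
    case (elim x)
    then show ?case
      using segment_between[OF s, where l = \<epsilon> and ?c0.0 = c0 and ?c1.0 = c1 and u = "1 / \<epsilon>" and x = x] by blast
  qed
  then show ?thesis using segment_LPhi[OF l] by (simp add: LPhi_eps_def)
qed

definition real_inf_energy :: "(real^'n \<Rightarrow> real) \<Rightarrow> real" where "real_inf_energy c = (INF u\<in>V. energy c u)"

lemma J_c_convex:
  assumes l: "\<And>r. r > 0 \<Longrightarrow> l \<le> 1 + r * deriv (deriv (mu \<phi>)) r / (2 * deriv (mu \<phi>) r)"
    and \<epsilon>: "0 < \<epsilon>" and c: "c0 \<in> LPhi_eps \<phi> \<Omega> \<epsilon>" "c1 \<in> LPhi_eps \<phi> \<Omega> \<epsilon>" and s: "0 \<le> s" "s \<le> 1"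
  shows "- \<kappa> * J_c \<phi> \<Omega> (segment c0 c1 s) \<le> (1 - s) * (- \<kappa> * J_c \<phi> \<Omega> c0) + s * (- \<kappa> * J_c \<phi> \<Omega> c1)
     - l / 2 * s * (1 - s) * (LPhi_dist \<phi> \<Omega> c0 c1)\<^sup>2"
proof -
  let ?M = "lebesgue_on \<Omega>"
  note cs = segment_LPhi_eps[OF c s]
  have b: "AE x in ?M. \<epsilon> \<le> c0 x \<and> c0 x \<le> 1 / \<epsilon>" "AE x in ?M. \<epsilon> \<le> c1 x \<and> c1 x \<le> 1 / \<epsilon>"
    "AE x in ?M. \<epsilon> \<le> segment c0 c1 s x \<and> segment c0 c1 s x \<le> 1 / \<epsilon>"
    using c cs by (simp_all add: LPhi_eps_def)
  have sqp: "integrable ?M (\<lambda>x. (psi \<phi> (c1 x) - psi \<phi> (c0 x))\<^sup>2)"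
  proof -
    have "square_integrable ?M (\<lambda>x. psi \<phi> (c x))" if "c \<in> LPhi_eps \<phi> \<Omega> \<epsilon>" for c
    proof -
      have "c \<in> LPhi \<phi> \<Omega>" using that by (simp add: LPhi_eps_def)
      then have "c \<in> borel_measurable ?M" "integrable ?M (\<lambda>x. (psi \<phi> (c x))\<^sup>2)" unfolding LPhi_iff by blast+
      then show ?thesis using measurable_compose[OF _ psi_measurable] by (simp add: square_integrable_def)
    qed
    from square_integrable_lincomb(1)[OF this[OF c(2)] this[OF c(1)], of 1 "-1"]
    show ?thesis by (simp add: square_integrable_def)
  qed
  note I = J_c_integrable[OF \<epsilon> c(1)] J_c_integrable[OF \<epsilon> c(2)] J_c_integrable[OF \<epsilon> cs]
  have i: "integrable ?M (\<lambda>x. (1 - s) * energy_density (c0 x) + s * energy_density (c1 x))" using I by simp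
  have i2: "integrable ?M (\<lambda>x. l / 2 * s * (1 - s) * (psi \<phi> (c1 x) - psi \<phi> (c0 x))\<^sup>2)" using sqp by simp
  have "(\<integral>x. energy_density (segment c0 c1 s x) \<partial>?M) \<le>
    (\<integral>x. (1 - s) * energy_density (c0 x) + s * energy_density (c1 x) - l / 2 * s * (1 - s) * (psi \<phi> (c1 x) - psi \<phi> (c0 x))\<^sup>2 \<partial>?M)"
  proof (rule integral_mono_AE[OF I(5) Bochner_Integration.integrable_diff[OF i i2]])
    show "AE x in ?M. energy_density (segment c0 c1 s x) \<le>
      (1 - s) * energy_density (c0 x) + s * energy_density (c1 x) - l / 2 * s * (1 - s) * (psi \<phi> (c1 x) - psi \<phi> (c0 x))\<^sup>2"
      using b
    proof eventually_elim
      case (elim x)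
      then show ?case using \<epsilon>
        by (intro energy_density_convex[OF l] s psi_segment) auto
    qed
  qed
  also have "\<dots> = (\<integral>x. (1 - s) * energy_density (c0 x) + s * energy_density (c1 x) \<partial>?M)
     - (\<integral>x. l / 2 * s * (1 - s) * (psi \<phi> (c1 x) - psi \<phi> (c0 x))\<^sup>2 \<partial>?M)"
    by (rule Bochner_Integration.integral_diff[OF i i2])
  also have "(\<integral>x. (1 - s) * energy_density (c0 x) + s * energy_density (c1 x) \<partial>?M) =
     (1 - s) * (\<integral>x. energy_density (c0 x) \<partial>?M) + s * (\<integral>x. energy_density (c1 x) \<partial>?M)"
    using I by simp
  also have "(\<integral>x. l / 2 * s * (1 - s) * (psi \<phi> (c1 x) - psi \<phi> (c0 x))\<^sup>2 \<partial>?M) =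
      l / 2 * s * (1 - s) * (LPhi_dist \<phi> \<Omega> c0 c1)\<^sup>2"
  proof -
    have "0 \<le> (\<integral>x. (psi \<phi> (c1 x) - psi \<phi> (c0 x))\<^sup>2 \<partial>?M)" by (rule Bochner_Integration.integral_nonneg) simp
    then show ?thesis unfolding integral_mult_right_zero LPhi_dist_def L2_norm_def by simp
  qed
  finally show ?thesis unfolding I(2,4,6) .
qed

text \<open>For fixed \<open>u\<close> the energy is affine in \<open>mu \<phi> \<circ> c\<close>, which is concave along the segment.\<close>

lemma energy_concave:
  assumes conv: "\<kappa> = 1" and m: "\<And>r. r > 0 \<Longrightarrow> deriv (deriv (mu \<phi>)) r \<le> 0"
    and \<epsilon>: "0 < \<epsilon>" and c: "c0 \<in> LPhi_eps \<phi> \<Omega> \<epsilon>" "c1 \<in> LPhi_eps \<phi> \<Omega> \<epsilon>" and s: "0 \<le> s" "s \<le> 1"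
    and u: "u \<in> V"
  shows "(1 - s) * energy c0 u + s * energy c1 u \<le> energy (segment c0 c1 s) u"
proof -
  let ?M = "lebesgue_on \<Omega>"
  let ?d = "\<lambda>c x. 1/2 * mu \<phi> (c x) * (norm (A u x))\<^sup>2"
  note cs = segment_LPhi_eps[OF c s]
  have b: "AE x in ?M. \<epsilon> \<le> c0 x \<and> c0 x \<le> 1 / \<epsilon>" "AE x in ?M. \<epsilon> \<le> c1 x \<and> c1 x \<le> 1 / \<epsilon>"
    "AE x in ?M. \<epsilon> \<le> segment c0 c1 s x \<and> segment c0 c1 s x \<le> 1 / \<epsilon>"
    using c cs by (simp_all add: LPhi_eps_def)
  note I = dissipation_integrable[OF \<epsilon> c(1) u] dissipation_integrable[OF \<epsilon> c(2) u] dissipation_integrable[OF \<epsilon> cs u]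
  have "(1 - s) * integral\<^sup>L ?M (?d c0) + s * integral\<^sup>L ?M (?d c1) = (\<integral>x. (1 - s) * ?d c0 x + s * ?d c1 x \<partial>?M)"
    using Bochner_Integration.integral_add[OF integrable_mult_right[OF I(1), of "1 - s"] integrable_mult_right[OF I(2), of s]]
    unfolding integral_mult_right_zero by (rule sym)
  also have "\<dots> \<le> integral\<^sup>L ?M (?d (segment c0 c1 s))"
  proof (rule integral_mono_AE[OF Bochner_Integration.integrable_add[OF integrable_mult_right[OF I(1)] integrable_mult_right[OF I(2)]] I(3)])
    show "AE x in ?M. (1 - s) * ?d c0 x + s * ?d c1 x \<le> ?d (segment c0 c1 s) x"
      using b
    proof eventually_elim
      case (elim x)
      then have "(1 - s) * mu \<phi> (c0 x) + s * mu \<phi> (c1 x) \<le> mu \<phi> (segment c0 c1 s x)"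
        using \<epsilon> by (intro mu_concave_along_psi[OF conv m] s psi_segment) auto
      then have "((1 - s) * mu \<phi> (c0 x) + s * mu \<phi> (c1 x)) * (1/2 * (norm (A u x))\<^sup>2) \<le>
         mu \<phi> (segment c0 c1 s x) * (1/2 * (norm (A u x))\<^sup>2)" by (rule mult_right_mono) simp
      moreover have "1/2 * y * z = y * (1/2 * z)" for y z :: real by simp
      ultimately show ?case by (simp only: distrib_right mult.assoc)
    qed
  qed
  finally have "(1 - s) * integral\<^sup>L ?M (?d c0) + s * integral\<^sup>L ?M (?d c1) \<le> integral\<^sup>L ?M (?d (segment c0 c1 s))" .
  then show ?thesis unfolding energy_def by (simp add: algebra_simps)
qed

text \<open>The competitor \<open>w\<close> is the convex combination of \<open>u\<close> and \<open>v\<close>.\<close>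

lemma energy_jointly_convex:
  assumes conc: "\<kappa> = - 1" and m: "\<And>r. r > 0 \<Longrightarrow> 4 * (deriv (mu \<phi>) r)\<^sup>2 / mu \<phi> r \<le> deriv (deriv (mu \<phi>)) r"
    and \<epsilon>: "0 < \<epsilon>" and c: "c0 \<in> LPhi_eps \<phi> \<Omega> \<epsilon>" "c1 \<in> LPhi_eps \<phi> \<Omega> \<epsilon>" and s: "0 \<le> s" "s \<le> 1"
    and u: "u \<in> V" "v \<in> V"
  shows "\<exists>w\<in>V. energy (segment c0 c1 s) w \<le> (1 - s) * energy c0 u + s * energy c1 v"
proof -
  let ?M = "lebesgue_on \<Omega>"
  let ?d = "\<lambda>c u x. 1/2 * mu \<phi> (c x) * (norm (A u x))\<^sup>2"
  obtain w where w: "w \<in> V" "F w = (1 - s) * F u + s * F v"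
    "AE x in ?M. A w x = (1 - s) *\<^sub>R A u x + s *\<^sub>R A v x" using comb[OF u] by blast
  note cs = segment_LPhi_eps[OF c s]
  have b: "AE x in ?M. \<epsilon> \<le> c0 x \<and> c0 x \<le> 1 / \<epsilon>" "AE x in ?M. \<epsilon> \<le> c1 x \<and> c1 x \<le> 1 / \<epsilon>"
    "AE x in ?M. \<epsilon> \<le> segment c0 c1 s x \<and> segment c0 c1 s x \<le> 1 / \<epsilon>"
    using c cs by (simp_all add: LPhi_eps_def)
  note I = dissipation_integrable[OF \<epsilon> c(1) u(1)] dissipation_integrable[OF \<epsilon> c(2) u(2)] dissipation_integrable[OF \<epsilon> cs w(1)]
  have "integral\<^sup>L ?M (?d (segment c0 c1 s) w) \<le> (\<integral>x. (1 - s) * ?d c0 u x + s * ?d c1 v x \<partial>?M)"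
  proof (rule integral_mono_AE[OF I(3) Bochner_Integration.integrable_add[OF integrable_mult_right[OF I(1)] integrable_mult_right[OF I(2)]]])
    show "AE x in ?M. ?d (segment c0 c1 s) w x \<le> (1 - s) * ?d c0 u x + s * ?d c1 v x"
      using b w(3)
    proof eventually_elim
      case (elim x)
      have p: "0 < c0 x" "0 < c1 x" "0 < segment c0 c1 s x" using elim \<epsilon> by auto
      have "mu \<phi> (segment c0 c1 s x) * (norm ((1 - s) *\<^sub>R A u x + s *\<^sub>R A v x))\<^sup>2 \<le>
          (1 - s) * (mu \<phi> (c0 x) * (norm (A u x))\<^sup>2) + s * (mu \<phi> (c1 x) * (norm (A v x))\<^sup>2)"
        by (intro perspective_inequality mu_pos p s inverse_mu_concave_along_psi[OF conc m] psi_segment)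
      then show ?case unfolding elim(4) by simp
    qed
  qed
  also have "\<dots> = (1 - s) * integral\<^sup>L ?M (?d c0 u) + s * integral\<^sup>L ?M (?d c1 v)"
    using Bochner_Integration.integral_add[OF integrable_mult_right[OF I(1), of "1 - s"] integrable_mult_right[OF I(2), of s]]
    unfolding integral_mult_right_zero .
  finally have "energy (segment c0 c1 s) w \<le> (1 - s) * energy c0 u + s * energy c1 v"
    unfolding energy_def w(2) by (simp add: algebra_simps)
  with w(1) show ?thesis by blast
qed

text \<open>In the convex case an infimum of concave functions is taken; in the concave case near-minimisers
  at the endpoints are combined to a competitor on the segment.\<close>

lemma signed_inf_energy_convex:
  assumes cases: "(\<kappa> = 1 \<and> (\<forall>r>0. deriv (deriv (mu \<phi>)) r \<le> 0)) \<or>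
      (\<kappa> = - 1 \<and> (\<forall>r>0. 4 * (deriv (mu \<phi>) r)\<^sup>2 / mu \<phi> r \<le> deriv (deriv (mu \<phi>)) r))"
    and \<epsilon>: "0 < \<epsilon>" "\<epsilon> < 1" and c: "c0 \<in> LPhi_eps \<phi> \<Omega> \<epsilon>" "c1 \<in> LPhi_eps \<phi> \<Omega> \<epsilon>" and s: "0 \<le> s" "s \<le> 1"
  shows "- \<kappa> * real_inf_energy (segment c0 c1 s) \<le> (1 - s) * (- \<kappa> * real_inf_energy c0) + s * (- \<kappa> * real_inf_energy c1)"
  using cases
proof (elim disjE conjE)
  note bdd = inf_energy_real(2)[OF \<epsilon>]
  note cs = segment_LPhi_eps[OF c s]
  assume k: "\<kappa> = 1" and m: "\<forall>r>0. deriv (deriv (mu \<phi>)) r \<le> 0"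
  have "(1 - s) * real_inf_energy c0 + s * real_inf_energy c1 \<le> real_inf_energy (segment c0 c1 s)"
    unfolding real_inf_energy_def[of "segment c0 c1 s"]
  proof (rule cINF_greatest[OF ne])
    fix u assume u: "u \<in> V"
    have "(1 - s) * real_inf_energy c0 + s * real_inf_energy c1 \<le> (1 - s) * energy c0 u + s * energy c1 u"
      unfolding real_inf_energy_def using s by (intro add_mono mult_left_mono cINF_lower bdd c u) auto
    also have "\<dots> \<le> energy (segment c0 c1 s) u"
      by (rule energy_concave[OF k _ \<epsilon>(1) c s u]) (use m in blast)
    finally show "(1 - s) * real_inf_energy c0 + s * real_inf_energy c1 \<le> energy (segment c0 c1 s) u" .
  qed
  then show ?thesis unfolding k by simp
next
  note bdd = inf_energy_real(2)[OF \<epsilon>]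
  note cs = segment_LPhi_eps[OF c s]
  assume k: "\<kappa> = - 1" and m: "\<forall>r>0. 4 * (deriv (mu \<phi>) r)\<^sup>2 / mu \<phi> r \<le> deriv (deriv (mu \<phi>)) r"
  have "real_inf_energy (segment c0 c1 s) \<le> (1 - s) * real_inf_energy c0 + s * real_inf_energy c1"
  proof (rule field_le_epsilon)
    fix e :: real assume "e > 0"
    then have "real_inf_energy c0 < real_inf_energy c0 + e" "real_inf_energy c1 < real_inf_energy c1 + e" by simp_all
    then obtain u v where u: "u \<in> V" "energy c0 u < real_inf_energy c0 + e" and v: "v \<in> V" "energy c1 v < real_inf_energy c1 + e"
      unfolding real_inf_energy_def using cINF_less_iff[OF ne bdd] c by metis
    obtain w where w: "w \<in> V" "energy (segment c0 c1 s) w \<le> (1 - s) * energy c0 u + s * energy c1 v"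
      using energy_jointly_convex[OF k _ \<epsilon>(1) c s u(1) v(1)] m by blast
    have "real_inf_energy (segment c0 c1 s) \<le> energy (segment c0 c1 s) w"
      unfolding real_inf_energy_def by (rule cINF_lower[OF bdd[OF cs] w(1)])
    also have "\<dots> \<le> (1 - s) * (real_inf_energy c0 + e) + s * (real_inf_energy c1 + e)"
      using w(2) s u v by (intro order_trans[OF w(2)] add_mono mult_left_mono) auto
    also have "\<dots> = (1 - s) * real_inf_energy c0 + s * real_inf_energy c1 + e" by (simp add: algebra_simps)
    finally show "real_inf_energy (segment c0 c1 s) \<le> (1 - s) * real_inf_energy c0 + s * real_inf_energy c1 + e" .
  qed
  then show ?thesis unfolding k by simp
qed

text \<open>The contributions of \<open>J_c\<close> and \<open>J_F\<close> add up. If an endpoint has infinite energy, the right-hand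
  side is infinite for \<open>0 < s < 1\<close>, because the energy never takes the value \<open>- \<infinity>\<close>.\<close>

lemma geodesically_convex_energy:
  assumes cases: "(\<kappa> = 1 \<and> (\<forall>r>0. deriv (deriv (mu \<phi>)) r \<le> 0)) \<or>
      (\<kappa> = - 1 \<and> (\<forall>r>0. 4 * (deriv (mu \<phi>) r)\<^sup>2 / mu \<phi> r \<le> deriv (deriv (mu \<phi>)) r))"
    and l: "\<And>r. r > 0 \<Longrightarrow> l \<le> 1 + r * deriv (deriv (mu \<phi>)) r / (2 * deriv (mu \<phi>) r)"
    and \<epsilon>: "0 < \<epsilon>" "\<epsilon> < 1"
  shows "geodesically_convex \<phi> \<Omega> l (E_eps \<phi> \<Omega> inf_energy \<epsilon>)"
proof -
  let ?E = "E_eps \<phi> \<Omega> inf_energy \<epsilon>"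
  have E: "?E c = ereal (- \<kappa> * J_c \<phi> \<Omega> c + - \<kappa> * real_inf_energy c)" if "c \<in> LPhi_eps \<phi> \<Omega> \<epsilon>" for c
    using that inf_energy_real(1)[OF \<epsilon> that] by (simp add: E_eps_def sign(1) real_inf_energy_def)
  have Einf: "?E c = \<infinity>" if "c \<notin> LPhi_eps \<phi> \<Omega> \<epsilon>" for c
    using that by (simp add: E_eps_def)
  have gt: "?E c > - \<infinity>" for c by (cases "c \<in> LPhi_eps \<phi> \<Omega> \<epsilon>") (simp_all add: E Einf)
  have main: "?E (segment c0 c1 s) \<le> ereal (1 - s) * ?E c0 + ereal s * ?E c1
        - ereal (l / 2 * s * (1 - s) * (LPhi_dist \<phi> \<Omega> c0 c1)\<^sup>2)"
    if s: "s \<in> {0..1}" for c0 c1 s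
  \<comment> \<open>At the endpoints the convention \<open>0 * \<infinity> = 0\<close> makes the claim an equality.\<close>
  proof (cases "s = 0 \<or> s = 1")
    case True
    then show ?thesis by (auto simp: segment_endpoints zero_ereal_def[symmetric] one_ereal_def[symmetric])
  next
    case False
    then have s': "0 \<le> s" "s \<le> 1" "0 < s" "0 < 1 - s" using s by auto
    show ?thesis
    proof (cases "c0 \<in> LPhi_eps \<phi> \<Omega> \<epsilon> \<and> c1 \<in> LPhi_eps \<phi> \<Omega> \<epsilon>")
      case True
      then have c: "c0 \<in> LPhi_eps \<phi> \<Omega> \<epsilon>" "c1 \<in> LPhi_eps \<phi> \<Omega> \<epsilon>" by blast+
      note J = J_c_convex[OF l \<epsilon>(1) c s'(1,2)] and W = signed_inf_energy_convex[OF cases \<epsilon> c s'(1,2)]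
      define j0 j1 j w0 w1 w d where "j0 = - \<kappa> * J_c \<phi> \<Omega> c0" and "j1 = - \<kappa> * J_c \<phi> \<Omega> c1"
        and "j = - \<kappa> * J_c \<phi> \<Omega> (segment c0 c1 s)" and "w0 = - \<kappa> * real_inf_energy c0" and "w1 = - \<kappa> * real_inf_energy c1"
        and "w = - \<kappa> * real_inf_energy (segment c0 c1 s)" and "d = l / 2 * s * (1 - s) * (LPhi_dist \<phi> \<Omega> c0 c1)\<^sup>2"
      have "j + w \<le> ((1 - s) * j0 + s * j1 - d) + ((1 - s) * w0 + s * w1)"
        using J W unfolding j0_def j1_def j_def w0_def w1_def w_def d_def by (rule add_mono)
      also have "\<dots> = (1 - s) * (j0 + w0) + s * (j1 + w1) - d" by (simp add: algebra_simps)
      finally show ?thesis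
        unfolding E[OF c(1)] E[OF c(2)] E[OF segment_LPhi_eps[OF c s'(1,2)]]
          j0_def[symmetric] j1_def[symmetric] j_def[symmetric] w0_def[symmetric] w1_def[symmetric] w_def[symmetric] d_def[symmetric]
        by simp
    next
      case False
      then have "?E c0 = \<infinity> \<or> ?E c1 = \<infinity>" using Einf by blast
      then have eq: "ereal (1 - s) * ?E c0 + ereal s * ?E c1 = \<infinity>"
        using gt[of c0] gt[of c1] s' by (cases "?E c0"; cases "?E c1"; auto)
      show ?thesis unfolding eq by simp
    qed
  qed
  show ?thesis
    unfolding geodesically_convex_def
  proof (intro conjI ballI)
    show "?E c > - \<infinity>" for c by (rule gt)
    fix c0 c1 assume "c0 \<in> LPhi \<phi> \<Omega>" "c1 \<in> LPhi \<phi> \<Omega>"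
    from segment_geodesic[OF this] main
    show "\<exists>\<gamma>. geodesic \<phi> \<Omega> c0 c1 \<gamma> \<and> (\<forall>s\<in>{0..1}. ?E (\<gamma> s) \<le> ereal (1 - s) * ?E c0 + ereal s * ?E c1
        - ereal (l / 2 * s * (1 - s) * (LPhi_dist \<phi> \<Omega> c0 c1)\<^sup>2))" by blast
  qed
qed

end

section \<open>The two variational problems\<close>

text \<open>By \<open>H10_poincare\<close> the full Sobolev norm is controlled by the gradient.\<close>

lemma H10_functional_bound:
  fixes G :: "(real^'n \<Rightarrow> 'b::euclidean_space) \<Rightarrow> real"
  assumes "open \<Omega>" "bounded \<Omega>" and G: "bounded_functional (H10 \<Omega>) (sobolev_norm (L2_norm \<Omega>) \<Omega>) G"
  shows "\<exists>C\<ge>0. \<forall>u\<in>H10 \<Omega>. \<bar>G u\<bar> \<le> C * sqrt (L2_sq \<Omega> (weak_deriv \<Omega> u))"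
proof -
  obtain K where K: "\<And>u. u \<in> H10 \<Omega> \<Longrightarrow> \<bar>G u\<bar> \<le> K * sobolev_norm (L2_norm \<Omega>) \<Omega> u"
    using G unfolding bounded_functional_def by blast
  obtain R0 where R0: "\<forall>x\<in>\<Omega>. norm x \<le> R0" using \<open>bounded \<Omega>\<close> unfolding bounded_iff by blast
  define R where "R = max 0 R0"
  have R: "R \<ge> 0" "\<And>x. x \<in> \<Omega> \<Longrightarrow> norm x \<le> R" using R0 unfolding R_def by (auto simp: le_max_iff_disj)
  have "\<bar>G u\<bar> \<le> \<bar>K\<bar> * (4 * R + 1) * sqrt (L2_sq \<Omega> (weak_deriv \<Omega> u))"
    if u: "u \<in> H10 \<Omega>" for u
  proof -
    define a b where "a = L2_sq \<Omega> u"
      and "b = L2_sq \<Omega> (weak_deriv \<Omega> u)"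
    have nn: "0 \<le> a" "0 \<le> b" unfolding a_def b_def by (intro Bochner_Integration.integral_nonneg; simp)+
    have "a \<le> 16 * R\<^sup>2 * b" unfolding a_def b_def by (rule H10_poincare[OF assms(1) u R(2)])
    then have "sqrt a \<le> sqrt ((4 * R)\<^sup>2 * b)" by (simp add: power_mult_distrib)
    also have "\<dots> = 4 * R * sqrt b" using R(1) by (simp add: real_sqrt_mult)
    finally have ab: "sqrt a + sqrt b \<le> (4 * R + 1) * sqrt b" by (simp add: algebra_simps)
    have "\<bar>G u\<bar> \<le> K * (sqrt a + sqrt b)"
      using K[OF u] unfolding sobolev_norm_def L2_norm_norm a_def b_def .
    also have "\<dots> \<le> \<bar>K\<bar> * (sqrt a + sqrt b)" using nn by (intro mult_right_mono) auto
    also have "\<dots> \<le> \<bar>K\<bar> * ((4 * R + 1) * sqrt b)" by (rule mult_left_mono[OF ab]) simp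
    finally show ?thesis unfolding b_def by (simp only: mult.assoc)
  qed
  then show ?thesis using R(1) by (intro exI[of _ "\<bar>K\<bar> * (4 * R + 1)"] conjI ballI) auto
qed

lemma H10_functional_comb:
  assumes "open \<Omega>" "bounded_functional (H10 \<Omega>) N G" "u \<in> H10 \<Omega>" "v \<in> H10 \<Omega>"
  shows "G (\<lambda>x. a *\<^sub>R u x + b *\<^sub>R v x) = a * G u + b * G v"
proof -
  have au: "(\<lambda>x. a *\<^sub>R u x) \<in> H10 \<Omega>" using H10_lincomb[OF assms(1,3,3), of a 0] by simp
  have bv: "(\<lambda>x. b *\<^sub>R v x) \<in> H10 \<Omega>" using H10_lincomb[OF assms(1,4,4), of b 0] by simp
  have add: "\<forall>u\<in>H10 \<Omega>. \<forall>v\<in>H10 \<Omega>. G (\<lambda>x. u x + v x) = G u + G v"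
    and scale: "\<forall>a. \<forall>u\<in>H10 \<Omega>. G (\<lambda>x. a *\<^sub>R u x) = a * G u"
    using assms(2) by (simp_all add: bounded_functional_def)
  from add[rule_format, OF au bv] show ?thesis
    by (simp only: scale[rule_format, OF assms(3)] scale[rule_format, OF assms(4)])
qed

lemma sym_grad_eq: "sym_grad \<Omega> u x = sym_part (weak_deriv \<Omega> u x)"
  by (simp add: sym_grad_def sym_part_def)

lemma trace_lincomb: "trace (a *\<^sub>R A + b *\<^sub>R B) = a * trace A + b * trace (B :: real^'n^'n)"
  by (simp add: trace_def sum.distrib sum_distrib_left)

lemma dissipation_scalar:
  fixes G :: "(real^'n \<Rightarrow> real) \<Rightarrow> real"
  assumes P: "profile \<phi> q \<kappa> \<alpha> \<beta>" and \<Omega>: "open \<Omega>" "bounded \<Omega>"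
    and G: "bounded_functional (H10 \<Omega>) (sobolev_norm (L2_norm \<Omega>) \<Omega>) G"
  shows "\<exists>C. dissipation \<phi> q \<kappa> \<alpha> \<beta> \<Omega> (H10 \<Omega>) (weak_deriv \<Omega>) G C"
proof -
  obtain C where C: "\<forall>u\<in>H10 \<Omega>. \<bar>G u\<bar> \<le> C * sqrt (L2_sq \<Omega> (weak_deriv \<Omega> u))"
    using H10_functional_bound[OF \<Omega> G] by blast
  have "dissipation \<phi> q \<kappa> \<alpha> \<beta> \<Omega> (H10 \<Omega>) (weak_deriv \<Omega>) G C"
  proof (intro dissipation.intro P dissipation_axioms.intro)
    show "\<Omega> \<in> lmeasurable" using \<Omega> by (intro lmeasurable_open)
    show "(H10 \<Omega> :: (real^'n \<Rightarrow> real) set) \<noteq> {}" using H10_zero(1)[OF \<Omega>(1)] by blast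
    show "square_integrable (lebesgue_on \<Omega>) (weak_deriv \<Omega> u)" if "u \<in> H10 \<Omega>" for u
      by (rule H10_weak_deriv(3)[OF \<Omega>(1) that])
    show "\<bar>G u\<bar> \<le> C * sqrt (L2_sq \<Omega> (weak_deriv \<Omega> u))" if "u \<in> H10 \<Omega>" for u
      using C that by blast
    show "\<exists>w\<in>H10 \<Omega>. G w = (1 - s) * G u + s * G v \<and>
       (AE x in lebesgue_on \<Omega>. weak_deriv \<Omega> w x = (1 - s) *\<^sub>R weak_deriv \<Omega> u x + s *\<^sub>R weak_deriv \<Omega> v x)"
      if uv: "u \<in> H10 \<Omega>" "v \<in> H10 \<Omega>" for u v s
    proof (intro bexI conjI)
      show "(\<lambda>x. (1 - s) *\<^sub>R u x + s *\<^sub>R v x) \<in> H10 \<Omega>" by (rule H10_lincomb[OF \<Omega>(1) uv])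
      show "G (\<lambda>x. (1 - s) *\<^sub>R u x + s *\<^sub>R v x) = (1 - s) * G u + s * G v"
        by (rule H10_functional_comb[OF \<Omega>(1) G uv])
      show "AE x in lebesgue_on \<Omega>. weak_deriv \<Omega> (\<lambda>x. (1 - s) *\<^sub>R u x + s *\<^sub>R v x) x =
          (1 - s) *\<^sub>R weak_deriv \<Omega> u x + s *\<^sub>R weak_deriv \<Omega> v x"
        by (intro weak_deriv_lincomb H10_weak_deriv(1) \<Omega> uv)
    qed
  qed
  then show ?thesis ..
qed

lemma dissipation_vector:
  fixes G :: "(real^'n \<Rightarrow> real^'n) \<Rightarrow> real"
  assumes P: "profile \<phi> q \<kappa> \<alpha> \<beta>" and \<Omega>: "open \<Omega>" "bounded \<Omega>"
    and G: "bounded_functional (H10 \<Omega>) (sobolev_norm (L2_norm \<Omega>) \<Omega>) G"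
  shows "\<exists>C. dissipation \<phi> q \<kappa> \<alpha> \<beta> \<Omega> (H10_div \<Omega>) (sym_grad \<Omega>) G C"
proof -
  have sg: "sym_grad \<Omega> u = (\<lambda>x. sym_part (weak_deriv \<Omega> u x))" for u :: "real^'n \<Rightarrow> real^'n"
    by (rule ext) (rule sym_grad_eq)
  obtain C where C0: "C \<ge> 0" and C: "\<forall>u\<in>H10 \<Omega>. \<bar>G u\<bar> \<le> C * sqrt (L2_sq \<Omega> (weak_deriv \<Omega> u))"
    using H10_functional_bound[OF \<Omega> G] by blast
  have D: "u \<in> H10 \<Omega>" "AE x in lebesgue_on \<Omega>. trace (weak_deriv \<Omega> u x) = 0" if "u \<in> H10_div \<Omega>" for u :: "real^'n \<Rightarrow> real^'n"
    using that by (simp_all add: H10_div_def)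
  have "dissipation \<phi> q \<kappa> \<alpha> \<beta> \<Omega> (H10_div \<Omega>) (sym_grad \<Omega>) G (C * sqrt 8)"
  proof (intro dissipation.intro P dissipation_axioms.intro)
    show "\<Omega> \<in> lmeasurable" using \<Omega> by (intro lmeasurable_open)
    have "AE x in lebesgue_on \<Omega>. trace (weak_deriv \<Omega> (\<lambda>x. 0 :: real^'n) x) = 0"
      using H10_zero(2)[OF \<Omega>(1), where 'b = "real^'n"] by eventually_elim (simp add: trace_def)
    then have "(\<lambda>x. 0 :: real^'n) \<in> H10_div \<Omega>" using H10_zero(1)[OF \<Omega>(1)] by (simp add: H10_div_def)
    then show "H10_div \<Omega> \<noteq> {}" by blast
    show "square_integrable (lebesgue_on \<Omega>) (sym_grad \<Omega> u)" if "u \<in> H10_div \<Omega>" for u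
      unfolding sg by (intro square_integrable_sym_part H10_weak_deriv(3) \<Omega> D(1) that)
    show "\<bar>G u\<bar> \<le> C * sqrt 8 * sqrt (L2_sq \<Omega> (sym_grad \<Omega> u))"
      if u: "u \<in> H10_div \<Omega>" for u
    proof -
      have "\<bar>G u\<bar> \<le> C * sqrt (L2_sq \<Omega> (weak_deriv \<Omega> u))" using C D(1)[OF u] by blast
      also have "\<dots> \<le> C * sqrt (8 * L2_sq \<Omega> (sym_grad \<Omega> u))"
        unfolding sg by (intro mult_left_mono real_sqrt_le_mono H10_korn \<Omega> D(1) u C0)
      finally show ?thesis by (simp add: real_sqrt_mult)
    qed
    show "\<exists>w\<in>H10_div \<Omega>. G w = (1 - s) * G u + s * G v \<and>
       (AE x in lebesgue_on \<Omega>. sym_grad \<Omega> w x = (1 - s) *\<^sub>R sym_grad \<Omega> u x + s *\<^sub>R sym_grad \<Omega> v x)"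
      if uv: "u \<in> H10_div \<Omega>" "v \<in> H10_div \<Omega>" for u v s
    proof -
      let ?w = "\<lambda>x. (1 - s) *\<^sub>R u x + s *\<^sub>R v x"
      note d = D[OF uv(1)] D[OF uv(2)]
      have ae: "AE x in lebesgue_on \<Omega>. weak_deriv \<Omega> ?w x = (1 - s) *\<^sub>R weak_deriv \<Omega> u x + s *\<^sub>R weak_deriv \<Omega> v x"
        by (intro weak_deriv_lincomb H10_weak_deriv(1) \<Omega> d)
      then have "AE x in lebesgue_on \<Omega>. trace (weak_deriv \<Omega> ?w x) = 0"
        using d(2) d(4) by eventually_elim (simp add: trace_lincomb)
      then have "?w \<in> H10_div \<Omega>" using H10_lincomb[OF \<Omega>(1) d(1) d(3)] by (simp add: H10_div_def)
      moreover have "G ?w = (1 - s) * G u + s * G v" by (rule H10_functional_comb[OF \<Omega>(1) G d(1) d(3)])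
      moreover have "AE x in lebesgue_on \<Omega>. sym_grad \<Omega> ?w x = (1 - s) *\<^sub>R sym_grad \<Omega> u x + s *\<^sub>R sym_grad \<Omega> v x"
        using ae unfolding sym_grad_eq by eventually_elim (simp only: sym_part_linear)
      ultimately show ?thesis by blast
    qed
  qed
  then show ?thesis ..
qed

section \<open>Verification of the hypotheses on the density\<close>

context density
begin

lemma Phi_increment:
  assumes "0 < a" "a < b"
  shows "\<exists>x. a < x \<and> x < b \<and> Phi \<phi> b - Phi \<phi> a = (b - a) * (mu \<phi> x / 2)"
  by (rule MVT2[OF assms(2)]) (use assms in \<open>auto intro: Phi_has_derivative\<close>)

text \<open>The points \<open>1\<close>, \<open>2\<close>, \<open>3\<close> are an arbitrary equidistant triple: convexity or concavity of \<open>\<Phi>\<close> fixes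
  the sign of the second difference, and the mean value theorem relates it to the monotonicity of
  \<open>\<mu>\<close>.\<close>

lemma Phi_second_difference:
  obtains x y where "0 < x" "x < y" "Phi \<phi> 3 - 2 * Phi \<phi> 2 + Phi \<phi> 1 = (mu \<phi> y - mu \<phi> x) / 2"
proof -
  obtain x where x: "1 < x" "x < 2" "Phi \<phi> 2 - Phi \<phi> 1 = (2 - 1) * (mu \<phi> x / 2)"
    using Phi_increment[of 1 2] by auto
  obtain y where y: "2 < y" "y < 3" "Phi \<phi> 3 - Phi \<phi> 2 = (3 - 2) * (mu \<phi> y / 2)"
    using Phi_increment[of 2 3] by auto
  show ?thesis by (rule that[of x y]) (use x y in auto)
qed

lemma not_convex_if_mu_decreasing:
  assumes "\<forall>r>0. deriv (mu \<phi>) r < 0" shows "\<not> convex_on {0<..} (Phi \<phi>)"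
proof
  assume c: "convex_on {0<..} (Phi \<phi>)"
  obtain x y where xy: "0 < x" "x < y" "Phi \<phi> 3 - 2 * Phi \<phi> 2 + Phi \<phi> 1 = (mu \<phi> y - mu \<phi> x) / 2"
    by (rule Phi_second_difference)
  have "mu \<phi> y < mu \<phi> x"
  proof (rule DERIV_neg_imp_decreasing[OF xy(2)])
    fix z assume "x \<le> z" "z \<le> y"
    then have "z > 0" using xy by linarith
    with assms mu_has_derivative[OF this] show "\<exists>d. (mu \<phi> has_real_derivative d) (at z) \<and> d < 0" by blast
  qed
  moreover have "Phi \<phi> ((1 - 1/2) *\<^sub>R 1 + (1/2) *\<^sub>R 3) \<le> (1 - 1/2) * Phi \<phi> 1 + 1/2 * Phi \<phi> 3"
    by (rule convex_onD[OF c]) auto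
  ultimately show False using xy(3) by simp
qed

lemma not_concave_if_mu_increasing:
  assumes "\<forall>r>0. deriv (mu \<phi>) r > 0" shows "\<not> concave_on {0<..} (Phi \<phi>)"
proof
  assume c: "concave_on {0<..} (Phi \<phi>)"
  obtain x y where xy: "0 < x" "x < y" "Phi \<phi> 3 - 2 * Phi \<phi> 2 + Phi \<phi> 1 = (mu \<phi> y - mu \<phi> x) / 2"
    by (rule Phi_second_difference)
  have "mu \<phi> x < mu \<phi> y"
  proof (rule DERIV_pos_imp_increasing[OF xy(2)])
    fix z assume "x \<le> z" "z \<le> y"
    then have "z > 0" using xy by linarith
    with assms mu_has_derivative[OF this] show "\<exists>d. (mu \<phi> has_real_derivative d) (at z) \<and> d > 0" by blast
  qed
  moreover have "- Phi \<phi> ((1 - 1/2) *\<^sub>R 1 + (1/2) *\<^sub>R 3) \<le> (1 - 1/2) * (- Phi \<phi> 1) + 1/2 * (- Phi \<phi> 3)"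
    by (rule convex_onD[OF c[unfolded concave_on_def]]) auto
  ultimately show False using xy(3) by simp
qed

lemma pos_mult_sign:
  fixes k y :: real
  assumes "k > 0" shows "0 < k * (y - 1) \<longleftrightarrow> 1 < y" "k * (y - 1) < 0 \<longleftrightarrow> y < 1"
  using assms by (simp_all add: zero_less_mult_iff mult_less_0_iff)

lemma second_index_sign:
  assumes "t > 0"
  shows "deriv (mu \<phi>) (t\<^sup>2) > 0 \<longleftrightarrow> t * deriv (deriv \<phi>) t / deriv \<phi> t > 1"
    "deriv (mu \<phi>) (t\<^sup>2) < 0 \<longleftrightarrow> t * deriv (deriv \<phi>) t / deriv \<phi> t < 1"
proof -
  have p: "t\<^sup>2 > 0" using assms by simp
  have "mu \<phi> (t\<^sup>2) / (2 * t\<^sup>2) > 0" using mu_pos[OF p] p by simp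
  moreover have "sqrt (t\<^sup>2) = t" using assms by simp
  ultimately show "deriv (mu \<phi>) (t\<^sup>2) > 0 \<longleftrightarrow> t * deriv (deriv \<phi>) t / deriv \<phi> t > 1"
    "deriv (mu \<phi>) (t\<^sup>2) < 0 \<longleftrightarrow> t * deriv (deriv \<phi>) t / deriv \<phi> t < 1"
    unfolding deriv_mu_index[OF p] by (simp_all only: pos_mult_sign)
qed

end

lemma density_if_N_function:
  assumes N: "N_function \<phi>" and C3: "C3_pos \<phi>"
    and lower: "(INF r\<in>{0<..}. ereal (r * deriv \<phi> r / \<phi> r)) > 1"
    and upper: "(SUP r\<in>{0<..}. ereal (r * deriv \<phi> r / \<phi> r)) < \<infinity>"
  shows "\<exists>q. density \<phi> q"
proof -
  have pos: "\<phi> r > 0" if "r > 0" for r using N that by (simp add: N_function_def)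
  have diff: "(deriv ^^ k) \<phi> differentiable (at r)" if "k < 3" "r > 0" for k r
  proof -
    have "(deriv ^^ k) \<phi> differentiable_on {0<..}" using C3 that by (simp add: C3_pos_def)
    then show ?thesis using that by (simp add: differentiable_on_eq_differentiable_at)
  qed
  let ?s = "SUP r\<in>{0<..}. ereal (r * deriv \<phi> r / \<phi> r)"
  have "ereal (1 * deriv \<phi> 1 / \<phi> 1) \<le> ?s" by (rule SUP_upper) simp
  then have "?s \<noteq> - \<infinity>" by auto
  then obtain q where q: "?s = ereal q" using upper by (cases ?s) auto
  have "density \<phi> q"
  proof
    show "\<phi> 0 = 0" "continuous_on {0..} \<phi>" "filterlim (\<lambda>r. \<phi> r / r) at_top at_top"
      using N by (simp_all add: N_function_def)
    fix r :: real assume r: "r > 0"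
    show "\<phi> r > 0" by (rule pos[OF r])
    show "(\<phi> has_real_derivative deriv \<phi> r) (at r)"
      using diff[of 0, OF _ r] by (simp add: DERIV_deriv_iff_real_differentiable)
    show "(deriv \<phi> has_real_derivative deriv (deriv \<phi>) r) (at r)"
      using diff[of 1, OF _ r] by (simp add: DERIV_deriv_iff_real_differentiable)
    show "deriv (deriv \<phi>) differentiable (at r)"
      using diff[of 2, OF _ r] by (simp add: numeral_2_eq_2)
    have "1 < ereal (r * deriv \<phi> r / \<phi> r)"
      by (rule less_le_trans[OF lower INF_lower]) (use r in simp)
    then have "1 < r * deriv \<phi> r / \<phi> r" by (simp add: one_ereal_def)
    then show "\<phi> r \<le> r * deriv \<phi> r" using pos[OF r] by (simp add: pos_less_divide_eq)
    have "ereal (r * deriv \<phi> r / \<phi> r) \<le> ereal q" unfolding q[symmetric] by (rule SUP_upper) (use r in simp)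
    then have "r * deriv \<phi> r / \<phi> r \<le> q" by simp
    then show "r * deriv \<phi> r \<le> q * \<phi> r" using pos[OF r] by (simp add: pos_divide_le_eq)
  qed
  then show ?thesis ..
qed

text \<open>The shape of \<open>\<Phi>\<close> determines the sign of \<open>\<mu>'\<close>, this sign determines on which side of \<open>1\<close> the
  quotient \<open>r \<phi>'' / \<phi>'\<close> lies, and hence which of the two alternatives for its bounds holds.\<close>

lemma profile_if_curvature:
  fixes \<phi> :: "real \<Rightarrow> real"
  assumes "density \<phi> q"
    and mono: "(\<forall>r>0. deriv (mu \<phi>) r > 0) \<or> (\<forall>r>0. deriv (mu \<phi>) r < 0)"
    and S: "(0 < S_minus \<phi> \<and> S_minus \<phi> \<le> S_plus \<phi> \<and> S_plus \<phi> < 1) \<or>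
         (1 < S_minus \<phi> \<and> S_minus \<phi> \<le> S_plus \<phi> \<and> S_plus \<phi> < \<infinity>)"
    and curv: "(convex_on {0<..} (Phi \<phi>) \<and> P) \<or> (concave_on {0<..} (Phi \<phi>) \<and> Q)"
  shows "\<exists>\<kappa> \<alpha> \<beta>. profile \<phi> q \<kappa> \<alpha> \<beta> \<and> ((\<kappa> = 1 \<and> P) \<or> (\<kappa> = - 1 \<and> Q))"
proof -
  interpret density \<phi> q by fact
  let ?S = "\<lambda>r. r * deriv (deriv \<phi>) r / deriv \<phi> r"
  have lo: "S_minus \<phi> \<le> ereal (?S r)" if "r > 0" for r
    unfolding S_minus_def by (rule INF_lower) (use that in simp)
  have hi: "ereal (?S r) \<le> S_plus \<phi>" if "r > 0" for r
    unfolding S_plus_def by (rule SUP_upper) (use that in simp)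
  have "S_minus \<phi> \<noteq> \<infinity>" "S_plus \<phi> \<noteq> - \<infinity>" using lo[of 1] hi[of 1] by auto
  moreover have "S_minus \<phi> \<noteq> - \<infinity>" "S_plus \<phi> \<noteq> \<infinity>" using S by auto
  ultimately obtain a b where ab: "S_minus \<phi> = ereal a" "S_plus \<phi> = ereal b"
    by (cases "S_minus \<phi>"; cases "S_plus \<phi>") auto
  have lo': "a \<le> ?S r" and hi': "?S r \<le> b" if "r > 0" for r
    using lo[OF that] hi[OF that] unfolding ab by simp_all
  have S': "b < 1 \<or> 1 < a" using S unfolding ab by (auto simp: one_ereal_def)
  show ?thesis using curv
  proof (elim disjE conjE)
    assume c: "convex_on {0<..} (Phi \<phi>)" and P
    have m: "\<forall>r>0. deriv (mu \<phi>) r > 0" using mono not_convex_if_mu_decreasing c by blast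
    have "?S 1 > 1" using second_index_sign(1)[of 1] m by simp
    then have a: "1 < a" using S' hi'[of 1] by linarith
    have "profile \<phi> q 1 (a - 1) (b - 1)"
    proof (intro profile.intro profile_axioms.intro)
      show "density \<phi> q" by fact
      show "omega \<phi> = 1" using c by (simp add: omega_def)
    qed (use a lo' hi' in \<open>simp_all\<close>)
    with \<open>P\<close> show ?thesis by blast
  next
    assume c: "concave_on {0<..} (Phi \<phi>)" and Q
    have m: "\<forall>r>0. deriv (mu \<phi>) r < 0" using mono not_concave_if_mu_increasing c by blast
    have "?S 1 < 1" using second_index_sign(2)[of 1] m by simp
    then have b: "b < 1" using S' lo'[of 1] by linarith
    have "profile \<phi> q (- 1) (1 - b) (1 - a)"
    proof (intro profile.intro profile_axioms.intro)
      show "density \<phi> q" by fact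
      show "omega \<phi> = - 1" using not_convex_if_mu_decreasing[OF m] by (simp add: omega_def)
    qed (use b lo' hi' in \<open>simp_all\<close>)
    with \<open>Q\<close> show ?thesis by blast
  qed
qed

text \<open>As an infimum over a nonempty set of reals the constant is not \<open>\<infinity>\<close>, so the conversion to a real
  number loses nothing.\<close>

lemma convexity_const_lower:
  assumes "convexity_const \<phi> > - \<infinity>" "r > 0"
  shows "real_of_ereal (convexity_const \<phi>) \<le> 1 + r * deriv (deriv (mu \<phi>)) r / (2 * deriv (mu \<phi>) r)"
proof -
  have "convexity_const \<phi> \<le> ereal (1 + r * deriv (deriv (mu \<phi>)) r / (2 * deriv (mu \<phi>) r))"
    unfolding convexity_const_def by (rule INF_lower) (use assms(2) in simp)
  with assms(1) show ?thesis by (cases "convexity_const \<phi>") auto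
qed

theorem theorem3p9:
  fixes \<phi> :: "real \<Rightarrow> real" and \<Omega> :: "(real^'n) set"
  assumes "CARD('n) = 2 \<or> CARD('n) = 3"
    and "open \<Omega>" and "connected \<Omega>" and "bounded \<Omega>" and "\<Omega> \<noteq> {}"
    and "N_function \<phi>" and "C1_nonneg \<phi>" and "C3_pos \<phi>"
    and "(INF r\<in>{0<..}. ereal (r * deriv \<phi> r / \<phi> r)) > 1"
    and "(SUP r\<in>{0<..}. ereal (r * deriv \<phi> r / \<phi> r)) < \<infinity>"
    and "(\<forall>r>0. deriv (mu \<phi>) r > 0) \<or> (\<forall>r>0. deriv (mu \<phi>) r < 0)"
    and "(0 < S_minus \<phi> \<and> S_minus \<phi> \<le> S_plus \<phi> \<and> S_plus \<phi> < 1) \<or>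
         (1 < S_minus \<phi> \<and> S_minus \<phi> \<le> S_plus \<phi> \<and> S_plus \<phi> < \<infinity>)"
    and "convexity_const \<phi> > - \<infinity>"
    and "(convex_on {0<..} (Phi \<phi>) \<and> (\<forall>r>0. deriv (deriv (mu \<phi>)) r \<le> 0)) \<or>
         (concave_on {0<..} (Phi \<phi>) \<and>
           (\<forall>r>0. deriv (deriv (mu \<phi>)) r \<ge> 4 * (deriv (mu \<phi>) r)\<^sup>2 / mu \<phi> r))"
  shows "(\<forall>F G. extends_to_H10 \<phi> \<Omega> F G \<longrightarrow>
            (\<forall>\<epsilon>\<in>{0<..<1}. geodesically_convex \<phi> \<Omega> (real_of_ereal (convexity_const \<phi>))
               (E_eps \<phi> \<Omega> (J_F_scalar \<phi> \<Omega> G) \<epsilon>))) \<and>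
         (\<forall>F G. extends_to_H10 \<phi> \<Omega> F G \<longrightarrow>
            (\<forall>\<epsilon>\<in>{0<..<1}. geodesically_convex \<phi> \<Omega> (real_of_ereal (convexity_const \<phi>))
               (E_eps \<phi> \<Omega> (J_F_vector \<phi> \<Omega> G) \<epsilon>)))"
proof -
  obtain q where "density \<phi> q"
    using density_if_N_function[OF assms(6,8-10)] by blast
  from profile_if_curvature[OF this assms(11,12,14)]
  obtain \<kappa> \<alpha> \<beta> where P: "profile \<phi> q \<kappa> \<alpha> \<beta>"
    and cases: "(\<kappa> = 1 \<and> (\<forall>r>0. deriv (deriv (mu \<phi>)) r \<le> 0)) \<or>
      (\<kappa> = - 1 \<and> (\<forall>r>0. 4 * (deriv (mu \<phi>) r)\<^sup>2 / mu \<phi> r \<le> deriv (deriv (mu \<phi>)) r))"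
    by (elim exE conjE)
  note l = convexity_const_lower[OF assms(13)]
  show ?thesis
  proof (intro conjI allI impI ballI)
    fix F G :: "(real^'n \<Rightarrow> real) \<Rightarrow> real" and \<epsilon> :: real
    assume ext: "extends_to_H10 \<phi> \<Omega> F G" and "\<epsilon> \<in> {0<..<1}"
    then have \<epsilon>: "0 < \<epsilon>" "\<epsilon> < 1" by simp_all
    have "bounded_functional (H10 \<Omega>) (sobolev_norm (L2_norm \<Omega>) \<Omega>) G"
      using ext unfolding extends_to_H10_def by blast
    from dissipation_scalar[OF P assms(2,4) this]
    obtain C where D: "dissipation \<phi> q \<kappa> \<alpha> \<beta> \<Omega> (H10 \<Omega>) (weak_deriv \<Omega>) G C" ..
    have "J_F_scalar \<phi> \<Omega> G = dissipation.inf_energy \<phi> \<Omega> (H10 \<Omega>) (weak_deriv \<Omega>) G"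
      unfolding J_F_scalar_def[abs_def] dissipation.inf_energy_def[OF D, abs_def] dissipation.energy_def[OF D] by (rule refl)
    then show "geodesically_convex \<phi> \<Omega> (real_of_ereal (convexity_const \<phi>)) (E_eps \<phi> \<Omega> (J_F_scalar \<phi> \<Omega> G) \<epsilon>)"
      using dissipation.geodesically_convex_energy[OF D cases l \<epsilon>] by (simp only:)
  next
    fix F G :: "(real^'n \<Rightarrow> real^'n) \<Rightarrow> real" and \<epsilon> :: real
    assume ext: "extends_to_H10 \<phi> \<Omega> F G" and "\<epsilon> \<in> {0<..<1}"
    then have \<epsilon>: "0 < \<epsilon>" "\<epsilon> < 1" by simp_all
    have "bounded_functional (H10 \<Omega>) (sobolev_norm (L2_norm \<Omega>) \<Omega>) G"
      using ext unfolding extends_to_H10_def by blast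
    from dissipation_vector[OF P assms(2,4) this]
    obtain C where D: "dissipation \<phi> q \<kappa> \<alpha> \<beta> \<Omega> (H10_div \<Omega>) (sym_grad \<Omega>) G C" ..
    have "J_F_vector \<phi> \<Omega> G = dissipation.inf_energy \<phi> \<Omega> (H10_div \<Omega>) (sym_grad \<Omega>) G"
      unfolding J_F_vector_def[abs_def] dissipation.inf_energy_def[OF D, abs_def] dissipation.energy_def[OF D] by (rule refl)
    then show "geodesically_convex \<phi> \<Omega> (real_of_ereal (convexity_const \<phi>)) (E_eps \<phi> \<Omega> (J_F_vector \<phi> \<Omega> G) \<epsilon>)"
      using dissipation.geodesically_convex_energy[OF D cases l \<epsilon>] by (simp only:)
  qed
qed

end
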